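(* Let $\mathcal C$ be a hereditary, topologically closed class of finite graphs which is either somewhere dense or has bounded expansion. Then the following are equivalent: (1) for every integer $p$ there is a non-bipartite finite graph $H_p$ of odd-girth strictly greater than $2p+1$ such that $H_p$-coloring is first-order definable on $\mathcal C$; (2) the class $\mathcal C$ has bounded expansion. Moreover, suppose the following statement ( * ) holds: "for every monotone nowhere dense class $\mathcal D$ of graphs that does not have bounded expansion there exists an integer $p$ such that $\mathcal D$ contains $p$-subdivisions of graphs with arbitrarily large chromatic number and arbitrarily large girth". Then the equivalence of (1) and (2) holds for every hereditary, addable, topologically closed class $\mathcal C$ of finite graphs.
   Context: Graphs are finite, simple and undirected. A class $\mathcal C$ is hereditary if it is closed under induced subgraphs, monotone if closed under subgraphs, addable if closed under disjoint unions, and topologically closed if every subdivision of a graph in $\mathcal C$ is in $\mathcal C$. The $k$-subdivision of a graph $G$ is obtained by replacing every edge by a path of length $k+1$; a $\le k$-subdivision replaces every edge by a path of length at most $k+1$. For a half-integer $p$, $H$ is a shallow topological minor of $G$ at depth $p$ if some $\le 2p$-subdivision of $H$ is a subgraph of $G$; $\mathcal C\,\widetilde\triangledown\, p$ denotes the class of all such minors of graphs in $\mathcal C$. $\mathcal C$ is somewhere dense if there is an integer $p$ such that the $p$-subdivision of every finite graph is a subgraph of some graph in $\mathcal C$, and nowhere dense otherwise (equivalently, the clique number of $\mathcal C\,\widetilde\triangledown\, p$ is finite for every $p$). $\mathcal C$ has bounded expansion if for every integer $p$ the average degrees of the shallow minors at depth $p$ of graphs in $\mathcal C$ are bounded (equivalently,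 the average degrees of graphs in $\mathcal C\,\widetilde\triangledown\, p$ are bounded). The odd-girth of a graph is the length of its shortest odd cycle. $G\to H$ means there is a homomorphism from $G$ to $H$. $H$-coloring is first-order definable on $\mathcal C$ if there is a first-order sentence $\Phi$ in the language of graphs (one binary adjacency relation) such that for every $G\in\mathcal C$, $G\models\Phi$ if and only if $G\to H$. *)

theory Defs
  imports
    Complex_Main
    "HOL-Library.Extended_Nat"
    "Graph_Theory.Graph_Theory"
begin

text \<open>
  A finite simple undirected graph is a \<^const>\<open>pair_graph\<close>: a finite, loop-free, symmetric
  digraph whose arcs are pairs. Every undirected edge is thus represented by two opposite arcs,
  and the null graph is admitted.
\<close>

section \<open>Classes of finite graphs\<close>

text \<open>
  Every finite graph has an isomorphic copy with vertices in \<^typ>\<open>nat\<close>, so a class of finite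
  graphs is an isomorphism-closed set of graphs on natural numbers.
\<close>

definition graph_class :: "nat pair_pre_digraph set \<Rightarrow> bool" where
  "graph_class \<C> \<longleftrightarrow>
     (\<forall>G\<in>\<C>. pair_graph G) \<and>
     (\<forall>G\<in>\<C>. \<forall>H :: nat pair_pre_digraph.
        digraph_iso (with_proj G) (with_proj H) \<longrightarrow> H \<in> \<C>)"

definition hereditary :: "nat pair_pre_digraph set \<Rightarrow> bool" where
  "hereditary \<C> \<longleftrightarrow>
     (\<forall>G\<in>\<C>. \<forall>H :: nat pair_pre_digraph.
        induced_subgraph (with_proj H) (with_proj G) \<longrightarrow> H \<in> \<C>)"

text \<open>A subgraph of a symmetric digraph need not be symmetric, hence the \<^const>\<open>pair_graph\<close> guard.\<close>

definition monotone_class :: "nat pair_pre_digraph set \<Rightarrow> bool" where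
  "monotone_class \<C> \<longleftrightarrow>
     (\<forall>G\<in>\<C>. \<forall>H. pair_graph H \<and> subgraph (with_proj H) (with_proj G) \<longrightarrow> H \<in> \<C>)"

text \<open>
  For isomorphism-closed classes, it suffices to consider graphs with disjoint vertex sets.
\<close>

definition addable :: "nat pair_pre_digraph set \<Rightarrow> bool" where
  "addable \<C> \<longleftrightarrow>
     (\<forall>G\<in>\<C>. \<forall>H\<in>\<C>. pverts G \<inter> pverts H = {} \<longrightarrow>
        \<lparr>pverts = pverts G \<union> pverts H, parcs = parcs G \<union> parcs H\<rparr> \<in> \<C>)"

definition topologically_closed :: "nat pair_pre_digraph set \<Rightarrow> bool" where
  "topologically_closed \<C> \<longleftrightarrow> (\<forall>G\<in>\<C>. \<forall>H. subdivision_pair G H \<longrightarrow> H \<in> \<C>)"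


section \<open>Somewhere dense classes and bounded expansion\<close>

text \<open>
  \<open>S\<close> is, up to isomorphism, the \<open>k\<close>-subdivision of \<open>H\<close>: the map \<open>f\<close> embeds the vertices of
  \<open>H\<close>, and \<open>P (x, y)\<close> is the path of length \<open>k + 1\<close> replacing the edge between \<open>x\<close> and \<open>y\<close>,
  the two arcs of an edge being replaced by the same path in the two directions.
\<close>

definition k_subdivision :: "nat \<Rightarrow> 'a pair_pre_digraph \<Rightarrow> 'b pair_pre_digraph \<Rightarrow> bool" where
  "k_subdivision k H S \<longleftrightarrow>
     pair_graph H \<and> pair_graph S \<and>
     (\<exists>(f :: 'a \<Rightarrow> 'b) (P :: 'a \<times> 'a \<Rightarrow> 'b list).
        inj_on f (pverts H) \<and>
        (\<forall>(x, y)\<in>parcs H.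
           vpath (P (x, y)) (with_proj S) \<and>
           hd (P (x, y)) = f x \<and> last (P (x, y)) = f y \<and>
           vwalk_length (P (x, y)) = k + 1 \<and>
           P (y, x) = rev (P (x, y)) \<and>
           set (P (x, y)) \<inter> f ` pverts H = {f x, f y}) \<and>
        (\<forall>(x, y)\<in>parcs H. \<forall>(x', y')\<in>parcs H. {x, y} \<noteq> {x', y'} \<longrightarrow>
           set (P (x, y)) \<inter> set (P (x', y')) \<subseteq> f ` pverts H) \<and>
        pverts S = f ` pverts H \<union> (\<Union>e\<in>parcs H. set (P e)) \<and>
        parcs S = (\<Union>e\<in>parcs H. set (vwalk_arcs (P e))))"

definition somewhere_dense :: "nat pair_pre_digraph set \<Rightarrow> bool" where
  "somewhere_dense \<C> \<longleftrightarrow>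
     (\<exists>p. \<forall>H :: nat pair_pre_digraph. pair_graph H \<longrightarrow>
        (\<exists>G\<in>\<C>. \<exists>S. k_subdivision p H S \<and> subgraph (with_proj S) (with_proj G)))"

definition nowhere_dense :: "nat pair_pre_digraph set \<Rightarrow> bool" where
  "nowhere_dense \<C> \<longleftrightarrow> \<not> somewhere_dense \<C>"

text \<open>
  \<open>H\<close> is a shallow minor of \<open>G\<close> at depth \<open>p\<close>: it is obtained by contracting pairwise disjoint
  connected subgraphs of radius at most \<open>p\<close> and taking a subgraph. Here \<open>B x\<close> is the branch set
  contracted to the vertex \<open>x\<close> of \<open>H\<close>, and \<open>c x\<close> is a center of \<open>B x\<close>.
\<close>

definition shallow_minor :: "nat \<Rightarrow> 'a pair_pre_digraph \<Rightarrow> 'b pair_pre_digraph \<Rightarrow> bool" where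
  "shallow_minor p H G \<longleftrightarrow>
     pair_graph H \<and> pair_graph G \<and>
     (\<exists>(B :: 'a \<Rightarrow> 'b set) (c :: 'a \<Rightarrow> 'b).
        (\<forall>x\<in>pverts H. B x \<subseteq> pverts G \<and> c x \<in> B x \<and>
           (\<forall>v\<in>B x. \<exists>w. vwalk w (with_proj G \<restriction> B x) \<and>
              hd w = c x \<and> last w = v \<and> vwalk_length w \<le> p)) \<and>
        (\<forall>x\<in>pverts H. \<forall>y\<in>pverts H. x \<noteq> y \<longrightarrow> B x \<inter> B y = {}) \<and>
        (\<forall>(x, y)\<in>parcs H. \<exists>u\<in>B x. \<exists>v\<in>B y. (u, v) \<in> parcs G))"

text \<open>
  As \<^const>\<open>parcs\<close> counts every edge twice, this is twice the number of edges divided by the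
  number of vertices; it is \<open>0\<close> for the null graph.
\<close>

definition average_degree :: "'a pair_pre_digraph \<Rightarrow> real" where
  "average_degree G = real (card (parcs G)) / real (card (pverts G))"

definition bounded_expansion :: "nat pair_pre_digraph set \<Rightarrow> bool" where
  "bounded_expansion \<C> \<longleftrightarrow>
     (\<forall>p. \<exists>b. \<forall>G\<in>\<C>. \<forall>H :: nat pair_pre_digraph.
        shallow_minor p H G \<longrightarrow> average_degree H \<le> b)"


section \<open>Colorings and cycles\<close>

definition graph_hom :: "'a pair_pre_digraph \<Rightarrow> 'b pair_pre_digraph \<Rightarrow> bool" where
  "graph_hom G H \<longleftrightarrow>
     (\<exists>f. f ` pverts G \<subseteq> pverts H \<and> (\<forall>(u, v)\<in>parcs G. (f u, f v) \<in> parcs H))"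

definition bipartite :: "'a pair_pre_digraph \<Rightarrow> bool" where
  "bipartite G \<longleftrightarrow>
     (\<exists>A B. A \<union> B = pverts G \<and> A \<inter> B = {} \<and> parcs G \<subseteq> A \<times> B \<union> B \<times> A)"

definition chromatic_number :: "'a pair_pre_digraph \<Rightarrow> nat" where
  "chromatic_number G =
     (LEAST k. \<exists>col :: 'a \<Rightarrow> nat.
        (\<forall>v\<in>pverts G. col v < k) \<and> (\<forall>(u, v)\<in>parcs G. col u \<noteq> col v))"

text \<open>
  The directed cycles of a symmetric digraph include the closed walks that traverse one edge back
  and forth; cycles of an undirected graph are those of length at least three.
\<close>

definition undirected_cycle :: "'a pair_pre_digraph \<Rightarrow> ('a \<times> 'a) list \<Rightarrow> bool" where
  "undirected_cycle G p \<longleftrightarrow> pre_digraph.cycle (with_proj G) p \<and> length p \<ge> 3"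

text \<open>The infima are \<open>\<infinity>\<close> if there is no (odd) cycle.\<close>

definition girth :: "'a pair_pre_digraph \<Rightarrow> enat" where
  "girth G = (INF p\<in>{p. undirected_cycle G p}. enat (length p))"

definition odd_girth :: "'a pair_pre_digraph \<Rightarrow> enat" where
  "odd_girth G = (INF p\<in>{p. undirected_cycle G p \<and> odd (length p)}. enat (length p))"


section \<open>First-order definability\<close>

datatype fo_formula =
    FO_Eq nat nat
  | FO_Adj nat nat
  | FO_Neg fo_formula
  | FO_And fo_formula fo_formula
  | FO_Ex nat fo_formula

primrec free_vars :: "fo_formula \<Rightarrow> nat set" where
  "free_vars (FO_Eq i j) = {i, j}"
| "free_vars (FO_Adj i j) = {i, j}"
| "free_vars (FO_Neg \<phi>) = free_vars \<phi>"
| "free_vars (FO_And \<phi> \<psi>) = free_vars \<phi> \<union> free_vars \<psi>"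
| "free_vars (FO_Ex i \<phi>) = free_vars \<phi> - {i}"

definition sentence :: "fo_formula \<Rightarrow> bool" where
  "sentence \<phi> \<longleftrightarrow> free_vars \<phi> = {}"

primrec fo_sat :: "'a pair_pre_digraph \<Rightarrow> (nat \<Rightarrow> 'a) \<Rightarrow> fo_formula \<Rightarrow> bool" where
  "fo_sat G s (FO_Eq i j) \<longleftrightarrow> s i = s j"
| "fo_sat G s (FO_Adj i j) \<longleftrightarrow> (s i, s j) \<in> parcs G"
| "fo_sat G s (FO_Neg \<phi>) \<longleftrightarrow> \<not> fo_sat G s \<phi>"
| "fo_sat G s (FO_And \<phi> \<psi>) \<longleftrightarrow> fo_sat G s \<phi> \<and> fo_sat G s \<psi>"
| "fo_sat G s (FO_Ex i \<phi>) \<longleftrightarrow> (\<exists>v\<in>pverts G. fo_sat G (s(i := v)) \<phi>)"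

text \<open>
  The truth of a sentence does not depend on the assignment. Assignments are not required to take
  values in \<^term>\<open>pverts G\<close>, so that the quantification is not vacuous for the null graph.
\<close>

definition fo_models :: "'a pair_pre_digraph \<Rightarrow> fo_formula \<Rightarrow> bool" where
  "fo_models G \<phi> \<longleftrightarrow> (\<forall>s. fo_sat G s \<phi>)"

definition coloring_fo_definable :: "'b pair_pre_digraph \<Rightarrow> 'a pair_pre_digraph set \<Rightarrow> bool" where
  "coloring_fo_definable H \<C> \<longleftrightarrow>
     (\<exists>\<Phi>. sentence \<Phi> \<and> (\<forall>G\<in>\<C>. fo_models G \<Phi> \<longleftrightarrow> graph_hom G H))"

definition fo_definable_large_odd_girth :: "nat pair_pre_digraph set \<Rightarrow> bool" where
  "fo_definable_large_odd_girth \<C> \<longleftrightarrow>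
     (\<forall>p :: nat. \<exists>H :: nat pair_pre_digraph.
        pair_graph H \<and> \<not> bipartite H \<and> odd_girth H > enat (2 * p + 1) \<and>
        coloring_fo_definable H \<C>)"

end

theory Submission
  imports Defs
begin

text \<open>
  Bounded expansion implies definability. Graphs with sparse shallow minors have vertex orders with
  bounded weakly reachable sets, and colouring the vertices so that weakly reachable sets are
  rainbow makes every union of at most \<open>q = 2 p + 1\<close> colour classes a graph of bounded tree-depth.
  Label a vertex by its colour and, for each such union containing it, by its depth and the lengths
  up to \<open>q\<close> of the walks between its ancestors. There are finitely many labels, and an odd closed
  walk of length at most \<open>q\<close> among the labels can be reassembled into one in an actual graph.
  The graph of labels plus an odd cycle of length \<open>2 p + 3\<close> is therefore a target for which colouring
  means having no odd closed walk of length at most \<open>q\<close>, which is first-order.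

  Conversely, subdividing an edge and deleting the new vertex shows that hereditary topologically
  closed classes are monotone. If the class contains subdivisions of graphs of large odd girth and
  large chromatic number (shift graphs in the somewhere dense case), their edges can be replaced by
  paths of an odd length \<open>m\<close> below the odd girth of \<open>H\<close>; such a subdivision \<open>B\<close> is not \<open>H\<close>-colourable,
  because an edge with equally coloured ends of the original graph would give a closed walk of
  length \<open>m\<close> in \<open>H\<close>. All balls of \<open>B\<close> are bipartite. Many
  disjoint balls of \<open>B\<close>, with and without a copy of \<open>B\<close> added, satisfy the same sentences of
  small quantifier rank, but only the graph without \<open>B\<close> is \<open>H\<close>-colourable.
\<close>

section \<open>Shallow minors and fans\<close>

text \<open>The obstacle in the first direction: consecutive arcs of a walk of labels may be
  witnessed by different graphs, so the walk has no lift to a single one. But a walk of length at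
  most \<open>q\<close> meets at most \<open>q\<close> colours, so all its labels can be read at one
  set of colours, where the ends of every arc are comparable in an elimination forest. The label of
  the upper end is then a truncation of the label of the lower end, so data about shallow ancestors
  pass unchanged from one graph to the next; at a label of least depth they record a closed walk of
  odd length. In the other direction the order of choices matters. The path length \<open>m\<close>
  depends on the class only, \<open>H\<close> is taken with odd girth beyond \<open>m\<close>, the
  sentence comes with \<open>H\<close>, and the graph to be subdivided is chosen last: not
  colourable with as many colours as \<open>H\<close> has vertices, and without odd closed walks
  inside the balls, whose radius is \<open>2\<close> to the quantifier rank. Hence one subdivision
  length has to serve graphs of arbitrarily large odd girth and chromatic number.\<close>

abbreviation linked :: "('a \<times> 'a) set \<Rightarrow> 'a set \<Rightarrow> 'a \<Rightarrow> 'a \<Rightarrow> bool" where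
  "linked E X u v \<equiv> (u, v) \<in> (Restr E X)\<^sup>*"

lemma linked_mono: "linked E X u v \<Longrightarrow> X \<subseteq> Y \<Longrightarrow> linked E Y u v"
  by (rule rtrancl_mono[THEN subsetD]) auto

lemma linked_sym: "sym E \<Longrightarrow> linked E X u v \<Longrightarrow> linked E X v u"
  by (rule symD[OF sym_rtrancl]) (auto simp: sym_def)

text \<open>\<open>e\<close> is the first vertex of \<open>M\<close> on a path from \<open>u\<close>
  to \<open>v\<close>, and \<open>y\<close> is its predecessor. Every later truncation of a path or
  blade is an instance with a suitable \<open>M\<close>.\<close>

lemma linked_exit:
  assumes "linked E X u v" "u \<in> X" "u \<notin> M" "v \<in> M"
  obtains y e where "linked E (X - M) u y" "y \<in> X - M" "e \<in> X \<inter> M" "(y, e) \<in> E"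
proof -
  have "(v \<in> X - M \<and> linked E (X - M) u v) \<or>
    (\<exists>y e. linked E (X - M) u y \<and> y \<in> X - M \<and> e \<in> X \<inter> M \<and> (y, e) \<in> E)"
    using assms(1)
  proof (induction rule: rtrancl_induct)
    case base
    then show ?case using assms by auto
  next
    case (step y z)
    show ?case
    proof (cases "z \<in> M")
      case True
      then show ?thesis using step by blast
    next
      case False
      then show ?thesis using step by (blast intro: rtrancl_into_rtrancl)
    qed
  qed
  then show thesis using that assms by blast
qed

definition component :: "('a \<times> 'a) set \<Rightarrow> 'a set \<Rightarrow> 'a \<Rightarrow> 'a set" where
  "component E X u = {z \<in> X. linked E X u z}"

lemma component_subset: "component E X u \<subseteq> X"
  by (auto simp: component_def)

lemma component_self: "u \<in> X \<Longrightarrow> u \<in> component E X u"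
  by (auto simp: component_def)

text \<open>Branch sets are built from components, and their vertices must be linked to the centre
  inside the branch set itself, not just inside the larger carrier.\<close>

lemma linked_component:
  assumes "linked E X u z" "u \<in> X"
  shows "linked E (component E X u) u z"
  using assms(1)
proof (induction rule: rtrancl_induct)
  case base
  then show ?case by simp
next
  case (step y z)
  then have "y \<in> component E X u" "z \<in> component E X u"
    by (auto simp: component_def intro: rtrancl_into_rtrancl)
  with step show ?case by (blast intro: rtrancl_into_rtrancl)
qed

lemma vwalk_relpow:
  assumes "(u, v) \<in> (Restr (parcs G) X) ^^ n" "u \<in> X"
  shows "\<exists>w. vwalk w (with_proj G \<restriction> X) \<and> hd w = u \<and> last w = v \<and> vwalk_length w = n"
  using assms
proof (induction n arbitrary: u)
  case 0
  then show ?case by (intro exI[of _ "[u]"]) (auto simp: vwalk_def)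
next
  case (Suc n)
  from Suc.prems(1) obtain y where y: "(u, y) \<in> Restr (parcs G) X" "(y, v) \<in> (Restr (parcs G) X) ^^ n"
    by (metis relpow_Suc_D2)
  from Suc.IH[OF y(2)] y(1) obtain w where
    w: "vwalk w (with_proj G \<restriction> X)" "hd w = y" "last w = v" "vwalk_length w = n" by auto
  have ne: "w \<noteq> []" using w(1) by auto
  have "(u, y) \<in> arcs_ends (with_proj G \<restriction> X)"
    using y(1) by (auto simp: arcs_ends_def arc_to_ends_def induce_subgraph_def with_proj_def)
  with w ne Suc.prems(2) have "vwalk (u # w) (with_proj G \<restriction> X)"
    by (intro vwalk_consI) auto
  moreover have "vwalk_length (u # w) = Suc n"
    using w(4) ne by (cases w) auto
  ultimately show ?case using w ne by (intro exI[of _ "u # w"]) auto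
qed

lemma vwalk_induce_mono:
  assumes "vwalk w (with_proj G \<restriction> X)" "X \<subseteq> Y"
  shows "vwalk w (with_proj G \<restriction> Y)"
  using assms by (force simp: vwalk_def arcs_ends_def arc_to_ends_def induce_subgraph_def with_proj_def)

text \<open>A reachable vertex is reached in at most as many steps as there are arcs, hence in at
  most \<open>s * s\<close>. The crude radius is harmless because bounded expansion controls every
  depth.\<close>

lemma linked_vwalk:
  assumes "linked (parcs G) X u v" "u \<in> X" "finite X" "card X \<le> s" "X \<subseteq> Y"
  shows "\<exists>w. vwalk w (with_proj G \<restriction> Y) \<and> hd w = u \<and> last w = v \<and> vwalk_length w \<le> s * s"
proof -
  have fin: "finite (Restr (parcs G) X)" using assms(3) by auto
  obtain n where n: "n \<le> card (Restr (parcs G) X)" "(u, v) \<in> (Restr (parcs G) X) ^^ n"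
    using assms(1) unfolding rtrancl_finite_eq_relpow[OF fin] by auto
  have "card (Restr (parcs G) X) \<le> card (X \<times> X)"
    using assms(3) by (intro card_mono) auto
  also have "\<dots> \<le> s * s" using assms(4) by (simp add: card_cartesian_product mult_mono)
  finally have "card (Restr (parcs G) X) \<le> s * s" .
  then show ?thesis
  proof -
    obtain w where "vwalk w (with_proj G \<restriction> X)" "hd w = u" "last w = v" "vwalk_length w = n"
      using vwalk_relpow[OF n(2) assms(2)] by blast
    then show ?thesis
      using vwalk_induce_mono[OF _ assms(5)] n(1) \<open>card (Restr (parcs G) X) \<le> s * s\<close> by (intro exI[of _ w]) auto
  qed
qed

text \<open>The branch set \<open>B x\<close> is centred at \<open>x\<close>; its radius is controlled by the number of vertices that
  suffice to link each of its vertices to \<open>x\<close>.\<close>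

definition sparse_minors :: "'a set \<Rightarrow> ('a \<times> 'a) set \<Rightarrow> nat \<Rightarrow> nat \<Rightarrow> bool" where
  "sparse_minors V E s b \<longleftrightarrow>
     (\<forall>W B D. finite W \<and> D \<subseteq> W \<times> W \<and> irrefl D \<and>
        (\<forall>x\<in>W. x \<in> B x \<and> B x \<subseteq> V \<and>
           (\<forall>z\<in>B x. \<exists>X\<subseteq>B x. x \<in> X \<and> card X \<le> s \<and> linked E X x z)) \<and>
        (\<forall>x\<in>W. \<forall>y\<in>W. x \<noteq> y \<longrightarrow> B x \<inter> B y = {}) \<and>
        (\<forall>(x, y)\<in>D. \<exists>u\<in>B x. \<exists>v\<in>B y. (u, v) \<in> E)
      \<longrightarrow> card D \<le> b * card W)"

lemma pair_graphI:
  assumes "finite V" "E \<subseteq> V \<times> V" "sym E" "irrefl E"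
  shows "pair_graph \<lparr>pverts = V, parcs = E\<rparr>"
proof -
  have "finite E" using assms by (meson finite_SigmaI finite_subset)
  then show ?thesis
    using assms by unfold_locales (auto simp: symmetric_def irrefl_def)
qed

lemma pair_graphD:
  assumes "pair_graph G"
  shows "finite (pverts G)" "parcs G \<subseteq> pverts G \<times> pverts G" "sym (parcs G)" "irrefl (parcs G)"
proof -
  interpret pair_graph G by fact
  show "finite (pverts G)" by (rule pair_finite_verts)
  show "parcs G \<subseteq> pverts G \<times> pverts G"
    using in_arcsD1 in_arcsD2 by auto
  show "sym (parcs G)" using pair_sym_arcs by (simp add: symmetric_def)
  show "irrefl (parcs G)" using pair_no_loops by (force simp: irrefl_def)
qed

lemma bounded_expansion_sparse_minors:
  assumes "bounded_expansion \<C>" "graph_class \<C>"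
  shows "\<exists>b. \<forall>G\<in>\<C>. sparse_minors (pverts G) (parcs G) s b"
proof -
  obtain b where b: "\<And>G H. G \<in> \<C> \<Longrightarrow> shallow_minor (s * s) H G \<Longrightarrow> average_degree (H :: nat pair_pre_digraph) \<le> b"
    using assms(1) unfolding bounded_expansion_def by meson
  have "sparse_minors (pverts G) (parcs G) s (nat \<lceil>b\<rceil>)" if G: "G \<in> \<C>" for G
    unfolding sparse_minors_def
  proof (intro allI impI, elim conjE)
    fix W D and B :: "nat \<Rightarrow> nat set"
    assume W: "finite W" and D: "D \<subseteq> W \<times> W" "irrefl D"
      and B: "\<forall>x\<in>W. x \<in> B x \<and> B x \<subseteq> pverts G \<and>
           (\<forall>z\<in>B x. \<exists>X\<subseteq>B x. x \<in> X \<and> card X \<le> s \<and> linked (parcs G) X x z)"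
      and disj: "\<forall>x\<in>W. \<forall>y\<in>W. x \<noteq> y \<longrightarrow> B x \<inter> B y = {}"
      and adj: "\<forall>(x, y)\<in>D. \<exists>u\<in>B x. \<exists>v\<in>B y. (u, v) \<in> parcs G"
    have pG: "pair_graph G" using G assms(2) by (auto simp: graph_class_def)
    note G' = pair_graphD[OF pG]
    \<comment> \<open>\<open>D\<close> may contain only one direction of an edge. Its symmetric
      closure is a graph with at least as many arcs, so the average degree of that graph bounds
      \<open>card D\<close>.\<close>
    let ?H = "\<lparr>pverts = W, parcs = D \<union> D\<inverse>\<rparr>"
    have "pair_graph ?H"
      using W D by (intro pair_graphI) (auto simp: sym_def irrefl_def)
    moreover have adj': "\<exists>u\<in>B x. \<exists>v\<in>B y. (u, v) \<in> parcs G" if xy: "(x, y) \<in> D \<union> D\<inverse>" for x y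
    proof (cases "(x, y) \<in> D")
      case True
      then show ?thesis using adj by fast
    next
      case False
      then have "(y, x) \<in> D" using xy by auto
      then obtain u v where "u \<in> B y" "v \<in> B x" "(u, v) \<in> parcs G" using adj by fast
      then show ?thesis using symD[OF G'(3)] by auto
    qed
    moreover have reach: "\<exists>w. vwalk w (with_proj G \<restriction> B x) \<and> hd w = x \<and> last w = v \<and> vwalk_length w \<le> s * s"
      if xv: "x \<in> W" "v \<in> B x" for x v
    proof -
      have "\<exists>X\<subseteq>B x. x \<in> X \<and> card X \<le> s \<and> linked (parcs G) X x v"
        using B xv by simp
      then obtain X where X: "X \<subseteq> B x" "x \<in> X" "card X \<le> s" "linked (parcs G) X x v"
        by blast
      have "B x \<subseteq> pverts G" using B xv(1) by simp
      then have "finite X" using X(1) G'(1) by (meson finite_subset)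
      then show ?thesis using linked_vwalk[OF X(4,2) _ X(3,1)] by simp
    qed
    ultimately have "shallow_minor (s * s) ?H G"
      unfolding shallow_minor_def
    proof (intro conjI exI[of _ B] exI[of _ "\<lambda>x. x"] ballI impI)
      fix x y assume "x \<in> pverts ?H" "y \<in> pverts ?H" "x \<noteq> y"
      then show "B x \<inter> B y = {}" using disj by simp
    next
      fix e assume "e \<in> parcs ?H"
      then show "case e of (x, y) \<Rightarrow> \<exists>u\<in>B x. \<exists>v\<in>B y. (u, v) \<in> parcs G"
        using adj'[of "fst e" "snd e"] by (simp add: case_prod_unfold)
    qed (use pG B in simp_all)
    then have "average_degree ?H \<le> b" using b G by blast
    then have le: "real (card (D \<union> D\<inverse>)) / real (card W) \<le> b" by (simp add: average_degree_def)
    have "finite D" using D W by (meson finite_SigmaI finite_subset)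
    then have "card D \<le> card (D \<union> D\<inverse>)" by (intro card_mono) auto
    show "card D \<le> nat \<lceil>b\<rceil> * card W"
    proof (cases "card W = 0")
      case True
      then have "D = {}" using W D by auto
      then show ?thesis by simp
    next
      case False
      then have "real (card D) \<le> b * real (card W)"
        using le \<open>card D \<le> _\<close> by (simp add: field_simps)
      also have "\<dots> \<le> real (nat \<lceil>b\<rceil>) * real (card W)"
        by (intro mult_right_mono) (auto simp: real_nat_ceiling_ge)
      finally show ?thesis by (metis of_nat_le_iff of_nat_mult)
    qed
  qed
  then show ?thesis by blast
qed

section \<open>Linkages and fans in graphs with sparse shallow minors\<close>

lemma ex_max_card:
  assumes "P A" "\<And>A. P A \<Longrightarrow> card A \<le> (b :: nat)"
  shows "\<exists>B. P B \<and> (\<forall>A. P A \<longrightarrow> card A \<le> card B)"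
  using assms by (intro ex_has_greatest_nat[of P A card "Suc b"]) (auto simp: less_Suc_eq_le)

text \<open>A path from \<open>v\<close> to \<open>e \<in> S\<close> with inner vertices outside \<open>S\<close>, of which only the set \<open>Z\<close> of
  possible inner vertices is recorded.\<close>

definition blade :: "('a \<times> 'a) set \<Rightarrow> 'a set \<Rightarrow> nat \<Rightarrow> 'a \<Rightarrow> 'a set \<Rightarrow> 'a \<Rightarrow> bool" where
  "blade E S r v Z e \<longleftrightarrow> finite Z \<and> card Z \<le> r \<and> Z \<inter> S = {} \<and> e \<in> S \<and> e \<noteq> v \<and>
     linked E (insert v (insert e Z)) v e"

text \<open>The largest size of a fan is the admissibility of \<open>v\<close> relative to
  \<open>S\<close>, known from generalised colouring numbers, for paths with at most
  \<open>r\<close> inner vertices that meet only in \<open>v\<close>.\<close>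

definition fan :: "('a \<times> 'a) set \<Rightarrow> 'a set \<Rightarrow> nat \<Rightarrow> 'a \<Rightarrow> ('a set \<times> 'a) set \<Rightarrow> bool" where
  "fan E S r v F \<longleftrightarrow> finite F \<and> (\<forall>(Z, e)\<in>F. blade E S r v Z e) \<and>
     (\<forall>(Z, e)\<in>F. \<forall>(Z', e')\<in>F. (Z, e) \<noteq> (Z', e') \<longrightarrow> insert e Z \<inter> insert e' Z' = {})"

text \<open>This models a subdivision of a simple graph on vertices of \<open>S\<close>: every
  unordered pair of ends occurs at most once, so links can be counted as edges of a minor.\<close>

definition linkage :: "('a \<times> 'a) set \<Rightarrow> 'a set \<Rightarrow> nat \<Rightarrow> ('a \<times> 'a \<times> 'a set) set \<Rightarrow> bool" where
  "linkage E S m L \<longleftrightarrow> (\<forall>(u, v, Z)\<in>L. u \<in> S \<and> blade E S m u Z v) \<and>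
     (\<forall>(u, v, Z)\<in>L. \<forall>(u', v', Z')\<in>L. (u, v, Z) \<noteq> (u', v', Z') \<longrightarrow> {u, v} \<noteq> {u', v'} \<and> Z \<inter> Z' = {})"

lemma linked_carrier:
  assumes "E \<subseteq> V \<times> V" "linked E X v z" "v \<in> V" shows "z \<in> V"
  using assms(2) by (cases rule: rtrancl.cases) (use assms in auto)

text \<open>Contracting every link into its first end vertex turns the pairs of a linkage into edges of a minor.\<close>

lemma linkage_card:
  assumes sp: "sparse_minors V E (Suc m) b" and V: "finite V" "S \<subseteq> V" "E \<subseteq> V \<times> V" and symE: "sym E"
    and L: "linkage E S m L"
  shows "finite L" "card L \<le> b * card S"
proof -
  have finS: "finite S" using V finite_subset by auto
  define D where "D = (\<lambda>(u, v, Z). (u, v)) ` L"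
  have inj: "inj_on (\<lambda>(u, v, Z). (u, v)) L"
    using L unfolding linkage_def by (force simp: inj_on_def)
  have DS: "D \<subseteq> S \<times> S"
    using L unfolding linkage_def blade_def D_def by auto
  then have "finite D" using finS by (meson finite_SigmaI finite_subset)
  then show "finite L" unfolding D_def using inj finite_imageD by blast
  define B where "B u = insert u (\<Union>(v, Z)\<in>{(v, Z). (u, v, Z) \<in> L}. component E (insert u Z) u)" for u
  have "card D \<le> b * card S"
  proof (rule sp[unfolded sparse_minors_def, rule_format, of _ _ B], intro conjI ballI impI)
    show "finite S" "D \<subseteq> S \<times> S" by fact+
    show "irrefl D" using L unfolding linkage_def blade_def D_def irrefl_def by auto
  next
    fix x assume x: "x \<in> S"
    show "x \<in> B x" by (simp add: B_def)
    have xV: "x \<in> V" using x V(2) by auto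
    show "B x \<subseteq> V"
    proof
      fix z assume "z \<in> B x"
      then consider "z = x" | Z where "z \<in> component E (insert x Z) x" unfolding B_def by blast
      then show "z \<in> V"
      proof cases
        case 2
        then have "linked E (insert x Z) x z" by (simp add: component_def)
        then show ?thesis using linked_carrier[OF V(3)] xV by metis
      qed (use xV in simp)
    qed
    fix z assume z: "z \<in> B x"
    show "\<exists>X\<subseteq>B x. x \<in> X \<and> card X \<le> Suc m \<and> linked E X x z"
    proof (cases "z = x")
      case True
      have "{x} \<subseteq> B x \<and> x \<in> {x} \<and> card {x} \<le> Suc m \<and> linked E {x} x z"
        using True by (simp add: B_def)
      then show ?thesis by (rule exI)
    next
      case False
      then obtain v Z where Z: "(x, v, Z) \<in> L" "z \<in> component E (insert x Z) x"
        using z unfolding B_def by blast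
      let ?X = "component E (insert x Z) x"
      have Zf: "finite Z" "card Z \<le> m" using L Z(1) unfolding linkage_def blade_def by auto
      have "card ?X \<le> card (insert x Z)"
        using Zf by (intro card_mono) (auto simp: component_subset)
      also have "\<dots> \<le> Suc m" using Zf by (simp add: card_insert_if)
      finally have "card ?X \<le> Suc m" .
      moreover have "linked E ?X x z"
        using Z(2) by (intro linked_component) (simp_all add: component_def)
      moreover have "?X \<subseteq> B x" using Z(1) unfolding B_def by blast
      moreover have "x \<in> ?X" by (simp add: component_self)
      ultimately have "?X \<subseteq> B x \<and> x \<in> ?X \<and> card ?X \<le> Suc m \<and> linked E ?X x z"
        by simp
      then show ?thesis by (rule exI)
    qed
  next
    fix x y assume xy: "x \<in> S" "y \<in> S" "x \<noteq> y"
    show "B x \<inter> B y = {}"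
    proof (rule ccontr)
      assume "B x \<inter> B y \<noteq> {}"
      then obtain z where z: "z \<in> B x" "z \<in> B y" by auto
      have *: "z = w \<or> (\<exists>v Z. (w, v, Z) \<in> L \<and> z \<in> Z)" if "z \<in> B w" for w
        using that component_subset[of E _ w] unfolding B_def by fast
      have out: "z \<notin> S" if "(w, v, Z) \<in> L" "z \<in> Z" for w v Z
        using that L unfolding linkage_def blade_def by fast
      have "\<not> (z = x \<or> z = y)" using *[OF z(1)] *[OF z(2)] out xy by metis
      then obtain v Z v' Z' where "(x, v, Z) \<in> L" "z \<in> Z" "(y, v', Z') \<in> L" "z \<in> Z'"
        using *[OF z(1)] *[OF z(2)] by blast
      then show False using L xy unfolding linkage_def by fast
    qed
  next
    fix t assume "t \<in> D"
    then show "case t of (x, y) \<Rightarrow> \<exists>u\<in>B x. \<exists>v\<in>B y. (u, v) \<in> E"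
    proof (cases t, clarify)
      fix x y assume "(x, y) \<in> D"
      then obtain Z where Z: "(x, y, Z) \<in> L" by (auto simp: D_def)
      then have bl: "x \<in> S" "blade E S m x Z y" using L unfolding linkage_def by auto
      \<comment> \<open>Stopping just before \<open>y\<close> leaves a neighbour of \<open>y\<close>
        that is linked to \<open>x\<close> within \<open>insert x Z\<close>, so it lies in the
        branch set of \<open>x\<close>.\<close>
      obtain u e where ue: "linked E (insert x (insert y Z) - {y}) x u" "u \<in> insert x (insert y Z) - {y}"
         "e \<in> insert x (insert y Z) \<inter> {y}" "(u, e) \<in> E"
        using bl linked_exit[of x y E "insert x (insert y Z)" "{y}"] unfolding blade_def by auto
      have eq: "insert x (insert y Z) - {y} = insert x Z"
        using bl unfolding blade_def by auto
      have "u \<in> component E (insert x Z) x" using ue(1,2) unfolding eq component_def by auto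
      then have "u \<in> B x" using Z unfolding B_def by auto
      then show "\<exists>u\<in>B x. \<exists>v\<in>B y. (u, v) \<in> E" using ue by (auto simp: B_def)
    qed
  qed
  then show "card L \<le> b * card S" unfolding D_def using inj by (simp add: card_image)
qed

text \<open>The degrees sum up to at most \<open>2 * b * card S\<close>, so at least half of the
  vertices have degree at most \<open>4 * b\<close>. A maximal independent set of such vertices
  dominates all of them, and each member accounts for at most \<open>1 + 4 * b\<close>.\<close>

lemma ex_large_independent_subset:
  assumes fin: "finite S" and L: "finite L" "card L \<le> b * card S"
  shows "\<exists>R\<subseteq>S. (\<forall>x\<in>R. \<forall>y\<in>R. x \<noteq> y \<longrightarrow> (x, y) \<notin> L) \<and> card S \<le> 2 * (1 + 4 * b) * card R"
proof -
  define N where "N x = {t \<in> L. x = fst t \<or> x = snd t}" for x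
  have finN: "finite (N x)" for x using L(1) by (simp add: N_def)
  have "(\<Sum>x\<in>S. card (N x)) = (\<Sum>x\<in>S. \<Sum>t\<in>L. if x = fst t \<or> x = snd t then 1 else 0)"
    using L(1) by (simp add: N_def flip: sum.inter_filter)
  also have "\<dots> = (\<Sum>t\<in>L. \<Sum>x\<in>S. if x = fst t \<or> x = snd t then 1 else 0)"
    by (rule sum.swap)
  also have "\<dots> \<le> (\<Sum>t\<in>L. 2)"
  proof (rule sum_mono)
    fix t :: "'a \<times> 'a"
    have "(\<Sum>x\<in>S. if x = fst t \<or> x = snd t then 1 else 0) = card {x\<in>S. x = fst t \<or> x = snd t}"
      using fin by (simp flip: sum.inter_filter)
    also have "\<dots> \<le> card {fst t, snd t}" by (intro card_mono) auto
    also have "\<dots> \<le> 2" by (simp add: card_insert_if)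
    finally show "(\<Sum>x\<in>S. if x = fst t \<or> x = snd t then 1 else 0) \<le> (2::nat)" .
  qed
  finally have deg: "(\<Sum>x\<in>S. card (N x)) \<le> 2 * card L" by simp
  define lo where "lo = {x\<in>S. card (N x) \<le> 4 * b}"
  have lo: "lo \<subseteq> S" "finite lo" using fin by (auto simp: lo_def)
  have "(4 * b + 1) * card (S - lo) \<le> (\<Sum>x\<in>S - lo. card (N x))"
  proof -
    have "4 * b + 1 \<le> card (N x)" if "x \<in> S - lo" for x using that by (auto simp: lo_def)
    from sum_bounded_below[of "S - lo", OF this] show ?thesis by (simp add: mult.commute)
  qed
  also have "\<dots> \<le> (\<Sum>x\<in>S. card (N x))" using fin by (intro sum_mono2) auto
  also have "\<dots> \<le> 2 * b * card S" using deg L(2) by simp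
  finally have "(4 * b + 1) * (2 * card (S - lo)) \<le> (4 * b + 1) * card S"
    by (simp add: algebra_simps)
  then have "2 * card (S - lo) \<le> card S" by (subst (asm) mult_le_cancel1) auto
  moreover have "card S = card lo + card (S - lo)"
    using fin lo by (metis card_Diff_subset card_mono le_add_diff_inverse)
  ultimately have large: "card S \<le> 2 * card lo" by linarith
  let ?P = "\<lambda>R. R \<subseteq> lo \<and> (\<forall>x\<in>R. \<forall>y\<in>R. x \<noteq> y \<longrightarrow> (x, y) \<notin> L)"
  have "?P {}" by simp
  moreover have "\<forall>R. ?P R \<longrightarrow> card R \<le> card lo" using lo by (auto intro: card_mono)
  ultimately have "\<exists>R. ?P R \<and> (\<forall>R'. ?P R' \<longrightarrow> card R' \<le> card R)"
    by (intro ex_max_card[of ?P "{}" "card lo"]) simp_all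
  then obtain R where Rmax: "?P R \<and> (\<forall>R'. ?P R' \<longrightarrow> card R' \<le> card R)" ..
  have R: "?P R" using Rmax by (rule conjunct1)
  have max: "\<forall>R'. ?P R' \<longrightarrow> card R' \<le> card R" using Rmax by (rule conjunct2)
  have finR: "finite R" using R lo finite_subset by auto
  have "lo \<subseteq> (\<Union>x\<in>R. insert x ((\<lambda>t. if fst t = x then snd t else fst t) ` N x))" (is "_ \<subseteq> (\<Union>x\<in>R. ?C x)")
  proof
    fix y assume y: "y \<in> lo"
    show "y \<in> (\<Union>x\<in>R. ?C x)"
    proof (cases "y \<in> R")
      case True
      then show ?thesis by auto
    next
      case False
      then have "card (insert y R) = Suc (card R)" using finR by simp
      then have "\<not> ?P (insert y R)" using max[rule_format, of "insert y R"] by linarith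
      then obtain x where "x \<in> R" "x \<noteq> y" "(x, y) \<in> L \<or> (y, x) \<in> L" using R y by blast
      then have "y \<in> ?C x" unfolding N_def by force
      with \<open>x \<in> R\<close> show ?thesis by blast
    qed
  qed
  then have "card lo \<le> card (\<Union>x\<in>R. ?C x)"
    using finR finN by (intro card_mono) auto
  also have "\<dots> \<le> (\<Sum>x\<in>R. card (?C x))" using finR by (rule card_UN_le)
  also have "\<dots> \<le> (\<Sum>x\<in>R. 1 + 4 * b)"
  proof (rule sum_mono)
    fix x assume "x \<in> R"
    then have "card (N x) \<le> 4 * b" using R by (auto simp: lo_def)
    then have "card ((\<lambda>t. if fst t = x then snd t else fst t) ` N x) \<le> 4 * b"
      using card_image_le[OF finN] le_trans by blast
    then show "card (?C x) \<le> 1 + 4 * b" using finN by (simp add: card_insert_if)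
  qed
  finally have "card lo \<le> (1 + 4 * b) * card R" by (simp add: mult.commute)
  with large have "card S \<le> 2 * (1 + 4 * b) * card R" by simp
  then show ?thesis using R lo(1) by (intro exI[of _ R]) auto
qed

text \<open>In a maximal linkage, the pairs form a sparse graph, so it has a large independent set \<open>R\<close>. The fans at
  \<open>R\<close>, cut off at the linkage, are disjoint by maximality, and contracting them gives a dense
  minor if they are large.\<close>

lemma sparse_minors_no_large_fan:
  assumes sp: "sparse_minors V E (Suc (2 * r)) b" and V: "finite V" "S \<subseteq> V" "E \<subseteq> V \<times> V"
    and symE: "sym E" and "S \<noteq> {}"
  shows "\<exists>v\<in>S. \<forall>F. fan E S r v F \<longrightarrow> card F \<le> b * (1 + 2 * r * b) * (2 * (1 + 4 * b))"
proof (rule ccontr)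
  define K where "K = Suc (b * (1 + 2 * r * b) * (2 * (1 + 4 * b)))"
  assume "\<not> ?thesis"
  then have "\<forall>v\<in>S. \<exists>F. fan E S r v F \<and> K \<le> card F" by (fastforce simp: K_def not_le)
  then obtain F where F: "\<And>v. v \<in> S \<Longrightarrow> fan E S r v (F v)" and cF: "\<And>v. v \<in> S \<Longrightarrow> K \<le> card (F v)"
    using bchoice[of S "\<lambda>v F. fan E S r v F \<and> K \<le> card F"] by blast
  have finS: "finite S" using V finite_subset by auto
  \<comment> \<open>Links get twice as many inner vertices as blades because two overlapping blades
    are going to be merged into one link.\<close>
  let ?P = "linkage E S (2 * r)"
  note lc = linkage_card[OF sp V symE]
  have "\<exists>L. ?P L \<and> (\<forall>L'. ?P L' \<longrightarrow> card L' \<le> card L)"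
    by (rule ex_max_card[of ?P "{}" "b * card S"]) (use lc in \<open>simp_all add: linkage_def\<close>)
  then obtain L where L: "?P L" and max: "\<forall>L'. ?P L' \<longrightarrow> card L' \<le> card L"
    by (elim exE conjE)
  have finL: "finite L" and cardL: "card L \<le> b * card S" using lc[OF L] by auto
  define M where "M = (\<Union>(u, v, Z)\<in>L. Z)"
  have blL: "u \<in> S \<and> blade E S (2 * r) u Z v" if "(u, v, Z) \<in> L" for u v Z
    using L that unfolding linkage_def by auto
  have MS: "M \<inter> S = {}" unfolding M_def using blL by (fastforce simp: blade_def)
  have "card M \<le> (\<Sum>t\<in>L. card (snd (snd t)))"
    unfolding M_def case_prod_unfold using finL by (rule card_UN_le)
  also have "\<dots> \<le> (\<Sum>t\<in>L. 2 * r)"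
    by (intro sum_mono) (use blL in \<open>auto simp: blade_def\<close>)
  finally have cardM: "card M \<le> 2 * r * card L" by (simp add: mult.commute)
  have finM: "finite M" unfolding M_def using finL blL by (fastforce simp: blade_def)
  define L' where "L' = (\<lambda>(u, v, Z). (u, v)) ` L"
  have "finite L'" "card L' \<le> b * card S"
    unfolding L'_def using finL cardL card_image_le[OF finL] le_trans by blast+
  from ex_large_independent_subset[OF finS this]
  obtain R where R: "R \<subseteq> S" "\<And>x y. x \<in> R \<Longrightarrow> y \<in> R \<Longrightarrow> x \<noteq> y \<Longrightarrow> (x, y) \<notin> L'"
    and cardR: "card S \<le> 2 * (1 + 4 * b) * card R" by blast
  have finR: "finite R" using R(1) finS finite_subset by auto
  \<comment> \<open>Maximality of \<open>L\<close> in the form in which it is used twice: a short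
    path between two vertices of \<open>R\<close> that avoids \<open>S\<close> and \<open>M\<close>
    could be added to \<open>L\<close>, since no link joins these two vertices yet.\<close>
  have no_link: False
    if "u \<in> R" "v \<in> R" "u \<noteq> v" and T: "finite T" "T \<inter> S = {}" "T \<inter> M = {}" "card T \<le> 2 * r"
      and link: "linked E (insert u (insert v T)) u v" for u v T
  proof -
    have bl: "blade E S (2 * r) u T v" using that R(1) by (auto simp: blade_def)
    have nin: "{u, v} \<noteq> {u', v'} \<and> T \<inter> Z' = {}" if "(u', v', Z') \<in> L" for u' v' Z'
    proof
      have "(u', v') \<in> L'" using that unfolding L'_def by force
      then show "{u, v} \<noteq> {u', v'}" using R(2) \<open>u \<in> R\<close> \<open>v \<in> R\<close> \<open>u \<noteq> v\<close> by (auto simp: doubleton_eq_iff)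
      have "Z' \<subseteq> M" using that unfolding M_def by fast
      then show "T \<inter> Z' = {}" using T(3) by auto
    qed
    have "?P (insert (u, v, T) L)"
      unfolding linkage_def
    proof (intro conjI ballI)
      fix t assume "t \<in> insert (u, v, T) L"
      then show "case t of (u, v, Z) \<Rightarrow> u \<in> S \<and> blade E S (2 * r) u Z v"
        using bl blL R(1) \<open>u \<in> R\<close> by auto
    next
      fix t assume "t \<in> insert (u, v, T) L"
      then show "case t of (u1, v1, Z1) \<Rightarrow> \<forall>(u2, v2, Z2)\<in>insert (u, v, T) L.
          (u1, v1, Z1) \<noteq> (u2, v2, Z2) \<longrightarrow> {u1, v1} \<noteq> {u2, v2} \<and> Z1 \<inter> Z2 = {}"
      proof (cases t, hypsubst, unfold prod.case, intro ballI, unfold case_prod_unfold, intro impI)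
        fix u1 v1 Z1 and q :: "'a \<times> 'a \<times> 'a set"
        obtain u2 v2 Z2 where q: "q = (u2, v2, Z2)" by (cases q)
        assume "(u1, v1, Z1) \<in> insert (u, v, T) L" "q \<in> insert (u, v, T) L"
          "(u1, v1, Z1) \<noteq> (fst q, fst (snd q), snd (snd q))"
        then have t: "(u1, v1, Z1) \<in> insert (u, v, T) L" "(u2, v2, Z2) \<in> insert (u, v, T) L"
          and ne: "(u1, v1, Z1) \<noteq> (u2, v2, Z2)"
          by (simp_all add: q)
        then consider "(u1, v1, Z1) = (u, v, T)" "(u2, v2, Z2) \<in> L"
          | "(u1, v1, Z1) \<in> L" "(u2, v2, Z2) = (u, v, T)" | "(u1, v1, Z1) \<in> L" "(u2, v2, Z2) \<in> L"
          by fastforce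
        then have "{u1, v1} \<noteq> {u2, v2} \<and> Z1 \<inter> Z2 = {}"
        proof cases
          case 1
          then show ?thesis using nin[OF 1(2)] by simp
        next
          case 2
          then show ?thesis using nin[OF 2(1)] by (simp add: Int_commute eq_commute[of "{u1, v1}"])
        next
          case 3
          then show ?thesis using L ne unfolding linkage_def by fast
        qed
        then show "{u1, v1} \<noteq> {fst q, fst (snd q)} \<and> Z1 \<inter> snd (snd q) = {}" by (simp add: q)
      qed
    qed
    then have "card (insert (u, v, T) L) \<le> card L" using max by simp
    moreover have "(u, v, T) \<notin> L" using nin by blast
    ultimately show False using finL by simp
  qed
  have blF: "blade E S r v Z e" if "v \<in> R" "(Z, e) \<in> F v" for v Z e
    using F[of v] that R(1) unfolding fan_def by auto
  \<comment> \<open>Every blade is cut off at its first vertex \<open>t\<close> in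
    \<open>S \<union> M\<close> other than \<open>v\<close>. If \<open>t\<close> were in
    \<open>R\<close>, the part before \<open>t\<close> would be a link excluded by
    \<open>no_link\<close>.\<close>
  have "\<exists>t y. t \<in> insert e Z \<and> t \<in> S \<union> M \<and> t \<notin> R \<and> y \<in> component E (insert v (Z - M)) v \<and> (y, t) \<in> E"
    if v: "v \<in> R" and Ze: "(Z, e) \<in> F v" for v Z e
  proof -
    note bl = blF[OF v Ze, unfolded blade_def]
    have vS: "v \<in> S" "v \<notin> M" using v R(1) MS by auto
    obtain y t where yt: "linked E (insert v (insert e Z) - (S \<union> M - {v})) v y"
      "y \<in> insert v (insert e Z) - (S \<union> M - {v})" "t \<in> insert v (insert e Z) \<inter> (S \<union> M - {v})" "(y, t) \<in> E"
      using bl linked_exit[of v e E "insert v (insert e Z)" "S \<union> M - {v}"] by auto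
    have eq: "insert v (insert e Z) - (S \<union> M - {v}) = insert v (Z - M)" using bl vS by auto
    have y: "y \<in> component E (insert v (Z - M)) v" using yt(1,2) unfolding eq component_def by simp
    have "t \<notin> R"
    proof
      assume t: "t \<in> R"
      have "linked E (insert v (insert t (Z - M))) v y"
        using yt(1) unfolding eq by (rule linked_mono) auto
      moreover have "(y, t) \<in> Restr E (insert v (insert t (Z - M)))"
        using yt(2,4) unfolding eq by auto
      ultimately have link: "linked E (insert v (insert t (Z - M))) v t"
        by (rule rtrancl_into_rtrancl)
      have "card (Z - M) \<le> card Z" using bl by (intro card_mono) auto
      then have "card (Z - M) \<le> 2 * r" using bl by linarith
      then show False using no_link[OF v t _ _ _ _ _ link] yt(3) bl by auto
    qed
    then show ?thesis using yt y by blast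
  qed
  then have "\<forall>v\<in>R. \<forall>p\<in>F v. \<exists>t. t \<in> insert (snd p) (fst p) \<and> t \<in> S \<union> M \<and> t \<notin> R \<and>
      (\<exists>y\<in>component E (insert v (fst p - M)) v. (y, t) \<in> E)" by (metis prod.collapse)
  then obtain f where f: "\<And>v p. v \<in> R \<Longrightarrow> p \<in> F v \<Longrightarrow> f v p \<in> insert (snd p) (fst p) \<and> f v p \<in> S \<union> M \<and>
      f v p \<notin> R \<and> (\<exists>y\<in>component E (insert v (fst p - M)) v. (y, f v p) \<in> E)" by metis
  define D where "D = (\<lambda>(v, p). (v, f v p)) ` Sigma R F"
  define B where "B w = (if w \<in> R then insert w (\<Union>p\<in>F w. component E (insert w (fst p - M)) w) else {w})" for w
  have Bin: "z = w \<or> w \<in> R \<and> (\<exists>p\<in>F w. z \<in> fst p - M \<and> linked E (insert w (fst p - M)) w z)" if "z \<in> B w" for w z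
    using that unfolding B_def component_def by (auto split: if_splits)
  have finF: "finite (F v)" if "v \<in> R" for v using F[of v] that R(1) unfolding fan_def by auto
  \<comment> \<open>Carriers of blades are not confined to \<open>V\<close>, so only the part of
    \<open>M\<close> inside \<open>V\<close> can serve as branch vertices. The cut vertices do lie
    in \<open>V\<close>, being ends of arcs.\<close>
  let ?W = "S \<union> M \<inter> V"
  have finW: "finite ?W" using finS finM by simp
  have "card D \<le> b * card ?W"
  proof (rule sp[unfolded sparse_minors_def, rule_format, of _ _ B], intro conjI ballI impI)
    show "finite ?W" by fact
    have fW: "f v p \<in> ?W \<and> f v p \<notin> R" if "v \<in> R" "p \<in> F v" for v p using f[OF that] V(3) by auto
    show "D \<subseteq> ?W \<times> ?W"
    proof
      fix t assume "t \<in> D"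
      then obtain v p where vp: "v \<in> R" "p \<in> F v" "t = (v, f v p)" by (auto simp: D_def)
      then show "t \<in> ?W \<times> ?W" using fW[OF vp(1,2)] R(1) by (simp add: subset_iff)
    qed
    show "irrefl D"
    proof (rule irreflI, rule notI)
      fix t assume "(t, t) \<in> D"
      then obtain v p where vp: "v \<in> R" "p \<in> F v" "t = v" "t = f v p" by (auto simp: D_def)
      then show False using fW[OF vp(1,2)] by simp
    qed
  next
    fix x assume x: "x \<in> ?W"
    then have xV: "x \<in> V" using V(2) by auto
    show xB: "x \<in> B x" by (simp add: B_def)
    show "B x \<subseteq> V"
    proof
      fix z assume "z \<in> B x"
      then show "z \<in> V" using Bin[of z x] linked_carrier[OF V(3) _ xV] xV by blast
    qed
    fix z assume z: "z \<in> B x"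
    show "\<exists>X\<subseteq>B x. x \<in> X \<and> card X \<le> Suc (2 * r) \<and> linked E X x z"
    proof (cases "z = x")
      case True
      have "{x} \<subseteq> B x \<and> x \<in> {x} \<and> card {x} \<le> Suc (2 * r) \<and> linked E {x} x z"
        using True xB by simp
      then show ?thesis by (rule exI)
    next
      case False
      then obtain p where p: "x \<in> R" "p \<in> F x" "z \<in> component E (insert x (fst p - M)) x"
        using z unfolding B_def by (auto split: if_splits)
      let ?X = "component E (insert x (fst p - M)) x"
      have bl: "finite (fst p)" "card (fst p) \<le> r"
        using blF[of x "fst p" "snd p"] p by (auto simp: blade_def)
      have "card ?X \<le> card (insert x (fst p))"
        using bl component_subset[of E "insert x (fst p - M)" x] by (intro card_mono) auto
      also have "\<dots> \<le> Suc (2 * r)" using bl by (simp add: card_insert_if)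
      finally have "card ?X \<le> Suc (2 * r)" .
      moreover have "linked E ?X x z"
        using p(3) by (intro linked_component) (simp_all add: component_def)
      moreover have "?X \<subseteq> B x" using p(1,2) unfolding B_def by auto
      moreover have "x \<in> ?X" by (simp add: component_self)
      ultimately have "?X \<subseteq> B x \<and> x \<in> ?X \<and> card ?X \<le> Suc (2 * r) \<and> linked E ?X x z"
        by simp
      then show ?thesis by (rule exI)
    qed
  next
    fix x y assume xy: "x \<in> ?W" "y \<in> ?W" "x \<noteq> y"
    have out: "z \<notin> ?W" if "w \<in> R" "p \<in> F w" "z \<in> fst p - M" for w p z
      using blF[of w "fst p" "snd p"] that by (auto simp: blade_def)
    show "B x \<inter> B y = {}"
    proof (rule ccontr)
      assume "B x \<inter> B y \<noteq> {}"
      then obtain z where z: "z \<in> B x" "z \<in> B y" by auto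
      have "z \<noteq> x" "z \<noteq> y" using Bin[OF z(1)] Bin[OF z(2)] out xy by metis+
      then obtain p q where p: "x \<in> R" "p \<in> F x" "z \<in> fst p - M" "linked E (insert x (fst p - M)) x z"
        and q: "y \<in> R" "q \<in> F y" "z \<in> fst q - M" "linked E (insert y (fst q - M)) y z"
        using Bin[OF z(1)] Bin[OF z(2)] by blast
      define T where "T = (fst p - M) \<union> (fst q - M)"
      have bl: "finite (fst p)" "card (fst p) \<le> r" "fst p \<inter> S = {}" "finite (fst q)" "card (fst q) \<le> r" "fst q \<inter> S = {}"
        using blF[of x "fst p" "snd p"] blF[of y "fst q" "snd q"] p q by (auto simp: blade_def)
      have "card T \<le> card (fst p - M) + card (fst q - M)" unfolding T_def by (rule card_Un_le)
      also have "\<dots> \<le> card (fst p) + card (fst q)" using bl by (intro add_mono card_mono) auto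
      finally have "card T \<le> 2 * r" using bl by linarith
      have "linked E (insert x (insert y T)) x z"
        using p(4) by (rule linked_mono) (auto simp: T_def)
      moreover have "linked E (insert x (insert y T)) z y"
        using linked_sym[OF symE q(4)] by (rule linked_mono) (auto simp: T_def)
      ultimately have "linked E (insert x (insert y T)) x y" by (metis rtrancl_trans)
      moreover have "finite T" "T \<inter> S = {}" "T \<inter> M = {}" using bl by (auto simp: T_def)
      ultimately show False
        using no_link[OF p(1) q(1) xy(3), of T] \<open>card T \<le> 2 * r\<close> by blast
    qed
  next
    fix t assume "t \<in> D"
    then obtain v p where vp: "v \<in> R" "p \<in> F v" "t = (v, f v p)" by (auto simp: D_def)
    then obtain y where y: "y \<in> component E (insert v (fst p - M)) v" "(y, f v p) \<in> E" using f by meson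
    then have "y \<in> B v" using vp(1,2) unfolding B_def by auto
    then show "case t of (x, y) \<Rightarrow> \<exists>u\<in>B x. \<exists>v\<in>B y. (u, v) \<in> E"
      using y(2) vp(3) by (auto simp: B_def f)
  qed
  \<comment> \<open>The target of an arc lies on the blade that produced it, and blades of one fan
    are disjoint outside \<open>v\<close>. So distinct blades give distinct arcs.\<close>
  moreover have "card D = card (Sigma R F)"
    unfolding D_def
  proof (rule card_image, rule inj_onI)
    fix s t assume "s \<in> Sigma R F" "t \<in> Sigma R F" and eq: "(case s of (v, p) \<Rightarrow> (v, f v p)) = (case t of (v, p) \<Rightarrow> (v, f v p))"
    then obtain v Z e Z' e' where v: "v \<in> R" and Ze: "(Z, e) \<in> F v" "(Z', e') \<in> F v"
      and st: "s = (v, Z, e)" "t = (v, Z', e')" by (cases s; cases t) auto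
    have "f v (Z, e) \<in> insert e Z \<inter> insert e' Z'" using f[OF v Ze(1)] f[OF v Ze(2)] eq by (auto simp: st)
    then have "(Z, e) = (Z', e')" using F[of v] v R(1) Ze unfolding fan_def by fast
    then show "s = t" by (simp add: st)
  qed
  moreover have "card (Sigma R F) = (\<Sum>v\<in>R. card (F v))" using finR finF by (intro card_SigmaI) auto
  moreover have "K * card R \<le> (\<Sum>v\<in>R. card (F v))"
    using sum_bounded_below[of R K "\<lambda>v. card (F v)"] cF R(1) by (simp add: mult.commute subset_iff)
  \<comment> \<open>Each of the at most \<open>b * card S\<close> links has a carrier of at most
    \<open>2 * r\<close> vertices, whence \<open>1 + 2 * r * b\<close>. The factor
    \<open>2 * (1 + 4 * b)\<close> used next is the loss in passing from \<open>S\<close> to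
    \<open>R\<close>.\<close>
  moreover have "card ?W \<le> (1 + 2 * r * b) * card S"
  proof -
    have "card ?W \<le> card S + card (M \<inter> V)" by (rule card_Un_le)
    also have "\<dots> \<le> card S + card M" using finM by (simp add: card_mono)
    also have "\<dots> \<le> card S + 2 * r * (b * card S)"
      using cardM mult_le_mono2[OF cardL, of "2 * r"] by linarith
    finally show ?thesis by (simp add: algebra_simps)
  qed
  ultimately have "K * card R \<le> b * ((1 + 2 * r * b) * card S)"
    by (metis (no_types, lifting) le_trans mult_le_mono2)
  also have "\<dots> \<le> b * ((1 + 2 * r * b) * (2 * (1 + 4 * b) * card R))"
    using cardR by (intro mult_le_mono2)
  finally have "K * card R \<le> (b * (1 + 2 * r * b) * (2 * (1 + 4 * b))) * card R" by (simp only: mult.assoc)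
  moreover have "card R \<noteq> 0" using cardR \<open>S \<noteq> {}\<close> finS by (metis card_0_eq le_zero_eq mult_0_right)
  ultimately have "K \<le> b * (1 + 2 * r * b) * (2 * (1 + 4 * b))" by (metis mult_le_cancel2 gr0I)
  then show False by (simp only: K_def)
qed

section \<open>Weakly reachable sets\<close>

text \<open>Remove a vertex good for the whole set, rank it last, and recurse. The initial segment
  of the order ending in \<open>v\<close> is then the set from which \<open>v\<close> was
  removed.\<close>

lemma ex_removal_order:
  assumes "finite V" "\<And>S. S \<subseteq> V \<Longrightarrow> S \<noteq> {} \<Longrightarrow> \<exists>v\<in>S. Q S v"
  shows "\<exists>\<rho> :: 'a \<Rightarrow> nat. inj_on \<rho> V \<and> (\<forall>v\<in>V. Q {u\<in>V. \<rho> u \<le> \<rho> v} v)"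
  using assms
proof (induction V rule: finite_psubset_induct)
  case (psubset V)
  show ?case
  proof (cases "V = {}")
    case False
    then obtain m where m: "m \<in> V" "Q V m" using psubset.prems[of V] by blast
    then have "V - {m} \<subset> V" by auto
    then obtain \<rho> :: "'a \<Rightarrow> nat" where \<rho>: "inj_on \<rho> (V - {m})" "\<And>v. v \<in> V - {m} \<Longrightarrow> Q {u\<in>V - {m}. \<rho> u \<le> \<rho> v} v"
      using psubset.IH[of "V - {m}"] psubset.prems by (meson order.trans psubset_imp_subset)
    define \<rho>' where "\<rho>' = \<rho>(m := Suc (Max (insert 0 (\<rho> ` V))))"
    have less: "\<rho>' u < \<rho>' m" if "u \<in> V - {m}" for u
      using that psubset.hyps by (auto simp: \<rho>'_def less_Suc_eq_le intro!: Max_ge)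
    have "inj_on \<rho>' V"
    proof (rule inj_onI)
      fix x y assume "x \<in> V" "y \<in> V" "\<rho>' x = \<rho>' y"
      then show "x = y" using \<rho>(1) less[of x] less[of y]
        by (cases "x = m"; cases "y = m") (auto simp: \<rho>'_def inj_on_def)
    qed
    moreover have "Q {u\<in>V. \<rho>' u \<le> \<rho>' v} v" if "v \<in> V" for v
    proof (cases "v = m")
      case True
      then have "{u\<in>V. \<rho>' u \<le> \<rho>' v} = V" using less by (auto intro: less_imp_le)
      then show ?thesis using True m by simp
    next
      case False
      then have "{u\<in>V. \<rho>' u \<le> \<rho>' v} = {u\<in>V - {m}. \<rho> u \<le> \<rho> v}"
        using less[of v] that by (auto simp: \<rho>'_def)
      then show ?thesis using \<rho>(2)[of v] False that by simp
    qed
    ultimately show ?thesis by blast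
  qed simp
qed

lemma fan_iff:
  "fan E S r v F \<longleftrightarrow> finite F \<and> (\<forall>p\<in>F. blade E S r v (fst p) (snd p)) \<and>
     (\<forall>p\<in>F. \<forall>q\<in>F. p \<noteq> q \<longrightarrow> insert (snd p) (fst p) \<inter> insert (snd q) (fst q) = {})"
  unfolding fan_def case_prod_unfold prod.collapse ..

text \<open>The weakly reachable sets of generalised colouring numbers, with the distance bounded
  through the size of a carrier: \<open>s\<close> vertices allow distance
  \<open>s - 1\<close>.\<close>

definition weak_reach :: "'a set \<Rightarrow> ('a \<times> 'a) set \<Rightarrow> ('a \<Rightarrow> nat) \<Rightarrow> nat \<Rightarrow> 'a \<Rightarrow> 'a set" where
  "weak_reach V E \<rho> s v = {z. \<exists>X\<subseteq>V. card X \<le> s \<and> v \<in> X \<and> z \<in> X \<and> (\<forall>x\<in>X. \<rho> z \<le> \<rho> x) \<and> linked E X v z}"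

lemma weak_reachI:
  "X \<subseteq> V \<Longrightarrow> card X \<le> s \<Longrightarrow> v \<in> X \<Longrightarrow> z \<in> X \<Longrightarrow> (\<And>x. x \<in> X \<Longrightarrow> \<rho> z \<le> \<rho> x) \<Longrightarrow> linked E X v z
    \<Longrightarrow> z \<in> weak_reach V E \<rho> s v"
  unfolding weak_reach_def by (intro CollectI exI[of _ X]) simp

lemma weak_reachE:
  assumes "z \<in> weak_reach V E \<rho> s v"
  obtains X where "X \<subseteq> V" "card X \<le> s" "v \<in> X" "z \<in> X" "\<forall>x\<in>X. \<rho> z \<le> \<rho> x" "linked E X v z"
  using assms unfolding weak_reach_def by (elim CollectE exE conjE) metis

lemma weak_reach_subset: "weak_reach V E \<rho> s v \<subseteq> V"
  by (auto elim!: weak_reachE)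

text \<open>Cut the path at its last visit to \<open>v\<close>; the rest avoids
  \<open>v\<close>.\<close>

lemma linked_first_step:
  assumes "linked E X v z" "v \<noteq> z"
  shows "\<exists>w\<in>X - {v}. (v, w) \<in> E \<and> linked E (X - {v}) w z"
proof -
  have "(a \<noteq> v \<and> linked E (X - {v}) a z) \<or> (\<exists>w\<in>X - {v}. (v, w) \<in> E \<and> linked E (X - {v}) w z)"
    if "linked E X a z" for a
    using that
  proof (induction rule: converse_rtrancl_induct)
    case base
    then show ?case using assms(2) by simp
  next
    case (step y w)
    show ?case
    proof (cases "\<exists>w\<in>X - {v}. (v, w) \<in> E \<and> linked E (X - {v}) w z")
      case False
      then have w: "w \<noteq> v" "linked E (X - {v}) w z" using step by auto
      then have "y \<noteq> v" using False step(1) by auto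
      then have "(y, w) \<in> Restr E (X - {v})" using step(1) w by auto
      then show ?thesis using w \<open>y \<noteq> v\<close> by (metis converse_rtrancl_into_rtrancl)
    qed simp
  qed
  from this[OF assms(1)] show ?thesis by simp
qed

text \<open>A maximal fan at \<open>v\<close> meets every short path from \<open>v\<close> to a smaller vertex, which bounds the
  weakly reachable sets recursively.\<close>

lemma card_weak_reach:
  assumes V: "finite V" "E \<subseteq> V \<times> V" and symE: "sym E" and inj: "inj_on \<rho> V"
    and fan: "\<And>v F. v \<in> V \<Longrightarrow> fan E {u\<in>V. \<rho> u \<le> \<rho> v} r v F \<Longrightarrow> card F \<le> k"
    and "s \<le> Suc r" "v \<in> V"
  shows "card (weak_reach V E \<rho> s v) \<le> ((\<lambda>m. 1 + k * Suc r * m) ^^ s) 0"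
  using assms(6,7)
proof (induction s arbitrary: v)
  case 0
  have "weak_reach V E \<rho> 0 v = {}"
    using V(1) by (auto elim!: weak_reachE dest: finite_subset)
  then show ?case by simp
next
  case (Suc s)
  let ?S = "{u\<in>V. \<rho> u \<le> \<rho> v}"
  have "\<exists>F. fan E ?S r v F \<and> (\<forall>F'. fan E ?S r v F' \<longrightarrow> card F' \<le> card F)"
    by (rule ex_max_card[of _ "{}" k]) (use fan Suc.prems in \<open>simp_all add: fan_def\<close>)
  then obtain F where F: "fan E ?S r v F" and max: "\<And>F'. fan E ?S r v F' \<Longrightarrow> card F' \<le> card F" by blast
  have finF: "finite F" using F by (simp add: fan_def)
  have blF: "finite (fst p) \<and> card (fst p) \<le> r" if "p \<in> F" for p
    using F that by (cases p) (auto simp: fan_def blade_def)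
  define U where "U = (\<Union>p\<in>F. insert (snd p) (fst p))"
  have finU: "finite U" unfolding U_def using finF blF by blast
  have "card U \<le> (\<Sum>p\<in>F. card (insert (snd p) (fst p)))"
    unfolding U_def using finF by (rule card_UN_le)
  also have "\<dots> \<le> (\<Sum>p\<in>F. Suc r)"
  proof (rule sum_mono)
    fix p assume "p \<in> F"
    then show "card (insert (snd p) (fst p)) \<le> Suc r" using blF[of p] by (simp add: card_insert_if)
  qed
  also have "\<dots> \<le> k * Suc r" using mult_le_mono1[OF fan[OF Suc.prems(2) F], of "Suc r"] by simp
  finally have cardU: "card U \<le> k * Suc r" .
  have "weak_reach V E \<rho> (Suc s) v \<subseteq> insert v (\<Union>w\<in>U \<inter> V. weak_reach V E \<rho> s w)"
  proof
    fix z assume "z \<in> weak_reach V E \<rho> (Suc s) v"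
    then obtain X where X: "X \<subseteq> V" "card X \<le> Suc s" "v \<in> X" "z \<in> X" "\<forall>x\<in>X. \<rho> z \<le> \<rho> x"
      "linked E X v z" by (rule weak_reachE)
    show "z \<in> insert v (\<Union>w\<in>U \<inter> V. weak_reach V E \<rho> s w)"
    proof (cases "z = v")
      case False
      have finX: "finite X" using X(1) V(1) finite_subset by auto
      have cX: "card (X - {v}) \<le> s" using X(2,3) finX by simp
      obtain w where w: "w \<in> X - {v}" "(v, w) \<in> E" "linked E (X - {v}) w z"
        using linked_first_step[OF X(6)] False by auto
      \<comment> \<open>\<open>Y\<close> collects what is connected to \<open>z\<close> without
        \<open>v\<close>. If it missed all blades of the maximal fan, a path from \<open>v\<close>
        through \<open>Y\<close>, cut at its first vertex in \<open>?S - {v}\<close>, would be a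
        further blade.\<close>
      define Y where "Y = component E (X - {v}) z"
      have Yz: "linked E (X - {v}) y z" if "y \<in> Y" for y
        using that linked_sym[OF symE] unfolding Y_def component_def by blast
      have YX: "Y \<subseteq> X - {v}" by (simp add: Y_def component_subset)
      have "Y \<inter> U \<noteq> {}"
      proof
        assume disj: "Y \<inter> U = {}"
        have zw: "linked E (X - {v}) z w" using linked_sym[OF symE w(3)] .
        then have wY: "w \<in> Y" using w(1) by (simp add: Y_def component_def)
        have "linked E Y z w"
          unfolding Y_def by (rule linked_component[OF zw]) (use X(4) False in simp)
        from linked_sym[OF symE this] have "linked E (insert v Y) w z"
          by (rule linked_mono) blast
        moreover have "(v, w) \<in> Restr E (insert v Y)" using w(2) wY by simp
        ultimately have vz: "linked E (insert v Y) v z"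
          by (metis converse_rtrancl_into_rtrancl)
        have "z \<in> ?S - {v}" using X False by auto
        then obtain y e where ye: "linked E (insert v Y - (?S - {v})) v y"
            "y \<in> insert v Y - (?S - {v})" "e \<in> insert v Y \<inter> (?S - {v})" "(y, e) \<in> E"
          using linked_exit[OF vz, of "?S - {v}"] by blast
        define Z where "Z = Y - ?S"
        have "linked E (insert v (insert e Z)) v y"
          using ye(1) by (rule linked_mono) (auto simp: Z_def)
        moreover have "(y, e) \<in> Restr E (insert v (insert e Z))" using ye(2,3,4) by (auto simp: Z_def)
        ultimately have ve: "linked E (insert v (insert e Z)) v e" by (rule rtrancl_into_rtrancl)
        have "card Z \<le> card (X - {v})" using YX finX unfolding Z_def by (intro card_mono) auto
        then have "card Z \<le> r" using cX Suc.prems(1) by linarith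
        moreover have "finite Z" using YX finX unfolding Z_def by (meson finite_Diff finite_subset)
        ultimately have bl: "blade E ?S r v Z e" using ve ye(3) by (auto simp: blade_def Z_def)
        have dj: "insert e Z \<inter> insert (snd p) (fst p) = {}" if "p \<in> F" for p
        proof -
          have "insert e Z \<subseteq> Y" using ye(3) by (auto simp: Z_def)
          then show ?thesis using disj that unfolding U_def by blast
        qed
        have nin: "(Z, e) \<notin> F" using dj by fastforce
        have "fan E ?S r v (insert (Z, e) F)"
          unfolding fan_iff
        proof (intro conjI ballI impI)
          show "finite (insert (Z, e) F)" using finF by simp
        next
          fix p assume "p \<in> insert (Z, e) F"
          then show "blade E ?S r v (fst p) (snd p)" using bl F by (auto simp: fan_iff)
        next
          fix p q assume "p \<in> insert (Z, e) F" "q \<in> insert (Z, e) F" "p \<noteq> q"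
          then consider "p = (Z, e)" "q \<in> F" | "q = (Z, e)" "p \<in> F" | "p \<in> F" "q \<in> F" "p \<noteq> q" by auto
          then show "insert (snd p) (fst p) \<inter> insert (snd q) (fst q) = {}"
          proof cases
            case 1
            then show ?thesis using dj[of q] by simp
          next
            case 2
            then show ?thesis using dj[of p] by (simp add: Int_commute)
          next
            case 3
            then show ?thesis using F by (simp add: fan_iff)
          qed
        qed
        from max[OF this] show False using nin finF by simp
      qed
      then obtain u where u: "u \<in> Y" "u \<in> U" by auto
      \<comment> \<open>Dropping \<open>v\<close> from the carrier leaves one vertex fewer, which
        drives the recursion: \<open>z\<close> is counted at one of the at most
        \<open>k * Suc r\<close> vertices of the fan, with \<open>s\<close> instead of
        \<open>Suc s\<close>.\<close>
      have "z \<in> weak_reach V E \<rho> s u"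
        using X cX u YX Yz[OF u(1)] False by (intro weak_reachI[of "X - {v}"]) auto
      then show ?thesis using u YX X(1) by blast
    qed simp
  qed
  then have "card (weak_reach V E \<rho> (Suc s) v) \<le> card (insert v (\<Union>w\<in>U \<inter> V. weak_reach V E \<rho> s w))"
    using finU finite_subset[OF weak_reach_subset V(1)] by (intro card_mono) simp_all
  also have "\<dots> \<le> 1 + card (\<Union>w\<in>U \<inter> V. weak_reach V E \<rho> s w)"
    by (cases "finite (\<Union>w\<in>U \<inter> V. weak_reach V E \<rho> s w)") (simp_all add: card_insert_if)
  finally have le: "card (weak_reach V E \<rho> (Suc s) v) \<le> 1 + card (\<Union>w\<in>U \<inter> V. weak_reach V E \<rho> s w)" .
  have "card (\<Union>w\<in>U \<inter> V. weak_reach V E \<rho> s w) \<le> (\<Sum>w\<in>U \<inter> V. card (weak_reach V E \<rho> s w))"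
    using finU by (intro card_UN_le) auto
  also have "\<dots> \<le> (\<Sum>w\<in>U \<inter> V. ((\<lambda>m. 1 + k * Suc r * m) ^^ s) 0)"
    using Suc by (intro sum_mono) auto
  also have "\<dots> = card (U \<inter> V) * ((\<lambda>m. 1 + k * Suc r * m) ^^ s) 0"
    by (simp only: sum_constant of_nat_id)
  also have "\<dots> \<le> (k * Suc r) * ((\<lambda>m. 1 + k * Suc r * m) ^^ s) 0"
  proof (rule mult_le_mono1)
    show "card (U \<inter> V) \<le> k * Suc r" using cardU finU by (meson card_mono inf_le1 le_trans)
  qed
  finally show ?case using le by (simp only: funpow.simps comp_apply)
qed

section \<open>Colourings in which weakly reachable sets are rainbow\<close>

lemma ex_greedy_coloring:
  assumes "finite V" "inj_on (\<rho> :: 'a \<Rightarrow> nat) V" "\<And>v. v \<in> V \<Longrightarrow> N v \<subseteq> {u\<in>V. \<rho> u < \<rho> v} \<and> card (N v) < K"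
  shows "\<exists>c. \<forall>v\<in>V. c v < K \<and> (\<forall>u\<in>N v. c u \<noteq> c v)"
  using assms
proof (induction V rule: finite_psubset_induct)
  case (psubset V)
  show ?case
  proof (cases "V = {}")
    case False
    then have "Max (\<rho> ` V) \<in> \<rho> ` V" using psubset.hyps by simp
    then obtain m where m: "m \<in> V" "\<rho> m = Max (\<rho> ` V)" by force
    then have le: "\<rho> v \<le> \<rho> m" if "v \<in> V" for v using that psubset.hyps by simp
    have "V - {m} \<subset> V" using m by auto
    moreover have "inj_on \<rho> (V - {m})" using psubset.prems(1) by (auto simp: inj_on_def)
    moreover have "N v \<subseteq> {u \<in> V - {m}. \<rho> u < \<rho> v} \<and> card (N v) < K" if "v \<in> V - {m}" for v
      using psubset.prems(2)[of v] le[of v] that by fastforce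
    ultimately obtain c where c: "\<And>v. v \<in> V - {m} \<Longrightarrow> c v < K \<and> (\<forall>u\<in>N v. c u \<noteq> c v)"
      using psubset.IH[of "V - {m}"] by blast
    have "finite (N m)" using psubset.prems(2)[OF m(1)] psubset.hyps by (auto intro: finite_subset)
    then have "card (c ` N m) < card {..<K}"
      using psubset.prems(2)[OF m(1)] card_image_le[of "N m" c] by simp
    then have "\<not> {..<K} \<subseteq> c ` N m" by (meson \<open>finite (N m)\<close> card_mono finite_imageI not_less)
    then obtain x where x: "x < K" "x \<notin> c ` N m" by auto
    have "m \<notin> N v" if "v \<in> V" for v using psubset.prems(2)[OF that] le[OF that] by fastforce
    then have "\<forall>v\<in>V. (c(m := x)) v < K \<and> (\<forall>u\<in>N v. (c(m := x)) u \<noteq> (c(m := x)) v)"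
      using c x by (auto simp: image_iff)
    then show ?thesis by blast
  qed simp
qed

text \<open>Two vertices weakly reachable from \<open>v\<close> are joined through \<open>v\<close>
  by a carrier of at most \<open>2 * s\<close> vertices, whose minimum is the smaller of the two. So
  the smaller is weakly reachable from the larger with \<open>2 * s\<close>, and a greedy colouring
  that separates each vertex from what it weakly reaches with \<open>2 * s\<close> suffices.\<close>

lemma bounded_expansion_coloring:
  assumes "bounded_expansion \<C>" "graph_class \<C>"
  shows "\<exists>K :: nat. \<forall>G\<in>\<C>. \<exists>\<rho> c. inj_on \<rho> (pverts G) \<and> c ` pverts G \<subseteq> {..<K} \<and>
    (\<forall>v\<in>pverts G. inj_on c (weak_reach (pverts G) (parcs G) \<rho> s v))"
proof -
  \<comment> \<open>The fans used have blades with at most \<open>r = 2 * s\<close> inner vertices,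
    and \<open>sparse_minors_no_large_fan\<close> asks for branch carriers of size
    \<open>Suc (2 * r)\<close>.\<close>
  obtain b where b: "\<And>G. G \<in> \<C> \<Longrightarrow> sparse_minors (pverts G) (parcs G) (Suc (2 * (2 * s))) b"
    using bounded_expansion_sparse_minors[OF assms] by metis
  define k where "k = b * (1 + 2 * (2 * s) * b) * (2 * (1 + 4 * b))"
  define K where "K = Suc (((\<lambda>m. 1 + k * Suc (2 * s) * m) ^^ (2 * s)) 0)"
  have "\<exists>\<rho> c. inj_on \<rho> (pverts G) \<and> c ` pverts G \<subseteq> {..<K} \<and>
    (\<forall>v\<in>pverts G. inj_on c (weak_reach (pverts G) (parcs G) \<rho> s v))" if G: "G \<in> \<C>" for G
  proof -
    let ?V = "pverts G" and ?E = "parcs G"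
    have "pair_graph G" using G assms(2) by (simp add: graph_class_def)
    note G' = pair_graphD[OF this]
    have "\<exists>\<rho> :: nat \<Rightarrow> nat. inj_on \<rho> ?V \<and>
        (\<forall>v\<in>?V. (\<lambda>S v. \<forall>F. fan ?E S (2 * s) v F \<longrightarrow> card F \<le> k) {u\<in>?V. \<rho> u \<le> \<rho> v} v)"
      using sparse_minors_no_large_fan[OF b[OF G] G'(1) _ G'(2,3)]
      by (intro ex_removal_order G'(1)) (simp add: k_def)
    then obtain \<rho> :: "nat \<Rightarrow> nat" where \<rho>: "inj_on \<rho> ?V"
      "\<And>v F. v \<in> ?V \<Longrightarrow> fan ?E {u\<in>?V. \<rho> u \<le> \<rho> v} (2 * s) v F \<Longrightarrow> card F \<le> k" by auto
    define N where "N v = weak_reach ?V ?E \<rho> (2 * s) v \<inter> {u. \<rho> u < \<rho> v}" for v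
    have "N v \<subseteq> {u\<in>?V. \<rho> u < \<rho> v} \<and> card (N v) < K" if v: "v \<in> ?V" for v
    proof
      show "N v \<subseteq> {u\<in>?V. \<rho> u < \<rho> v}"
        using weak_reach_subset[of ?V ?E \<rho> "2 * s" v] unfolding N_def by auto
      have "finite (weak_reach ?V ?E \<rho> (2 * s) v)" by (rule finite_subset[OF weak_reach_subset G'(1)])
      then have "card (N v) \<le> card (weak_reach ?V ?E \<rho> (2 * s) v)"
        unfolding N_def by (intro card_mono) auto
      also have "\<dots> \<le> ((\<lambda>m. 1 + k * Suc (2 * s) * m) ^^ (2 * s)) 0"
        by (rule card_weak_reach[OF G'(1,2,3) \<rho>(1) \<rho>(2)]) (use v in auto)
      also have "\<dots> < K" by (simp add: K_def)
      finally show "card (N v) < K" .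
    qed
    then have "\<exists>c. \<forall>v\<in>?V. c v < K \<and> (\<forall>u\<in>N v. c u \<noteq> c v)"
      by (rule ex_greedy_coloring[OF G'(1) \<rho>(1)])
    then obtain c where c: "\<And>v. v \<in> ?V \<Longrightarrow> c v < K" "\<And>v u. v \<in> ?V \<Longrightarrow> u \<in> N v \<Longrightarrow> c u \<noteq> c v"
      by auto
    have key: "c x \<noteq> c y" if xy: "x \<in> weak_reach ?V ?E \<rho> s v" "y \<in> weak_reach ?V ?E \<rho> s v" "\<rho> x < \<rho> y" for x y v
    proof -
      obtain X where X: "X \<subseteq> ?V" "card X \<le> s" "v \<in> X" "x \<in> X" "\<forall>u\<in>X. \<rho> x \<le> \<rho> u" "linked ?E X v x"
        using xy(1) by (rule weak_reachE)
      obtain Y where Y: "Y \<subseteq> ?V" "card Y \<le> s" "v \<in> Y" "y \<in> Y" "\<forall>u\<in>Y. \<rho> y \<le> \<rho> u" "linked ?E Y v y"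
        using xy(2) by (rule weak_reachE)
      have "linked ?E (X \<union> Y) y v"
        using linked_sym[OF G'(3) Y(6)] by (rule linked_mono) auto
      also have "linked ?E (X \<union> Y) v x" using X(6) by (rule linked_mono) auto
      finally have "x \<in> weak_reach ?V ?E \<rho> (2 * s) y"
        using X Y xy(3) card_Un_le[of X Y]
        by (intro weak_reachI[of "X \<union> Y"]) (auto intro: order.trans less_imp_le)
      then show ?thesis using c(2)[of y x] xy(3) Y(1,4) by (auto simp: N_def)
    qed
    have "inj_on c (weak_reach ?V ?E \<rho> s v)" for v
    proof (rule inj_onI, rule ccontr)
      fix x y assume xy: "x \<in> weak_reach ?V ?E \<rho> s v" "y \<in> weak_reach ?V ?E \<rho> s v" "c x = c y" "x \<noteq> y"
      then have "x \<in> ?V" "y \<in> ?V" using weak_reach_subset[of ?V ?E \<rho> s v] by auto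
      then have "\<rho> x \<noteq> \<rho> y" using inj_onD[OF \<rho>(1)] xy(4) by blast
      then show False using key[OF xy(1,2)] key[OF xy(2,1)] xy(3) by linarith
    qed
    then show ?thesis using \<rho>(1) c(1) by (intro exI[of _ \<rho>] exI[of _ c]) auto
  qed
  then have "\<forall>G\<in>\<C>. \<exists>\<rho> c. inj_on \<rho> (pverts G) \<and> c ` pverts G \<subseteq> {..<K} \<and>
    (\<forall>v\<in>pverts G. inj_on c (weak_reach (pverts G) (parcs G) \<rho> s v))" ..
  then show ?thesis by (rule exI)
qed

section \<open>Depth labellings\<close>

lemma successively_linked:
  assumes "successively (\<lambda>x y. (x, y) \<in> E) xs" "sym E" "a \<in> set xs" "b \<in> set xs"
  shows "linked E (set xs) a b"
proof -
  have hd: "linked E (set xs) (hd xs) a" if "successively (\<lambda>x y. (x, y) \<in> E) xs" "a \<in> set xs" for a xs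
    using that
  proof (induction xs)
    case (Cons x xs)
    show ?case
    proof (cases "a = x")
      case False
      then have a: "a \<in> set xs" using Cons.prems(2) by simp
      then have ne: "xs \<noteq> []" by auto
      then have "(x, hd xs) \<in> Restr E (set (x # xs))" using Cons.prems(1) by (cases xs) auto
      moreover have "linked E (set xs) (hd xs) a"
        by (rule Cons.IH[OF _ a]) (use Cons.prems(1) ne in \<open>simp add: successively_Cons\<close>)
      then have "linked E (set (x # xs)) (hd xs) a"
        by (rule linked_mono) (simp add: subset_insertI)
      ultimately show ?thesis by (simp only: list.sel converse_rtrancl_into_rtrancl)
    qed simp
  qed simp
  from linked_sym[OF assms(2) hd[OF assms(1,3)]] hd[OF assms(1,4)] show ?thesis
    by (rule rtrancl_trans)
qed

lemma linked_path:
  assumes "linked E X v z" "v \<in> X"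
  shows "\<exists>xs. xs \<noteq> [] \<and> hd xs = v \<and> last xs = z \<and> set xs \<subseteq> X \<and> distinct xs \<and> successively (\<lambda>x y. (x, y) \<in> E) xs"
  using assms(1)
proof (induction rule: rtrancl_induct)
  case base
  then show ?case using assms(2) by (intro exI[of _ "[v]"]) auto
next
  case (step y w)
  then obtain xs where xs: "xs \<noteq> []" "hd xs = v" "last xs = y" "set xs \<subseteq> X" "distinct xs" "successively (\<lambda>x y. (x, y) \<in> E) xs"
    by auto
  show ?case
  proof (cases "w \<in> set xs")
    case True
    then obtain as bs where ab: "xs = as @ w # bs" by (meson split_list)
    have "hd (as @ [w]) = v" using xs(2) by (cases as) (auto simp: ab)
    moreover have "successively (\<lambda>x y. (x, y) \<in> E) (as @ [w])"
      using xs(6) by (auto simp: ab successively_append_iff)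
    ultimately show ?thesis using xs by (intro exI[of _ "as @ [w]"]) (auto simp: ab)
  next
    case False
    then show ?thesis using xs step(2) by (intro exI[of _ "xs @ [w]"]) (auto simp: successively_append_iff)
  qed
qed

text \<open>A walk of labels whose inner depths are not below the depths of its ends is realised by a walk
  between ancestors of a single vertex: split it at an inner label of minimal depth.\<close>

lemma depth_labelled_walk:
  fixes d :: "'l \<Rightarrow> nat" and M :: "'l \<Rightarrow> (nat \<times> nat \<times> nat) set"
  assumes symT: "sym T" and ne: "\<And>x y. (x, y) \<in> T \<Longrightarrow> d x \<noteq> d y"
    and edge: "\<And>x y. (x, y) \<in> T \<Longrightarrow> d x < d y \<Longrightarrow> (d x, d y, 1) \<in> M y"
    and trunc: "\<And>x y. (x, y) \<in> T \<Longrightarrow> d x < d y \<Longrightarrow> M x = {(i, j, l) \<in> M y. i \<le> d x \<and> j \<le> d x}"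
    and refl: "\<And>x y. (x, y) \<in> T \<Longrightarrow> (d x, d x, 0) \<in> M x"
    and Msym: "\<And>x y i j l. (x, y) \<in> T \<Longrightarrow> (i, j, l) \<in> M x \<Longrightarrow> (j, i, l) \<in> M x"
    and trans: "\<And>x y i j k l m. (x, y) \<in> T \<Longrightarrow> (i, j, l) \<in> M x \<Longrightarrow> (j, k, m) \<in> M x \<Longrightarrow> l + m \<le> L \<Longrightarrow> (i, k, l + m) \<in> M x"
    and w: "\<And>i :: nat. (w i, w (Suc i)) \<in> T"
    and "n \<le> L" "\<And>k. a < k \<Longrightarrow> k < a + n \<Longrightarrow> d (w a) \<le> d (w k) \<and> d (w (a + n)) \<le> d (w k)"
  shows "(d (w a) \<le> d (w (a + n)) \<longrightarrow> (d (w a), d (w (a + n)), n) \<in> M (w (a + n))) \<and>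
    (d (w (a + n)) \<le> d (w a) \<longrightarrow> (d (w a), d (w (a + n)), n) \<in> M (w a))"
  using assms(9,10)
proof (induction n arbitrary: a rule: less_induct)
  case (less n)
  \<comment> \<open>Labels at the two ends of an arc agree on all entries up to the smaller depth.
    An entry therefore survives along any stretch of the walk that never rises above the depths it
    mentions.\<close>
  have const: "t \<in> M (w a) \<longleftrightarrow> t \<in> M (w b)"
    if "a \<le> b" "\<And>k. a \<le> k \<Longrightarrow> k \<le> b \<Longrightarrow> J \<le> d (w k)" "fst t \<le> J" "fst (snd t) \<le> J" for a b J t
    using that(1,2)
  proof (induction b rule: dec_induct)
    case (step b)
    have "t \<in> M (w b) \<longleftrightarrow> t \<in> M (w (Suc b))"
    proof (cases "d (w b) < d (w (Suc b))")
      case True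
      have "J \<le> d (w b)" using step by auto
      then show ?thesis using trunc[OF w True] that(3,4) by (cases t) auto
    next
      case False
      then have "d (w (Suc b)) < d (w b)" using ne[OF w[of b]] by simp
      moreover have "J \<le> d (w (Suc b))" using step.prems[of "Suc b"] step.hyps by simp
      ultimately show ?thesis using trunc[OF symD[OF symT w]] that(3,4) by (cases t) auto
    qed
    then show ?case using step by auto
  qed simp
  consider "n = 0" | "n = 1" | "2 \<le> n" by linarith
  then show ?case
  proof cases
    case 1
    then show ?thesis using refl[OF w] by simp
  next
    case 2
    show ?thesis
    proof (cases "d (w a) < d (w (Suc a))")
      case True
      then show ?thesis using edge[OF w True] 2 by simp
    next
      case False
      then have lt: "d (w (Suc a)) < d (w a)" using ne[OF w[of a]] by simp
      show ?thesis using Msym[OF w edge[OF symD[OF symT w] lt]] 2 lt by simp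
    qed
  next
    case 3
    let ?K = "{a<..<a + n}"
    have "Suc a \<in> ?K" using 3 by auto
    then obtain k where k: "k \<in> ?K" "\<And>k'. k' \<in> ?K \<Longrightarrow> d (w k) \<le> d (w k')"
      using ex_has_least_nat[of "\<lambda>k. k \<in> ?K" "Suc a" "\<lambda>k. d (w k)"] by auto
    have ka: "a + (k - a) = k" "k + (a + n - k) = a + n" using k(1) by auto
    have dk: "d (w a) \<le> d (w k)" "d (w (a + n)) \<le> d (w k)" using less.prems(2) k(1) by auto
    have 1: "(d (w a), d (w k), k - a) \<in> M (w k)"
      using less.IH[of "k - a" a] k dk less.prems unfolding ka by (auto simp: less_imp_le)
    have 2: "(d (w k), d (w (a + n)), a + n - k) \<in> M (w k)"
      using less.IH[of "a + n - k" k] k dk less.prems unfolding ka by auto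
    have "(d (w a), d (w (a + n)), (k - a) + (a + n - k)) \<in> M (w k)"
      using k(1) less.prems(1) by (intro trans[OF w 1 2]) auto
    then have 3: "(d (w a), d (w (a + n)), n) \<in> M (w k)" using k(1) by simp
    show ?thesis
    proof (intro conjI impI)
      assume le: "d (w a) \<le> d (w (a + n))"
      have "d (w (a + n)) \<le> d (w k')" if "k \<le> k'" "k' \<le> a + n" for k'
        using that less.prems(2)[of k'] k(1) by (cases "k' = a + n") auto
      then show "(d (w a), d (w (a + n)), n) \<in> M (w (a + n))"
        using const[of k "a + n" "d (w (a + n))" "(d (w a), d (w (a + n)), n)"] 3 le k(1) by auto
    next
      assume le: "d (w (a + n)) \<le> d (w a)"
      have "d (w a) \<le> d (w k')" if "a \<le> k'" "k' \<le> k" for k'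
        using that less.prems(2)[of k'] k(1) by (cases "k' = a") auto
      then show "(d (w a), d (w (a + n)), n) \<in> M (w a)"
        using const[of a k "d (w a)" "(d (w a), d (w (a + n)), n)"] 3 le k(1) by auto
    qed
  qed
qed

text \<open>The periodic extension allows a closed walk to be started anywhere, in particular at a
  label of least depth.\<close>

lemma relpow_closed_periodic:
  assumes "(x, x) \<in> T ^^ n" "0 < n"
  obtains w :: "nat \<Rightarrow> 'a" where "\<And>i. (w i, w (Suc i)) \<in> T" "\<And>i. w (i + n) = w i" "w 0 = x"
proof -
  obtain f where f: "f 0 = x" "f n = x" "\<And>i. i < n \<Longrightarrow> (f i, f (Suc i)) \<in> T"
    using assms(1) by (auto simp: relpow_fun_conv)
  have "(f (i mod n), f (Suc i mod n)) \<in> T" for i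
    using f(3)[of "i mod n"] f(1,2) assms(2) by (auto simp: mod_Suc)
  then show thesis using that[of "\<lambda>i. f (i mod n)"] f(1) by simp
qed

text \<open>Started at a label of least depth, the whole closed walk satisfies the condition of
  \<open>depth_labelled_walk\<close>. It thus contributes an entry with equal depths and odd length,
  which \<open>noodd\<close> forbids.\<close>

lemma no_odd_closed_labelled_walk:
  fixes d :: "'l \<Rightarrow> nat" and M :: "'l \<Rightarrow> (nat \<times> nat \<times> nat) set"
  assumes symT: "sym T" and ne: "\<And>x y. (x, y) \<in> T \<Longrightarrow> d x \<noteq> d y"
    and edge: "\<And>x y. (x, y) \<in> T \<Longrightarrow> d x < d y \<Longrightarrow> (d x, d y, 1) \<in> M y"
    and trunc: "\<And>x y. (x, y) \<in> T \<Longrightarrow> d x < d y \<Longrightarrow> M x = {(i, j, l) \<in> M y. i \<le> d x \<and> j \<le> d x}"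
    and refl: "\<And>x y. (x, y) \<in> T \<Longrightarrow> (d x, d x, 0) \<in> M x"
    and Msym: "\<And>x y i j l. (x, y) \<in> T \<Longrightarrow> (i, j, l) \<in> M x \<Longrightarrow> (j, i, l) \<in> M x"
    and trans: "\<And>x y i j k l m. (x, y) \<in> T \<Longrightarrow> (i, j, l) \<in> M x \<Longrightarrow> (j, k, m) \<in> M x \<Longrightarrow> l + m \<le> L \<Longrightarrow> (i, k, l + m) \<in> M x"
    and noodd: "\<And>x y i l. (x, y) \<in> T \<Longrightarrow> odd l \<Longrightarrow> (i, i, l) \<notin> M x"
    and n: "odd n" "n \<le> L"
  shows "(x, x) \<notin> T ^^ n"
proof
  assume "(x, x) \<in> T ^^ n"
  moreover have "0 < n" using n(1) by (auto intro: Nat.gr0I)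
  ultimately obtain w where w: "\<And>i. (w i, w (Suc i)) \<in> T" "\<And>i. w (i + n) = w i"
    by (rule relpow_closed_periodic) blast
  obtain a where a: "\<And>k. d (w a) \<le> d (w k)"
    using ex_has_least_nat[of "\<lambda>_. True" 0 "\<lambda>k. d (w k)"] by auto
  have "(d (w a), d (w (a + n)), n) \<in> M (w a)"
    using depth_labelled_walk[where T = T and d = d and M = M and L = L and w = w and n = n and a = a,
        OF assms(1-7) w(1) n(2)] a w(2) by simp
  then show False using noodd[OF w(1) n(1)] w(2) by simp
qed

text \<open>The colour of the minimum of a path with \<open>2 ^ j\<close> vertices is unique on this path, so removing the
  minimum leaves a path with \<open>2 ^ (j - 1)\<close> vertices and one colour less.\<close>

lemma colored_path_length:
  assumes "distinct xs" "successively (\<lambda>x y. (x, y) \<in> E) xs" "set xs \<subseteq> V" "card (c ` set xs) \<le> j" "j \<le> q"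
    and symE: "sym E" and inj: "\<And>v. v \<in> V \<Longrightarrow> inj_on c (weak_reach V E \<rho> (2 ^ q) v)"
  shows "length xs < 2 ^ j"
  using assms(1-5)
proof (induction j arbitrary: xs)
  case 0
  then show ?case by simp
next
  case (Suc j)
  show ?case
  proof (rule ccontr)
    assume "\<not> length xs < 2 ^ Suc j"
    \<comment> \<open>A prefix of exactly \<open>2 ^ Suc j\<close> vertices is long enough for the
      contradiction and still fits into the carriers of size \<open>2 ^ q\<close> for which colours
      are known to be distinct.\<close>
    define ys where "ys = take (2 ^ Suc j) xs"
    have ys: "length ys = 2 ^ Suc j" "distinct ys" "set ys \<subseteq> set xs" "successively (\<lambda>x y. (x, y) \<in> E) ys"
      using \<open>\<not> length xs < 2 ^ Suc j\<close> Suc.prems(1,2) set_take_subset[of "2 ^ Suc j" xs]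
        successively_append_iff[of _ "take (2 ^ Suc j) xs" "drop (2 ^ Suc j) xs"]
      unfolding ys_def by (simp_all del: power_Suc)
    then have "ys \<noteq> []" by auto
    then obtain m where m: "m \<in> set ys" "\<And>x. x \<in> set ys \<Longrightarrow> \<rho> m \<le> \<rho> x"
      using ex_has_least_nat[of "\<lambda>x. x \<in> set ys" "hd ys" \<rho>] by auto
    have unique: "c a \<noteq> c m" if a: "a \<in> set ys" "a \<noteq> m" for a
    proof -
      have "card (set ys) \<le> 2 ^ q" using ys(1,2) Suc.prems(5) by (simp add: distinct_card del: power_Suc)
      then have "m \<in> weak_reach V E \<rho> (2 ^ q) a"
        using successively_linked[OF ys(4) symE a(1) m(1)] m a(1) ys(3) Suc.prems(3)
        by (intro weak_reachI[of "set ys"]) auto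
      moreover have "a \<in> weak_reach V E \<rho> (2 ^ q) a"
        using a ys(3) Suc.prems(3) by (intro weak_reachI[of "{a}"]) auto
      ultimately show ?thesis using inj[of a] a ys(3) Suc.prems(3) by (meson inj_onD subsetD)
    qed
    obtain as bs where ab: "ys = as @ m # bs" using m(1) by (meson split_list)
    have short: "length zs < 2 ^ j" if zs: "distinct zs" "successively (\<lambda>x y. (x, y) \<in> E) zs" "set zs \<subseteq> set ys - {m}" for zs
    proof (rule Suc.IH[OF zs(1,2)])
      show "set zs \<subseteq> V" using zs(3) ys(3) Suc.prems(3) by blast
      have "c ` set zs \<subseteq> c ` set xs - {c m}" using zs(3) ys(3) unique by auto
      then have "card (c ` set zs) \<le> card (c ` set xs - {c m})" by (intro card_mono) auto
      also have "\<dots> \<le> j" using Suc.prems(4) m(1) ys(3) by (auto simp: card_Diff_singleton)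
      finally show "card (c ` set zs) \<le> j" .
      show "j \<le> q" using Suc.prems(5) by simp
    qed
    have "length as < 2 ^ j" "length bs < 2 ^ j"
      using ys(2,4) by (intro short; auto simp: ab successively_append_iff successively_Cons)+
    then show False using ys(1) by (simp add: ab)
  qed
qed

text \<open>Carriers of size \<open>card W\<close> impose no restriction on the distance, so this is
  ancestry in the elimination forest of the graph on \<open>W\<close> for the order
  \<open>\<rho>\<close>. The number of ancestors is the depth, roots having depth
  \<open>1\<close>.\<close>

definition ancestors :: "'a set \<Rightarrow> ('a \<times> 'a) set \<Rightarrow> ('a \<Rightarrow> nat) \<Rightarrow> 'a \<Rightarrow> 'a set" where
  "ancestors W E \<rho> v = weak_reach W E \<rho> (card W) v"

text \<open>Ancestors are identified by their depths, so that the data of different graphs can be compared.\<close>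

definition walk_lengths :: "'a set \<Rightarrow> ('a \<times> 'a) set \<Rightarrow> ('a \<Rightarrow> nat) \<Rightarrow> nat \<Rightarrow> 'a \<Rightarrow> (nat \<times> nat \<times> nat) set" where
  "walk_lengths W E \<rho> L v = {(card (ancestors W E \<rho> y), card (ancestors W E \<rho> z), l) |y z l.
     y \<in> ancestors W E \<rho> v \<and> z \<in> ancestors W E \<rho> v \<and> l \<le> L \<and> (y, z) \<in> E ^^ l}"

lemma relpow_sym: "sym E \<Longrightarrow> (x, y) \<in> E ^^ l \<Longrightarrow> (y, x) \<in> E ^^ l"
proof (induction l arbitrary: x)
  case (Suc l)
  from Suc.prems(2) obtain z where "(x, z) \<in> E" "(z, y) \<in> E ^^ l" by (metis relpow_Suc_D2)
  with Suc show ?case by (meson relpow_Suc_I symD)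
qed simp

section \<open>Depths and walk lengths in the elimination forest of a vertex set\<close>

context
  fixes W :: "'a set" and E :: "('a \<times> 'a) set" and \<rho> :: "'a \<Rightarrow> nat"
  assumes finW: "finite W" and symE: "sym E" and irreflE: "irrefl E" and inj\<rho>: "inj_on \<rho> W"
begin

abbreviation "anc \<equiv> ancestors W E \<rho>"

abbreviation "depth v \<equiv> card (anc v)"

abbreviation "lens \<equiv> walk_lengths W E \<rho>"

lemma ancestorsI:
  "X \<subseteq> W \<Longrightarrow> v \<in> X \<Longrightarrow> z \<in> X \<Longrightarrow> (\<And>x. x \<in> X \<Longrightarrow> \<rho> z \<le> \<rho> x) \<Longrightarrow> linked E X v z \<Longrightarrow> z \<in> anc v"
  unfolding ancestors_def using finW by (intro weak_reachI[of X]) (auto intro: card_mono)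

lemma finite_ancestors: "finite (anc v)"
  unfolding ancestors_def by (rule finite_subset[OF weak_reach_subset finW])

lemma ancestors_self: "v \<in> W \<Longrightarrow> v \<in> anc v"
  by (rule ancestorsI[of "{v}"]) auto

lemma ancestors_in: "z \<in> anc v \<Longrightarrow> z \<in> W \<and> \<rho> z \<le> \<rho> v"
  unfolding ancestors_def by (auto elim!: weak_reachE)

lemma ancestors_edge: "(u, v) \<in> E \<Longrightarrow> u \<in> W \<Longrightarrow> v \<in> W \<Longrightarrow> \<rho> u < \<rho> v \<Longrightarrow> u \<in> anc v"
  using symD[OF symE, of u v] by (intro ancestorsI[of "{u, v}"]) auto

text \<open>The union of a carrier from \<open>v\<close> to \<open>z\<close> with a carrier that
  starts at one of these two vertices is connected, and its minimum is the smaller of the two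
  ancestors. Hence the ancestors of \<open>v\<close> form a chain, and those of \<open>z\<close> are
  an initial segment of it.\<close>

lemma ancestors_below:
  assumes z: "z \<in> anc v"
  shows "anc z = {y \<in> anc v. \<rho> y \<le> \<rho> z}"
proof (intro equalityI subsetI CollectI conjI)
  obtain X where X: "X \<subseteq> W" "v \<in> X" "z \<in> X" "\<forall>x\<in>X. \<rho> z \<le> \<rho> x" "linked E X v z"
    using z unfolding ancestors_def by (rule weak_reachE)
  have join: "linked E (X \<union> Y) a d" if "linked E X a b" "linked E Y b d" for a b d Y
  proof -
    have "linked E (X \<union> Y) a b" using that(1) by (rule linked_mono) simp
    also have "linked E (X \<union> Y) b d" using that(2) by (rule linked_mono) simp
    finally show ?thesis .
  qed
  fix y
  {
    assume y: "y \<in> anc z"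
    then obtain Y where Y: "Y \<subseteq> W" "z \<in> Y" "y \<in> Y" "\<forall>x\<in>Y. \<rho> y \<le> \<rho> x" "linked E Y z y"
      unfolding ancestors_def by (rule weak_reachE)
    show "\<rho> y \<le> \<rho> z" using Y by simp
    show "y \<in> anc v"
      by (rule ancestorsI[of "X \<union> Y"]) (use X Y join[OF X(5) Y(5)] in \<open>auto intro: le_trans\<close>)
  next
    assume y: "y \<in> {y \<in> anc v. \<rho> y \<le> \<rho> z}"
    then have "y \<in> weak_reach W E \<rho> (card W) v" by (simp add: ancestors_def)
    then obtain Y where Y: "Y \<subseteq> W" "v \<in> Y" "y \<in> Y" "\<forall>x\<in>Y. \<rho> y \<le> \<rho> x" "linked E Y v y"
      by (rule weak_reachE)
    show "y \<in> anc z"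
      by (rule ancestorsI[of "X \<union> Y"])
        (use X Y y join[OF linked_sym[OF symE X(5)] Y(5)] in \<open>auto intro: le_trans\<close>)
  }
qed

lemma card_ancestors_le_iff:
  assumes "y \<in> anc v" "z \<in> anc v"
  shows "depth y \<le> depth z \<longleftrightarrow> \<rho> y \<le> \<rho> z"
proof -
  have mono: "depth y \<le> depth z"
    if "y \<in> anc v" "z \<in> anc v" "\<rho> y \<le> \<rho> z" for y z
    using that finite_ancestors[of v] by (simp add: ancestors_below) (rule card_mono; auto)
  have strict: "depth z < depth y" if "\<rho> z < \<rho> y"
  proof (rule psubset_card_mono[OF finite_ancestors])
    have "y \<in> anc y" using assms ancestors_in ancestors_self by blast
    moreover have "y \<notin> anc z" using that ancestors_in[of y z] by auto
    moreover have "anc z \<subseteq> anc y"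
      using assms that by (auto simp: ancestors_below)
    ultimately show "anc z \<subset> anc y" by auto
  qed
  show ?thesis using mono[OF assms] strict by (meson leD not_le_imp_less)
qed

text \<open>Depth names an ancestor of a given vertex uniquely. This makes it legitimate to compose
  two recorded walks that agree only in the depth of their common end, as in
  \<open>walk_lengths_trans\<close>.\<close>

lemma card_ancestors_inj:
  assumes "y \<in> anc v" "z \<in> anc v" "depth y = depth z"
  shows "y = z"
proof -
  have "\<rho> y = \<rho> z" using card_ancestors_le_iff[OF assms(1,2)] card_ancestors_le_iff[OF assms(2,1)] assms(3) by auto
  then show ?thesis using inj_onD[OF inj\<rho>] ancestors_in assms(1,2) by blast
qed

text \<open>The smaller end of an edge is an ancestor of the larger one, which is the defining
  property of an elimination forest.\<close>

lemma edge_depth: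
  assumes "(u, v) \<in> E" "u \<in> W" "v \<in> W"
  shows "depth u \<noteq> depth v"
    and "depth u < depth v \<Longrightarrow> u \<in> anc v"
proof -
  have *: "depth u < depth v"
    if "(u, v) \<in> E" "u \<in> W" "v \<in> W" "\<rho> u < \<rho> v" for u v
    using card_ancestors_le_iff[OF ancestors_self[OF that(3)] ancestors_edge[OF that]] that(4) by simp
  have "u \<noteq> v" using assms(1) irreflE by (auto simp: irrefl_def)
  then have "\<rho> u \<noteq> \<rho> v" using inj_onD[OF inj\<rho>] assms by blast
  then consider "\<rho> u < \<rho> v" | "\<rho> v < \<rho> u" by linarith
  note cases = this
  show "depth u \<noteq> depth v"
    using cases *[OF assms] *[OF symD[OF symE assms(1)] assms(3,2)] by (metis less_irrefl)
  show "u \<in> anc v" if "depth u < depth v"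
    using cases
  proof cases
    case 1
    then show ?thesis using ancestors_edge assms by blast
  next
    case 2
    then show ?thesis using *[OF symD[OF symE assms(1)] assms(3,2)] that by simp
  qed
qed

text \<open>This and the lemmas up to \<open>walk_lengths_closed\<close> provide the hypotheses of
  \<open>no_odd_closed_labelled_walk\<close> for labels of actual vertices;
  \<open>walk_lengths_bounded\<close> is for the finiteness of the set of labels.\<close>

lemma walk_lengths_edge:
  assumes "(u, v) \<in> E" "u \<in> W" "v \<in> W" "depth u < depth v" "1 \<le> L"
  shows "(depth u, depth v, 1) \<in> lens L v"
proof -
  have "(u, v) \<in> E ^^ 1" using assms(1) by simp
  then show ?thesis
    using edge_depth(2)[OF assms(1-4)] ancestors_self[OF assms(3)] assms(5) unfolding walk_lengths_def by blast
qed

lemma walk_lengths_trunc: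
  assumes u: "u \<in> anc v"
  shows "lens L u = {(i, j, l) \<in> lens L v.
    i \<le> depth u \<and> j \<le> depth u}" (is "?A = ?B")
proof -
  have *: "y \<in> anc u \<longleftrightarrow> y \<in> anc v \<and> depth y \<le> depth u" for y
    using card_ancestors_le_iff[OF _ u] ancestors_below[OF u] by auto
  show ?thesis
  proof (intro set_eqI iffI)
    fix t assume "t \<in> ?A"
    then obtain y z l where "t = (depth y, depth z, l)"
      "y \<in> anc u" "z \<in> anc u" "l \<le> L" "(y, z) \<in> E ^^ l"
      unfolding walk_lengths_def by auto
    then show "t \<in> ?B" using *[of y] *[of z] unfolding walk_lengths_def by auto
  next
    fix t assume "t \<in> ?B"
    then obtain y z l where "t = (depth y, depth z, l)"
      "y \<in> anc v" "z \<in> anc v" "l \<le> L" "(y, z) \<in> E ^^ l"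
      "depth y \<le> depth u" "depth z \<le> depth u"
      unfolding walk_lengths_def by auto
    then show "t \<in> ?A" using *[of y] *[of z] unfolding walk_lengths_def by auto
  qed
qed

lemma walk_lengths_refl: "v \<in> W \<Longrightarrow> (depth v, depth v, 0) \<in> lens L v"
  unfolding walk_lengths_def using ancestors_self by fastforce

lemma walk_lengths_sym: "(i, j, l) \<in> lens L v \<Longrightarrow> (j, i, l) \<in> lens L v"
  unfolding walk_lengths_def using relpow_sym[OF symE] by blast

lemma walk_lengths_trans:
  assumes "(i, j, l) \<in> lens L v" "(j, k, m) \<in> lens L v" "l + m \<le> L"
  shows "(i, k, l + m) \<in> lens L v"
proof -
  obtain x y where 1: "i = depth x" "j = depth y" "x \<in> anc v"
    "y \<in> anc v" "(x, y) \<in> E ^^ l" using assms(1) unfolding walk_lengths_def by auto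
  obtain y' z where 2: "j = depth y'" "k = depth z" "y' \<in> anc v"
    "z \<in> anc v" "(y', z) \<in> E ^^ m" using assms(2) unfolding walk_lengths_def by auto
  have "y' = y" using card_ancestors_inj[OF 2(3) 1(4)] 1 2 by simp
  then have "(x, z) \<in> E ^^ (l + m)" using 1(5) 2(5) by (auto simp: relpow_add)
  then show ?thesis using 1 2 assms(3) unfolding walk_lengths_def by blast
qed

lemma walk_lengths_closed:
  assumes "(i, i, l) \<in> lens L v"
  shows "l \<le> L" "\<exists>y. (y, y) \<in> E ^^ l"
proof -
  obtain x y where 1: "i = depth x" "i = depth y" "x \<in> anc v"
    "y \<in> anc v" "(x, y) \<in> E ^^ l" "l \<le> L" using assms(1) unfolding walk_lengths_def by blast
  then have "x = y" using card_ancestors_inj by metis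
  with 1 show "l \<le> L" "\<exists>y. (y, y) \<in> E ^^ l" by auto
qed

lemma walk_lengths_bounded:
  assumes "v \<in> W"
  shows "lens L v \<subseteq> {..depth v} \<times> {..depth v} \<times> {..L}"
proof -
  have "depth y \<le> depth v" if "y \<in> anc v" for y
    using card_ancestors_le_iff[OF that ancestors_self[OF assms]] ancestors_in[OF that] by simp
  then show ?thesis unfolding walk_lengths_def by auto
qed

end

text \<open>A path inside the colours \<open>I\<close> has fewer than \<open>2 ^ card I\<close>
  vertices, so every ancestor is weakly reachable with \<open>2 ^ q\<close>. The ancestors thus have
  distinct colours, all from \<open>I\<close>, and there are at most \<open>q\<close> of
  them.\<close>

lemma card_ancestors_colored:
  assumes V: "finite V" "sym E" "inj_on \<rho> V" and inj: "\<And>v. v \<in> V \<Longrightarrow> inj_on c (weak_reach V E \<rho> (2 ^ q) v)"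
    and I: "finite I" "card I \<le> q" and v: "v \<in> V" "c v \<in> I"
  shows "card (ancestors {v\<in>V. c v \<in> I} E \<rho> v) \<le> q"
proof -
  let ?W = "{v\<in>V. c v \<in> I}"
  have sub: "ancestors ?W E \<rho> v \<subseteq> weak_reach V E \<rho> (2 ^ q) v"
  proof
    fix z assume "z \<in> ancestors ?W E \<rho> v"
    then obtain X where X: "X \<subseteq> ?W" "v \<in> X" "z \<in> X" "\<forall>x\<in>X. \<rho> z \<le> \<rho> x" "linked E X v z"
      unfolding ancestors_def by (rule weak_reachE)
    obtain xs where xs: "xs \<noteq> []" "hd xs = v" "last xs = z" "set xs \<subseteq> X" "distinct xs" "successively (\<lambda>x y. (x, y) \<in> E) xs"
      using linked_path[OF X(5,2)] by auto
    have "c ` set xs \<subseteq> I" using xs(4) X(1) by auto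
    then have "card (c ` set xs) \<le> card I" using I(1) by (intro card_mono)
    then have "length xs < 2 ^ card I"
      using xs X(1) by (intro colored_path_length[OF xs(5,6) _ _ I(2) V(2) inj]) auto
    also have "\<dots> \<le> 2 ^ q" using I(2) by simp
    finally have "card (set xs) \<le> 2 ^ q" using xs(5) by (simp add: distinct_card)
    moreover have "v \<in> set xs" "z \<in> set xs" using xs(1-3) by auto
    moreover have "linked E (set xs) v z"
      using xs calculation by (intro successively_linked[OF xs(6) V(2)]) auto
    moreover have "set xs \<subseteq> V" using xs(4) X(1) by auto
    ultimately show "z \<in> weak_reach V E \<rho> (2 ^ q) v"
      using xs(4) X(4) by (intro weak_reachI[of "set xs"]) auto
  qed
  have "ancestors ?W E \<rho> v \<subseteq> ?W" unfolding ancestors_def by (rule weak_reach_subset)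
  then have "c ` ancestors ?W E \<rho> v \<subseteq> I" by auto
  then have "card (c ` ancestors ?W E \<rho> v) \<le> card I" using I(1) by (intro card_mono)
  moreover have "card (c ` ancestors ?W E \<rho> v) = card (ancestors ?W E \<rho> v)"
    using inj_on_subset[OF inj[OF v(1)] sub] by (rule card_image)
  ultimately show ?thesis using I(2) by simp
qed

text \<open>Closed walks are used instead of cycles because homomorphisms preserve them and because
  walks compose. For graphs the condition says that the odd girth exceeds \<open>L\<close>.\<close>

definition short_odd_free :: "nat \<Rightarrow> ('a \<times> 'a) set \<Rightarrow> bool" where
  "short_odd_free L E \<longleftrightarrow> (\<forall>n\<le>L. odd n \<longrightarrow> (\<forall>x. (x, x) \<notin> E ^^ n))"

section \<open>The finite graph of labels\<close>

definition ordered_coloring :: "nat \<Rightarrow> nat \<Rightarrow> 'a pair_pre_digraph \<Rightarrow> ('a \<Rightarrow> nat) \<Rightarrow> ('a \<Rightarrow> nat) \<Rightarrow> bool" where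
  "ordered_coloring K q G \<rho> c \<longleftrightarrow> pair_graph G \<and> inj_on \<rho> (pverts G) \<and> c ` pverts G \<subseteq> {..<K} \<and>
     (\<forall>v\<in>pverts G. inj_on c (weak_reach (pverts G) (parcs G) \<rho> (2 ^ q) v))"

text \<open>Depths refer to the subgraph on the colours \<open>I\<close>, but the recorded lengths
  belong to walks in all of \<open>G\<close>, which may leave these colours.\<close>

definition color_label :: "nat \<Rightarrow> 'a pair_pre_digraph \<Rightarrow> ('a \<Rightarrow> nat) \<Rightarrow> ('a \<Rightarrow> nat) \<Rightarrow> nat set \<Rightarrow> 'a \<Rightarrow> nat \<times> (nat \<times> nat \<times> nat) set" where
  "color_label L G \<rho> c I v =
     (let W = {v\<in>pverts G. c v \<in> I} in (card (ancestors W (parcs G) \<rho> v), walk_lengths W (parcs G) \<rho> L v))"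

text \<open>The dummy value \<open>(0, {})\<close> makes the set of labels finite.\<close>

definition vertex_label :: "nat \<Rightarrow> nat \<Rightarrow> 'a pair_pre_digraph \<Rightarrow> ('a \<Rightarrow> nat) \<Rightarrow> ('a \<Rightarrow> nat) \<Rightarrow> 'a \<Rightarrow> nat \<times> (nat set \<Rightarrow> nat \<times> (nat \<times> nat \<times> nat) set)" where
  "vertex_label K L G \<rho> c v =
     (c v, \<lambda>I. if I \<subseteq> {..<K} \<and> card I \<le> L \<and> c v \<in> I then color_label L G \<rho> c I v else (0, {}))"

text \<open>Only \<open>I\<close> is fixed; the graph, its order and its colouring may change from
  arc to arc. This is harmless because the hypotheses of \<open>no_odd_closed_labelled_walk\<close>
  concern single arcs, and each arc comes from one graph.\<close>

lemma color_label_closed_walk: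
  assumes "odd n" "n \<le> L"
  shows "(x, x) \<notin> {(color_label L G \<rho> c I u, color_label L G \<rho> c I v) |(G :: 'a pair_pre_digraph) \<rho> c u v.
     pair_graph G \<and> inj_on \<rho> (pverts G) \<and> short_odd_free L (parcs G) \<and> (u, v) \<in> parcs G \<and> c u \<in> I \<and> c v \<in> I} ^^ n"
    (is "_ \<notin> ?T ^^ n")
proof (rule no_odd_closed_labelled_walk[where d = fst and M = snd and L = L, OF _ _ _ _ _ _ _ _ assms])
  have T: "\<exists>W E. \<exists>(\<rho> :: 'a \<Rightarrow> nat) u v. finite W \<and> sym E \<and> irrefl E \<and> inj_on \<rho> W \<and> u \<in> W \<and> v \<in> W \<and> (u, v) \<in> E \<and>
      short_odd_free L E \<and> x = (card (ancestors W E \<rho> u), walk_lengths W E \<rho> L u) \<and>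
      y = (card (ancestors W E \<rho> v), walk_lengths W E \<rho> L v)" if "(x, y) \<in> ?T" for x y
  proof -
    from that obtain G \<rho> c u v where G: "pair_graph (G :: 'a pair_pre_digraph)" "inj_on \<rho> (pverts G)" "short_odd_free L (parcs G)"
      "(u, v) \<in> parcs G" "c u \<in> I" "c v \<in> I"
      and xy: "x = color_label L G \<rho> c I u" "y = color_label L G \<rho> c I v" by auto
    note G' = pair_graphD[OF G(1)]
    let ?W = "{v\<in>pverts G. c v \<in> I}"
    have "finite ?W" "inj_on \<rho> ?W" "u \<in> ?W" "v \<in> ?W" using G G' by (auto simp: inj_on_def)
    then show ?thesis using G G' xy unfolding color_label_def Let_def
      by (intro exI[of _ ?W] exI[of _ "parcs G"] exI[of _ \<rho>] exI[of _ u] exI[of _ v] conjI) simp_all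
  qed
  show "sym ?T"
  proof (rule symI)
    fix x y assume "(x, y) \<in> ?T"
    then obtain G \<rho> c u v where G: "pair_graph (G :: 'a pair_pre_digraph)" "inj_on \<rho> (pverts G)" "short_odd_free L (parcs G)"
      "(u, v) \<in> parcs G" "c u \<in> I" "c v \<in> I"
      and xy: "x = color_label L G \<rho> c I u" "y = color_label L G \<rho> c I v" by auto
    have "(v, u) \<in> parcs G" using pair_graphD(3)[OF G(1)] G(4) by (rule symD)
    then show "(y, x) \<in> ?T" using G xy by blast
  qed
  fix x y assume "(x, y) \<in> ?T"
  then obtain W E u v and \<rho> :: "'a \<Rightarrow> nat" where G: "finite W" "sym E" "irrefl E" "inj_on \<rho> W" and uv: "(u, v) \<in> E" "u \<in> W" "v \<in> W"
    and odd: "short_odd_free L E" and xy: "x = (card (ancestors W E \<rho> u), walk_lengths W E \<rho> L u)"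
      "y = (card (ancestors W E \<rho> v), walk_lengths W E \<rho> L v)"
    using T[of x y] by auto
  have "1 \<le> L" using assms by (cases n) auto
  show "fst x \<noteq> fst y" unfolding xy using edge_depth(1)[OF G uv] by simp
  show "(fst x, fst y, 1) \<in> snd y" if "fst x < fst y"
    using that walk_lengths_edge[OF G uv _ \<open>1 \<le> L\<close>] unfolding xy by simp
  show "snd x = {(i, j, l) \<in> snd y. i \<le> fst x \<and> j \<le> fst x}" if "fst x < fst y"
    using that walk_lengths_trunc[OF G edge_depth(2)[OF G uv]] unfolding xy by simp
  show "(fst x, fst x, 0) \<in> snd x" unfolding xy using walk_lengths_refl[OF G uv(2)] by simp
  show "(j, i, l) \<in> snd x" if "(i, j, l) \<in> snd x" for i j l
    using that walk_lengths_sym[OF G] unfolding xy by simp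
  show "(i, k, l + m) \<in> snd x" if "(i, j, l) \<in> snd x" "(j, k, m) \<in> snd x" "l + m \<le> L" for i j k l m
    using that walk_lengths_trans[OF G] unfolding xy snd_conv by blast
  show "(i, i, l) \<notin> snd x" if "odd l" for i l
    using that walk_lengths_closed[OF G] odd unfolding xy snd_conv short_odd_free_def by blast
qed

text \<open>A closed walk of length \<open>n \<le> L\<close> meets a set \<open>I\<close> of at most
  \<open>L\<close> colours. Evaluating all its labels at this \<open>I\<close> turns it into a
  closed walk to which \<open>color_label_closed_walk\<close> applies. Colourings with parameter
  \<open>2 ^ L\<close> bound the depths for all such \<open>I\<close> at once, so finitely many
  labels suffice.\<close>

lemma bounded_expansion_odd_target:
  assumes "bounded_expansion \<C>" "graph_class \<C>"
  shows "\<exists>(\<Lambda> :: (nat \<times> (nat set \<Rightarrow> nat \<times> (nat \<times> nat \<times> nat) set)) set) T.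
    finite \<Lambda> \<and> T \<subseteq> \<Lambda> \<times> \<Lambda> \<and> sym T \<and> short_odd_free L T \<and>
    (\<forall>G\<in>\<C>. short_odd_free L (parcs G) \<longrightarrow> (\<exists>f. f ` pverts G \<subseteq> \<Lambda> \<and> (\<forall>(u, v)\<in>parcs G. (f u, f v) \<in> T)))"
proof -
  obtain K where K: "\<forall>G\<in>\<C>. \<exists>\<rho> c. inj_on \<rho> (pverts G) \<and> c ` pverts G \<subseteq> {..<K :: nat} \<and>
    (\<forall>v\<in>pverts G. inj_on c (weak_reach (pverts G) (parcs G) \<rho> (2 ^ L) v))"
    using bounded_expansion_coloring[OF assms, of "2 ^ L"] ..
  let ?J = "{I. I \<subseteq> {..<K} \<and> card I \<le> L}" and ?R = "{..L} \<times> Pow ({..L} \<times> {..L} \<times> {..L})"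
  define \<Lambda> where "\<Lambda> = {..<K} \<times> {f. \<forall>I. (I \<in> ?J \<longrightarrow> f I \<in> ?R) \<and> (I \<notin> ?J \<longrightarrow> f I = (0, {}))}"
  define T where "T = {(vertex_label K L G \<rho> c u, vertex_label K L G \<rho> c v) |G \<rho> c u v.
    G \<in> \<C> \<and> ordered_coloring K L G \<rho> c \<and> short_odd_free L (parcs G) \<and> (u, v) \<in> parcs G}"
  have T: "\<exists>G \<rho> c u v. G \<in> \<C> \<and> ordered_coloring K L G \<rho> c \<and> short_odd_free L (parcs G) \<and> (u, v) \<in> parcs G \<and>
      x = vertex_label K L G \<rho> c u \<and> y = vertex_label K L G \<rho> c v" if "(x, y) \<in> T" for x y
    using that unfolding T_def mem_Collect_eq prod.inject by blast
  have "finite \<Lambda>" unfolding \<Lambda>_def by (intro finite_cartesian_product finite_set_of_finite_funs) auto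
  moreover have label: "vertex_label K L G \<rho> c v \<in> \<Lambda>" if G: "ordered_coloring K L G \<rho> c" and v: "v \<in> pverts G" for G \<rho> c and v :: nat
  proof -
    note G' = pair_graphD[of G]
    have "color_label L G \<rho> c I v \<in> ?R" if I: "I \<in> ?J" "c v \<in> I" for I
    proof -
      let ?W = "{v\<in>pverts G. c v \<in> I}"
      have fI: "finite I" using I finite_subset by auto
      have card: "card (ancestors ?W (parcs G) \<rho> v) \<le> L"
        using G G' I v fI by (intro card_ancestors_colored) (auto simp: ordered_coloring_def)
      have "walk_lengths ?W (parcs G) \<rho> L v \<subseteq> {..card (ancestors ?W (parcs G) \<rho> v)} \<times> {..card (ancestors ?W (parcs G) \<rho> v)} \<times> {..L}"
        using G G' I v by (intro walk_lengths_bounded) (auto simp: ordered_coloring_def inj_on_def)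
      also have "\<dots> \<subseteq> {..L} \<times> {..L} \<times> {..L}" using card by auto
      finally show ?thesis using card by (simp add: color_label_def Let_def)
    qed
    then show ?thesis using G v unfolding \<Lambda>_def vertex_label_def ordered_coloring_def by auto
  qed
  moreover have "T \<subseteq> \<Lambda> \<times> \<Lambda>"
  proof
    fix t assume t: "t \<in> T"
    then have "(fst t, snd t) \<in> T" by simp
    from T[OF this] obtain G \<rho> c and u v :: nat where G: "ordered_coloring K L G \<rho> c" "(u, v) \<in> parcs G"
      "fst t = vertex_label K L G \<rho> c u" "snd t = vertex_label K L G \<rho> c v" by blast
    then have "u \<in> pverts G" "v \<in> pverts G" using pair_graphD(2)[of G] by (auto simp: ordered_coloring_def)
    then show "t \<in> \<Lambda> \<times> \<Lambda>" using label[OF G(1)] G(3,4) by (simp add: mem_Times_iff)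
  qed
  moreover have "sym T"
  proof (rule symI)
    fix x y assume "(x, y) \<in> T"
    then obtain G \<rho> c u v where "G \<in> \<C>" "ordered_coloring K L G \<rho> c" "short_odd_free L (parcs G)" "(u, v) \<in> parcs G"
      "x = vertex_label K L G \<rho> c u" "y = vertex_label K L G \<rho> c v" using T by blast
    moreover from this have "(v, u) \<in> parcs G" using symD[OF pair_graphD(3), of G u v] by (simp add: ordered_coloring_def)
    ultimately show "(y, x) \<in> T" unfolding T_def by blast
  qed
  moreover have "short_odd_free L T"
    unfolding short_odd_free_def
  proof (intro allI impI notI)
    fix n x assume n: "n \<le> L" "odd n" and xx: "(x, x) \<in> T ^^ n"
    have "0 < n" using n by (auto intro: Nat.gr0I)
    with xx obtain w where w: "\<And>i. (w i, w (Suc i)) \<in> T" "\<And>i. w (i + n) = w i"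
      by (rule relpow_closed_periodic) blast
    have wmod: "w i = w (i mod n)" for i
    proof (induction i rule: less_induct)
      case (less i)
      show ?case
      proof (cases "i < n")
        case False
        then have "w i = w (i - n)" using w(2)[of "i - n"] by simp
        also have "\<dots> = w ((i - n) mod n)" using less[of "i - n"] False \<open>0 < n\<close> by simp
        finally show ?thesis using False by (simp add: le_mod_geq)
      qed simp
    qed
    define I where "I = (\<lambda>i. fst (w i)) ` {..<n}"
    have inI: "fst (w i) \<in> I" for i using wmod[of i] \<open>0 < n\<close> unfolding I_def by (auto intro!: image_eqI[of _ _ "i mod n"])
    have "card I \<le> n" unfolding I_def using card_image_le[of "{..<n}"] by fastforce
    moreover have "fst (w i) < K" for i
      using w(1)[of i] \<open>T \<subseteq> \<Lambda> \<times> \<Lambda>\<close> unfolding \<Lambda>_def by auto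
    ultimately have IJ: "I \<subseteq> {..<K}" "card I \<le> L" using n unfolding I_def by auto
    let ?T = "{(color_label L G \<rho> c I u, color_label L G \<rho> c I v) |(G :: nat pair_pre_digraph) \<rho> c u v.
     pair_graph G \<and> inj_on \<rho> (pverts G) \<and> short_odd_free L (parcs G) \<and> (u, v) \<in> parcs G \<and> c u \<in> I \<and> c v \<in> I}"
    have step: "(snd (w i) I, snd (w (Suc i)) I) \<in> ?T" for i
    proof -
      obtain G \<rho> c and u v :: nat where G: "ordered_coloring K L G \<rho> c" "short_odd_free L (parcs G)" "(u, v) \<in> parcs G"
        "w i = vertex_label K L G \<rho> c u" "w (Suc i) = vertex_label K L G \<rho> c v"
        using T[OF w(1)[of i]] by blast
      have "c u \<in> I" "c v \<in> I" using inI[of i] inI[of "Suc i"] G(4,5) by (simp_all add: vertex_label_def)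
      then have "snd (w i) I = color_label L G \<rho> c I u" "snd (w (Suc i)) I = color_label L G \<rho> c I v"
        using G(4,5) IJ by (simp_all add: vertex_label_def)
      moreover have "pair_graph G" "inj_on \<rho> (pverts G)" using G(1) by (simp_all add: ordered_coloring_def)
      ultimately show ?thesis using G(2,3) \<open>c u \<in> I\<close> \<open>c v \<in> I\<close> unfolding mem_Collect_eq prod.inject by blast
    qed
    have "(snd (w 0) I, snd (w 0) I) \<in> ?T ^^ n"
      unfolding relpow_fun_conv using step w(2)[of 0]
      by (intro exI[of _ "\<lambda>i. snd (w i) I"] conjI allI impI) simp_all
    then show False using color_label_closed_walk[OF n(2,1)] by blast
  qed
  moreover have "\<exists>f. f ` pverts G \<subseteq> \<Lambda> \<and> (\<forall>(u, v)\<in>parcs G. (f u, f v) \<in> T)"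
    if G: "G \<in> \<C>" "short_odd_free L (parcs G)" for G
  proof -
    have "pair_graph G" using G assms(2) by (simp add: graph_class_def)
    then obtain \<rho> c where c: "ordered_coloring K L G \<rho> c"
      using K G(1) unfolding ordered_coloring_def by blast
    show ?thesis
    proof (intro exI[of _ "vertex_label K L G \<rho> c"] conjI)
      show "vertex_label K L G \<rho> c ` pverts G \<subseteq> \<Lambda>" using label[OF c] by auto
      show "\<forall>(u, v)\<in>parcs G. (vertex_label K L G \<rho> c u, vertex_label K L G \<rho> c v) \<in> T"
        using G c unfolding T_def by blast
    qed
  qed
  ultimately show ?thesis by (intro exI[of _ \<Lambda>] exI[of _ T]) simp
qed

section \<open>Definability in classes of bounded expansion\<close>

lemma relpow_map:
  assumes "(x, y) \<in> R ^^ n" "\<And>a b. (a, b) \<in> R \<Longrightarrow> (f a, f b) \<in> S"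
  shows "(f x, f y) \<in> S ^^ n"
  using assms(1)
proof (induction n arbitrary: y)
  case (Suc n)
  then obtain z where "(x, z) \<in> R ^^ n" "(z, y) \<in> R" by auto
  then show ?case using Suc.IH assms(2) by auto
qed simp

lemma short_odd_free_map:
  "short_odd_free L S \<Longrightarrow> (\<And>a b. (a, b) \<in> R \<Longrightarrow> (f a, f b) \<in> S) \<Longrightarrow> short_odd_free L R"
  unfolding short_odd_free_def using relpow_map by metis

text \<open>A walk cannot leave the field of the relation of its first arc. Positive length is
  essential, as the empty walk belongs to no field.\<close>

lemma relpow_Un_disjoint:
  assumes "(x, y) \<in> (R \<union> S) ^^ Suc n" "Field R \<inter> Field S = {}"
  shows "(x, y) \<in> R ^^ Suc n \<or> (x, y) \<in> S ^^ Suc n"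
  using assms(1)
proof (induction n arbitrary: y)
  case (Suc n)
  then obtain z where z: "(x, z) \<in> (R \<union> S) ^^ Suc n" "(z, y) \<in> R \<union> S" by (metis relpow_Suc_E)
  have F: "z \<in> Field T" if "(x, z) \<in> T ^^ Suc n" for T :: "('a \<times> 'a) set"
    using that by (auto simp: Field_def)
  from Suc.IH[OF z(1)] show ?case
  proof
    assume xz: "(x, z) \<in> R ^^ Suc n"
    then have "(z, y) \<in> R" using F[OF xz] z(2) assms(2) by (auto simp: Field_def)
    with xz show ?thesis by (metis relpow_Suc_I)
  next
    assume xz: "(x, z) \<in> S ^^ Suc n"
    then have "(z, y) \<in> S" using F[OF xz] z(2) assms(2) by (auto simp: Field_def)
    with xz show ?thesis by (metis relpow_Suc_I)
  qed
qed simp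

lemma short_odd_free_Un:
  assumes "short_odd_free L R" "short_odd_free L S" "Field R \<inter> Field S = {}"
  shows "short_odd_free L (R \<union> S)"
  unfolding short_odd_free_def
proof (intro allI impI notI)
  fix n x assume n: "n \<le> L" "odd n" "(x, x) \<in> (R \<union> S) ^^ n"
  then obtain m where "n = Suc m" by (cases n) auto
  then have "(x, x) \<in> R ^^ n \<or> (x, x) \<in> S ^^ n" using relpow_Un_disjoint[OF _ assms(3)] n(3) by blast
  then show False using assms(1,2) n(1,2) unfolding short_odd_free_def by blast
qed

lemma pcas_relpow: "pcas u p v \<Longrightarrow> set p \<subseteq> E \<Longrightarrow> (u, v) \<in> E ^^ length p"
proof (induction p arbitrary: u)
  case (Cons e p)
  then have "(u, snd e) \<in> E" "(snd e, v) \<in> E ^^ length p" by auto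
  then show ?case by (metis length_Cons relpow_Suc_I2)
qed simp

lemma short_odd_free_odd_girth:
  assumes "short_odd_free (2 * p + 1) (parcs G)"
  shows "odd_girth G > enat (2 * p + 1)"
proof -
  have "enat (2 * p + 2) \<le> enat (length c)" if c: "undirected_cycle G c" "odd (length c)" for c
  proof -
    obtain u where "pre_digraph.awalk (with_proj G) u c u"
      using c(1) unfolding undirected_cycle_def pre_digraph.cycle_def by blast
    then have "(u, u) \<in> parcs G ^^ length c"
      unfolding pre_digraph.awalk_def cas_with_proj_eq by (intro pcas_relpow) auto
    then have "\<not> length c \<le> 2 * p + 1" using assms c(2) unfolding short_odd_free_def by blast
    then show ?thesis by simp
  qed
  then have "enat (2 * p + 2) \<le> odd_girth G" unfolding odd_girth_def by (intro INF_greatest) auto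
  then show ?thesis by (metis Suc_eq_plus1 add_Suc_right enat_ord_simps(2) lessI numeral_2_eq_2 one_add_one order_less_le_trans add.assoc)
qed

text \<open>A closed odd walk that repeats a vertex splits into two closed walks, one of them odd.\<close>

lemma odd_closed_walk_cycle:
  assumes G: "pair_graph G" and "(x, x) \<in> parcs G ^^ n" "odd n"
  shows "\<exists>p. undirected_cycle G p \<and> odd (length p) \<and> length p \<le> n"
  using assms(2,3)
proof (induction n arbitrary: x rule: less_induct)
  case (less n)
  note G' = pair_graphD[OF G]
  obtain f where f: "f 0 = x" "f n = x" "\<And>i. i < n \<Longrightarrow> (f i, f (Suc i)) \<in> parcs G"
    using less.prems(1) by (auto simp: relpow_fun_conv)
  have seg: "(f i, f (i + k)) \<in> parcs G ^^ k" if "i + k \<le> n" for i k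
    using that f(3) by (auto simp: relpow_fun_conv intro!: exI[of _ "\<lambda>j. f (i + j)"])
  show ?case
  proof (cases "inj_on f {..<n}")
    case False
    then obtain i j where ij: "i < j" "j < n" "f i = f j"
      unfolding inj_on_def by (metis lessThan_iff linorder_neqE_nat)
    have 1: "(f i, f i) \<in> parcs G ^^ (j - i)" using seg[of i "j - i"] ij by simp
    have "(f j, f n) \<in> parcs G ^^ (n - j)" using seg[of j "n - j"] ij by simp
    moreover have "(f 0, f i) \<in> parcs G ^^ i" using seg[of 0 i] ij by simp
    ultimately have 2: "(f j, f j) \<in> parcs G ^^ (n - j + i)" using f ij(3) by (auto simp: relpow_add)
    show ?thesis
    proof (cases "odd (j - i)")
      case True
      then show ?thesis using less.IH[OF _ 1] ij by fastforce
    next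
      case False
      then have "odd (n - j + i)" using less.prems(2) ij by auto
      then show ?thesis using less.IH[OF _ 2] ij by fastforce
    qed
  next
    case True
    have "n \<noteq> 1" using f G'(4) by (auto simp: irrefl_def)
    then have n: "3 \<le> n" using less.prems(2) by (cases n; cases "n - 1"; cases "n - 2") auto
    define p where "p = map (\<lambda>i. (f i, f (Suc i))) [0..<n]"
    have vs: "pawalk_verts (f i) (map (\<lambda>i. (f i, f (Suc i))) [i..<n]) = map f [i..<Suc n]" if "i \<le> n" for i
      using that by (induction rule: inc_induct) (simp_all add: upt_conv_Cons del: upt_Suc)
    have cas: "pcas (f i) (map (\<lambda>i. (f i, f (Suc i))) [i..<n]) (f n)" if "i \<le> n" for i
      using that by (induction rule: inc_induct) (simp_all add: upt_conv_Cons del: upt_Suc)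
    have "tl (map f [0..<Suc n]) = map f [Suc 0..<Suc n]" by (simp add: upt_conv_Cons del: upt_Suc)
    also have "\<dots> = map f [Suc 0..<n] @ [f n]" using n by simp
    finally have tl: "tl (pawalk_verts x p) = map f [Suc 0..<n] @ [f 0]" using vs[of 0] f by (simp add: p_def)
    have "distinct (map f [Suc 0..<n])" using True by (auto simp: distinct_map inj_on_def)
    moreover have "f 0 \<notin> f ` {Suc 0..<n}"
    proof
      assume "f 0 \<in> f ` {Suc 0..<n}"
      then obtain i where "i \<in> {Suc 0..<n}" "f 0 = f i" by auto
      then show False using inj_onD[OF True, of 0 i] by auto
    qed
    ultimately have "distinct (tl (pawalk_verts x p))" unfolding tl by simp
    moreover have "pre_digraph.awalk (with_proj G) x p x"
      unfolding pre_digraph.awalk_def cas_with_proj_eq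
      using cas[of 0] f G'(2) n f(3)[of 0] by (auto simp: p_def)
    ultimately have "undirected_cycle G p"
      unfolding undirected_cycle_def pre_digraph.cycle_def awalk_verts_with_proj_eq
      using n by (intro conjI exI[of _ x]) (auto simp: p_def)
    then show ?thesis using less.prems(2) by (intro exI[of _ p]) (simp add: p_def)
  qed
qed

lemma odd_girth_short_odd_free:
  assumes "pair_graph G" "odd_girth G > enat L"
  shows "short_odd_free L (parcs G)"
  unfolding short_odd_free_def
proof (intro allI impI notI)
  fix n x assume n: "n \<le> L" "odd n" "(x, x) \<in> parcs G ^^ n"
  obtain p where p: "undirected_cycle G p" "odd (length p)" "length p \<le> n"
    using odd_closed_walk_cycle[OF assms(1) n(3,2)] by auto
  have "odd_girth G \<le> enat (length p)" unfolding odd_girth_def using p by (intro INF_lower) simp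
  also have "\<dots> \<le> enat L" using p(3) n(1) by simp
  finally show False using assms(2) by simp
qed

lemma girth_short_odd_free:
  assumes "pair_graph G" "girth G \<ge> enat (Suc L)"
  shows "short_odd_free L (parcs G)"
proof (rule odd_girth_short_odd_free[OF assms(1)])
  have "girth G \<le> odd_girth G" unfolding girth_def odd_girth_def by (intro INF_superset_mono) auto
  then show "enat L < odd_girth G" using assms(2) by (metis enat_ord_simps(2) lessI order_less_le_trans order_trans)
qed

text \<open>Variable \<open>0\<close> is the start and variable \<open>Suc n\<close> the end of a
  walk of length \<open>n\<close>. Lengthening the walk thus binds the old end and uses the next
  variable for the new one.\<close>

primrec walk_formula :: "nat \<Rightarrow> fo_formula" where
  "walk_formula 0 = FO_Eq 0 1"
| "walk_formula (Suc n) = FO_Ex (Suc n) (FO_And (walk_formula n) (FO_Adj (Suc n) (Suc (Suc n))))"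

lemma free_vars_walk_formula: "free_vars (walk_formula n) \<subseteq> {0, Suc n}"
  by (induction n) auto

lemma fo_sat_walk_formula:
  assumes "parcs G \<subseteq> pverts G \<times> pverts G"
  shows "fo_sat G s (walk_formula n) \<longleftrightarrow> (s 0, s (Suc n)) \<in> parcs G ^^ n"
proof (induction n arbitrary: s)
  case (Suc n)
  have "fo_sat G s (walk_formula (Suc n)) \<longleftrightarrow>
    (\<exists>v\<in>pverts G. (s 0, v) \<in> parcs G ^^ n \<and> (v, s (Suc (Suc n))) \<in> parcs G)"
    by (simp add: Suc.IH)
  also have "\<dots> \<longleftrightarrow> (s 0, s (Suc (Suc n))) \<in> parcs G ^^ Suc n"
    using assms by (auto intro: relpow_Suc_I elim!: relpow_Suc_E)
  finally show ?case .
qed simp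

definition closed_walk_formula :: "nat \<Rightarrow> fo_formula" where
  "closed_walk_formula n = FO_Ex 0 (FO_Ex (Suc n) (FO_And (walk_formula n) (FO_Eq 0 (Suc n))))"

lemma free_vars_closed_walk_formula: "free_vars (closed_walk_formula n) = {}"
proof -
  have "free_vars (closed_walk_formula n) = (free_vars (walk_formula n) - {Suc n} - {0}) \<union> ({0, Suc n} - {Suc n} - {0})"
    unfolding closed_walk_formula_def free_vars.simps by (simp only: Un_Diff)
  then show ?thesis using free_vars_walk_formula[of n] by blast
qed

lemma fo_sat_closed_walk_formula:
  assumes "parcs G \<subseteq> pverts G \<times> pverts G" "0 < n"
  shows "fo_sat G s (closed_walk_formula n) \<longleftrightarrow> (\<exists>x. (x, x) \<in> parcs G ^^ n)"
proof -
  have "x \<in> pverts G" if "(x, x) \<in> parcs G ^^ n" for x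
    using that assms by (cases n) auto
  then show ?thesis by (auto simp: closed_walk_formula_def fo_sat_walk_formula[OF assms(1)])
qed

primrec odd_free_formula :: "nat \<Rightarrow> fo_formula" where
  "odd_free_formula 0 = FO_Neg (closed_walk_formula 1)"
| "odd_free_formula (Suc p) = FO_And (odd_free_formula p) (FO_Neg (closed_walk_formula (2 * p + 3)))"

lemma sentence_odd_free_formula: "sentence (odd_free_formula p)"
  unfolding sentence_def by (induction p) (simp_all add: free_vars_closed_walk_formula)

lemma fo_sat_odd_free_formula:
  assumes "parcs G \<subseteq> pverts G \<times> pverts G"
  shows "fo_sat G s (odd_free_formula p) \<longleftrightarrow> short_odd_free (2 * p + 1) (parcs G)"
proof (induction p)
  case 0
  have "n \<le> 1 \<and> odd n \<longleftrightarrow> n = 1" for n :: nat by (cases n) auto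
  then have "short_odd_free 1 (parcs G) \<longleftrightarrow> (\<nexists>x. (x, x) \<in> parcs G ^^ 1)" unfolding short_odd_free_def by metis
  then show ?case using fo_sat_closed_walk_formula[OF assms, of 1] by simp
next
  case (Suc p)
  have "n \<le> 2 * Suc p + 1 \<and> odd n \<longleftrightarrow> n \<le> 2 * p + 1 \<and> odd n \<or> n = 2 * p + 3" for n :: nat by presburger
  then have "short_odd_free (2 * Suc p + 1) (parcs G) \<longleftrightarrow> short_odd_free (2 * p + 1) (parcs G) \<and> (\<nexists>x. (x, x) \<in> parcs G ^^ (2 * p + 3))"
    unfolding short_odd_free_def by metis
  moreover have "fo_sat G s (closed_walk_formula (2 * p + 3)) \<longleftrightarrow> (\<exists>x. (x, x) \<in> parcs G ^^ (2 * p + 3))"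
    by (rule fo_sat_closed_walk_formula[OF assms]) simp
  ultimately show ?case using Suc by (simp only: odd_free_formula.simps fo_sat.simps(3,4))
qed

definition cycle_arcs :: "nat \<Rightarrow> (nat \<times> nat) set" where
  "cycle_arcs n = {(i, j). i < n \<and> j < n \<and> (j = Suc i mod n \<or> i = Suc j mod n)}"

text \<open>A walk of length \<open>m\<close> moves by some \<open>s\<close> modulo
  \<open>Suc L\<close>, where \<open>s\<close> has absolute value at most \<open>m\<close> and the
  parity of \<open>m\<close>. For a closed walk with \<open>m \<le> L\<close> the shift must be
  \<open>0\<close>, so \<open>m\<close> is even.\<close>

lemma short_odd_free_cycle_arcs: "short_odd_free L (cycle_arcs (Suc L))"
  unfolding short_odd_free_def
proof (intro allI impI notI)
  have "\<exists>s :: int. \<bar>s\<bar> \<le> int m \<and> even (s - int m) \<and> int (Suc L) dvd int y - int x - s" if "(x, y) \<in> cycle_arcs (Suc L) ^^ m" for m x y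
    using that
  proof (induction m arbitrary: y)
    case 0
    then show ?case by (intro exI[of _ 0]) auto
  next
    case (Suc m)
    then obtain z where z: "(x, z) \<in> cycle_arcs (Suc L) ^^ m" "(z, y) \<in> cycle_arcs (Suc L)" by auto
    then obtain s where s: "\<bar>s\<bar> \<le> int m" "even (s - int m)" "int (Suc L) dvd int z - int x - s" using Suc.IH by blast
    have md: "int (Suc L) dvd int (Suc a mod Suc L) - (int a + 1)" for a
    proof -
      have "int (Suc a mod Suc L) mod int (Suc L) = (int a + 1) mod int (Suc L)"
        by (simp add: zmod_int add.commute)
      then show ?thesis by (simp add: mod_eq_dvd_iff)
    qed
    have "int (Suc L) dvd int y - int z - 1 \<or> int (Suc L) dvd int y - int z + 1"
    proof -
      consider "y = Suc z mod Suc L" | "z = Suc y mod Suc L" using z(2) unfolding cycle_arcs_def by auto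
      then show ?thesis
      proof cases
        case 1
        then show ?thesis using md[of z] by (simp add: algebra_simps)
      next
        case 2
        have "int y - int z + 1 = - (int z - (int y + 1))" by simp
        then show ?thesis using md[of y] 2 by (metis dvd_minus_iff)
      qed
    qed
    then show ?case
    proof
      assume "int (Suc L) dvd int y - int z - 1"
      from dvd_add[OF s(3) this] show ?thesis
        using s(1,2) by (intro exI[of _ "s + 1"]) (auto simp: algebra_simps)
    next
      assume "int (Suc L) dvd int y - int z + 1"
      from dvd_add[OF s(3) this] show ?thesis
        using s(1,2) by (intro exI[of _ "s - 1"]) (auto simp: algebra_simps)
    qed
  qed
  note key = this
  fix n x assume n: "n \<le> L" "odd n" "(x, x) \<in> cycle_arcs (Suc L) ^^ n"
  obtain s :: int where s: "\<bar>s\<bar> \<le> int n" "even (s - int n)" "int (Suc L) dvd int x - int x - s" using key[OF n(3)] by blast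
  have "s = 0"
  proof (rule ccontr)
    assume "s \<noteq> 0"
    moreover have "int (Suc L) dvd s" using s(3) by simp
    ultimately have "int (Suc L) \<le> \<bar>s\<bar>" using dvd_imp_le_int by force
    then show False using s(1) n(1) by simp
  qed
  then show False using s(2) n(2) by simp
qed

lemma bounded_expansion_fo_definable:
  assumes "bounded_expansion \<C>" "graph_class \<C>"
  shows "fo_definable_large_odd_girth \<C>"
  unfolding fo_definable_large_odd_girth_def
proof
  fix p :: nat
  let ?L = "2 * p + 1"
  obtain \<Lambda> :: "(nat \<times> (nat set \<Rightarrow> nat \<times> (nat \<times> nat \<times> nat) set)) set" and T where
    T: "finite \<Lambda>" "T \<subseteq> \<Lambda> \<times> \<Lambda>" "sym T" "short_odd_free ?L T"
    and hom: "\<And>G. G \<in> \<C> \<Longrightarrow> short_odd_free ?L (parcs G) \<Longrightarrow> \<exists>f. f ` pverts G \<subseteq> \<Lambda> \<and> (\<forall>(u, v)\<in>parcs G. (f u, f v) \<in> T)"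
    using bounded_expansion_odd_target[OF assms, of ?L] by blast
  obtain h :: "nat \<times> (nat set \<Rightarrow> nat \<times> (nat \<times> nat \<times> nat) set) \<Rightarrow> nat" where h: "inj_on h \<Lambda>"
    using finite_imp_inj_to_nat_seg[OF T(1)] by auto
  \<comment> \<open>\<open>n = 2 * p + 3\<close> is the least odd length of a cycle without odd
    closed walks up to \<open>?L\<close>. The cycle makes \<open>H\<close> non-bipartite whatever
    the labels are.\<close>
  define n where "n = Suc (Suc ?L)"
  \<comment> \<open>Labels are placed on even numbers and the cycle on odd ones, so that the two
    parts of \<open>H\<close> are disjoint.\<close>
  define T1 where "T1 = map_prod (\<lambda>x. 2 * h x) (\<lambda>x. 2 * h x) ` T"
  define T2 where "T2 = map_prod (\<lambda>i. 2 * i + 1) (\<lambda>i. 2 * i + 1) ` cycle_arcs n"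
  define H where "H = \<lparr>pverts = (\<lambda>x. 2 * h x) ` \<Lambda> \<union> (\<lambda>i. 2 * i + 1) ` {..<n}, parcs = T1 \<union> T2\<rparr>"
  have F1: "Field T1 \<subseteq> {x. even x}" unfolding T1_def Field_def by auto
  have F2: "Field T2 \<subseteq> {x. odd x}" unfolding T2_def Field_def by auto
  have "short_odd_free ?L T1"
    by (rule short_odd_free_map[OF T(4), of _ "\<lambda>y. inv_into \<Lambda> h (y div 2)"]) (use T(2) h in \<open>auto simp: T1_def\<close>)
  moreover have "short_odd_free ?L T2"
  proof (rule short_odd_free_map[of _ "cycle_arcs n" _ "\<lambda>y. y div 2"])
    have "short_odd_free (Suc ?L) (cycle_arcs n)" unfolding n_def by (rule short_odd_free_cycle_arcs)
    then show "short_odd_free ?L (cycle_arcs n)" by (simp add: short_odd_free_def)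
  qed (auto simp: T2_def)
  ultimately have free: "short_odd_free ?L (parcs H)"
    unfolding H_def using F1 F2 by (simp, intro short_odd_free_Un) auto
  have irr: "irrefl (parcs H)"
    using free[unfolded short_odd_free_def, rule_format, of 1] unfolding irrefl_def by simp
  have "pair_graph H"
    unfolding H_def
  proof (rule pair_graphI)
    show "finite ((\<lambda>x. 2 * h x) ` \<Lambda> \<union> (\<lambda>i. 2 * i + 1) ` {..<n})" using T(1) by simp
    show "T1 \<union> T2 \<subseteq> ((\<lambda>x. 2 * h x) ` \<Lambda> \<union> (\<lambda>i. 2 * i + 1) ` {..<n}) \<times> ((\<lambda>x. 2 * h x) ` \<Lambda> \<union> (\<lambda>i. 2 * i + 1) ` {..<n})"
      using T(2) unfolding T1_def T2_def cycle_arcs_def by auto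
    have "sym T1" using T(3) unfolding T1_def sym_def by force
    moreover have "sym T2" unfolding T2_def cycle_arcs_def sym_def by force
    ultimately show "sym (T1 \<union> T2)" by (rule sym_Un)
    show "irrefl (T1 \<union> T2)" using irr by (simp add: H_def)
  qed
  moreover have "\<not> bipartite H"
  proof
    assume "bipartite H"
    then obtain A B where AB: "A \<inter> B = {}" "parcs H \<subseteq> A \<times> B \<union> B \<times> A" unfolding bipartite_def by blast
    have arc: "(2 * i + 1, 2 * (Suc i mod n) + 1) \<in> parcs H" if "i < n" for i
      using that by (auto simp: H_def T2_def cycle_arcs_def intro!: image_eqI[of _ _ "(i, Suc i mod n)"])
    have "2 * i + 1 \<in> A \<longleftrightarrow> (1 \<in> A \<longleftrightarrow> even i)" if "i < n" for i
      using that
    proof (induction i)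
      case (Suc i)
      then have "(2 * i + 1, 2 * Suc i + 1) \<in> parcs H" using arc[of i] by simp
      then show ?case using Suc AB by auto
    qed simp
    from this[of "n - 1"] have "2 * (n - 1) + 1 \<in> A \<longleftrightarrow> 1 \<in> A" by (simp add: n_def)
    moreover have "(2 * (n - 1) + 1, 1) \<in> parcs H" using arc[of "n - 1"] by (simp add: n_def)
    ultimately show False using AB by auto
  qed
  moreover have "odd_girth H > enat (2 * p + 1)" using short_odd_free_odd_girth[OF free] .
  moreover have "coloring_fo_definable H \<C>"
    unfolding coloring_fo_definable_def
  proof (intro exI[of _ "odd_free_formula p"] conjI ballI sentence_odd_free_formula)
    fix G assume G: "G \<in> \<C>"
    then have "pair_graph G" using assms(2) by (simp add: graph_class_def)
    note G' = pair_graphD[OF this]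
    have "fo_models G (odd_free_formula p) \<longleftrightarrow> short_odd_free ?L (parcs G)"
      unfolding fo_models_def fo_sat_odd_free_formula[OF G'(2)] by simp
    also have "\<dots> \<longleftrightarrow> graph_hom G H"
    proof
      assume "short_odd_free ?L (parcs G)"
      then obtain f where f: "f ` pverts G \<subseteq> \<Lambda>" "\<forall>(u, v)\<in>parcs G. (f u, f v) \<in> T" using hom[OF G] by blast
      show "graph_hom G H"
        unfolding graph_hom_def
      proof (intro exI[of _ "\<lambda>v. 2 * h (f v)"] conjI)
        show "(\<lambda>v. 2 * h (f v)) ` pverts G \<subseteq> pverts H" using f(1) by (auto simp: H_def)
        show "\<forall>(u, v)\<in>parcs G. (2 * h (f u), 2 * h (f v)) \<in> parcs H"
          using f(2) by (auto simp: H_def T1_def)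
      qed
    next
      assume "graph_hom G H"
      then obtain f where "\<forall>(u, v)\<in>parcs G. (f u, f v) \<in> parcs H" unfolding graph_hom_def by auto
      then show "short_odd_free ?L (parcs G)" by (intro short_odd_free_map[OF free, of _ f]) auto
    qed
    finally show "fo_models G (odd_free_formula p) \<longleftrightarrow> graph_hom G H" .
  qed
  ultimately show "\<exists>H :: nat pair_pre_digraph. pair_graph H \<and> \<not> bipartite H \<and> enat (2 * p + 1) < odd_girth H \<and> coloring_fo_definable H \<C>"
    by blast
qed

section \<open>Ehrenfeucht-Fraisse games\<close>

primrec quantifier_rank :: "fo_formula \<Rightarrow> nat" where
  "quantifier_rank (FO_Eq i j) = 0"
| "quantifier_rank (FO_Adj i j) = 0"
| "quantifier_rank (FO_Neg \<phi>) = quantifier_rank \<phi>"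
| "quantifier_rank (FO_And \<phi> \<psi>) = max (quantifier_rank \<phi>) (quantifier_rank \<psi>)"
| "quantifier_rank (FO_Ex i \<phi>) = Suc (quantifier_rank \<phi>)"

text \<open>\<open>I k J s t\<close> describes the positions from which the second player survives
  \<open>k\<close> more rounds. The set \<open>J\<close> of variables already played is part of the
  position because assignments are total and their values outside \<open>J\<close> are
  arbitrary.\<close>

lemma ehrenfeucht_fraisse:
  assumes atom: "\<And>k J s t i j. I k J s t \<Longrightarrow> i \<in> J \<Longrightarrow> j \<in> J \<Longrightarrow>
      (s i = s j \<longleftrightarrow> t i = t j) \<and> ((s i, s j) \<in> parcs A \<longleftrightarrow> (t i, t j) \<in> parcs B)"
    and zig: "\<And>k J s t i v. I (Suc k) J s t \<Longrightarrow> v \<in> pverts A \<Longrightarrow> \<exists>w\<in>pverts B. I k (insert i J) (s(i := v)) (t(i := w))"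
    and zag: "\<And>k J s t i w. I (Suc k) J s t \<Longrightarrow> w \<in> pverts B \<Longrightarrow> \<exists>v\<in>pverts A. I k (insert i J) (s(i := v)) (t(i := w))"
    and "I k J s t" "quantifier_rank \<phi> \<le> k" "free_vars \<phi> \<subseteq> J"
  shows "fo_sat A s \<phi> \<longleftrightarrow> fo_sat B t \<phi>"
  using assms(4-6)
proof (induction \<phi> arbitrary: k J s t)
  case (FO_Ex i \<phi>)
  then obtain k' where k: "k = Suc k'" "quantifier_rank \<phi> \<le> k'" by (cases k) auto
  have J: "free_vars \<phi> \<subseteq> insert i J" using FO_Ex.prems(3) by auto
  have I: "I (Suc k') J s t" using FO_Ex.prems(1) k by simp
  show ?case
  proof
    assume "fo_sat A s (FO_Ex i \<phi>)"
    then obtain v where v: "v \<in> pverts A" "fo_sat A (s(i := v)) \<phi>" by auto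
    then show "fo_sat B t (FO_Ex i \<phi>)" using zig[OF I v(1), of i] FO_Ex.IH[OF _ k(2) J] by auto
  next
    assume "fo_sat B t (FO_Ex i \<phi>)"
    then obtain w where w: "w \<in> pverts B" "fo_sat B (t(i := w)) \<phi>" by auto
    then show "fo_sat A s (FO_Ex i \<phi>)" using zag[OF I w(1), of i] FO_Ex.IH[OF _ k(2) J] by auto
  qed
next
  case (FO_And \<phi> \<psi>)
  then show ?case using FO_And.IH(1)[of k J s t] FO_And.IH(2)[of k J s t] by simp
qed (use atom in auto)

definition image_graph :: "('a \<Rightarrow> 'b) \<Rightarrow> 'a pair_pre_digraph \<Rightarrow> 'b pair_pre_digraph" where
  "image_graph f G = \<lparr>pverts = f ` pverts G, parcs = map_prod f f ` parcs G\<rparr>"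

lemma image_graph_simps [simp]:
  "pverts (image_graph f G) = f ` pverts G" "parcs (image_graph f G) = map_prod f f ` parcs G"
  by (simp_all add: image_graph_def)

lemma map_prod_in_image_iff:
  assumes "inj_on f V" "A \<subseteq> V \<times> V" "x \<in> V" "y \<in> V"
  shows "(f x, f y) \<in> map_prod f f ` A \<longleftrightarrow> (x, y) \<in> A"
  using assms by (auto dest: inj_onD)

lemma fo_models_image_graph:
  assumes "inj_on f (pverts G)" "parcs G \<subseteq> pverts G \<times> pverts G" "sentence \<phi>"
  shows "fo_models (image_graph f G) \<phi> \<longleftrightarrow> fo_models G \<phi>"
proof -
  have "fo_sat G s \<phi> \<longleftrightarrow> fo_sat (image_graph f G) t \<phi>" for s t
  proof (rule ehrenfeucht_fraisse[where k = "quantifier_rank \<phi>" and J = "{}" and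
        I = "\<lambda>k J s t. \<forall>i\<in>J. s i \<in> pverts G \<and> t i = f (s i)"])
    fix J :: "nat set" and s t i j assume "\<forall>i\<in>J. s i \<in> pverts G \<and> t i = f (s i)" "i \<in> J" "j \<in> J"
    then show "(s i = s j \<longleftrightarrow> t i = t j) \<and> ((s i, s j) \<in> parcs G \<longleftrightarrow> (t i, t j) \<in> parcs (image_graph f G))"
      using map_prod_in_image_iff[OF assms(1,2), of "s i" "s j"] inj_onD[OF assms(1), of "s i" "s j"] by auto
  qed (use assms(3) in \<open>auto simp: sentence_def\<close>)
  then show ?thesis by (auto simp: fo_models_def)
qed

lemma graph_hom_image_graph:
  assumes "inj_on f (pverts G)" "parcs G \<subseteq> pverts G \<times> pverts G"
  shows "graph_hom (image_graph f G) H \<longleftrightarrow> graph_hom G H"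
proof
  assume "graph_hom (image_graph f G) H"
  then obtain h where "h ` f ` pverts G \<subseteq> pverts H" "\<forall>(u, v)\<in>map_prod f f ` parcs G. (h u, h v) \<in> parcs H"
    unfolding graph_hom_def by auto
  then show "graph_hom G H" unfolding graph_hom_def by (intro exI[of _ "h \<circ> f"]) auto
next
  assume "graph_hom G H"
  then obtain h where h: "h ` pverts G \<subseteq> pverts H" "\<forall>(u, v)\<in>parcs G. (h u, h v) \<in> parcs H"
    unfolding graph_hom_def by auto
  have inv: "inv_into (pverts G) f (f x) = x" if "x \<in> pverts G" for x using assms(1) that by simp
  show "graph_hom (image_graph f G) H"
    unfolding graph_hom_def
  proof (intro exI[of _ "h \<circ> inv_into (pverts G) f"] conjI)
    show "(h \<circ> inv_into (pverts G) f) ` pverts (image_graph f G) \<subseteq> pverts H" using h(1) inv by auto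
    show "\<forall>(u, v)\<in>parcs (image_graph f G). ((h \<circ> inv_into (pverts G) f) u, (h \<circ> inv_into (pverts G) f) v) \<in> parcs H"
    proof (intro ballI, clarsimp)
      fix x y assume "(x, y) \<in> parcs G"
      then show "(h (inv_into (pverts G) f (f x)), h (inv_into (pverts G) f (f y))) \<in> parcs H"
        using h(2) inv assms(2) by force
    qed
  qed
qed

section \<open>Games on disjoint unions of pieces of one graph\<close>

definition walk_ball :: "('a \<times> 'a) set \<Rightarrow> nat \<Rightarrow> 'a \<Rightarrow> 'a set" where
  "walk_ball E r x = {y. \<exists>l\<le>r. (x, y) \<in> E ^^ l}"

lemma walk_ball_self: "x \<in> walk_ball E r x"
  by (auto simp: walk_ball_def intro!: exI[of _ 0])

lemma walk_ball_sym: "sym E \<Longrightarrow> y \<in> walk_ball E r x \<Longrightarrow> x \<in> walk_ball E r y"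
  unfolding walk_ball_def using relpow_sym by fastforce

lemma walk_ball_trans:
  assumes "y \<in> walk_ball E r x" "z \<in> walk_ball E r' y"
  shows "z \<in> walk_ball E (r + r') x"
proof -
  obtain l l' where "l \<le> r" "l' \<le> r'" "(x, y) \<in> E ^^ l" "(y, z) \<in> E ^^ l'" using assms by (auto simp: walk_ball_def)
  then have "l + l' \<le> r + r'" "(x, z) \<in> E ^^ (l + l')" by (auto simp: relpow_add)
  then show ?thesis unfolding walk_ball_def by blast
qed

lemma walk_ball_mono: "r \<le> r' \<Longrightarrow> walk_ball E r x \<subseteq> walk_ball E r' x"
  by (auto simp: walk_ball_def intro: le_trans)

lemma walk_ball_arc: "(x, y) \<in> E \<Longrightarrow> 1 \<le> r \<Longrightarrow> y \<in> walk_ball E r x"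
  unfolding walk_ball_def by (intro CollectI exI[of _ 1]) auto

text \<open>All pieces are induced subgraphs of the same ambient graph. A vertex keeps its ambient
  name in the second component, so that distances and neighbourhoods in different pieces can be
  compared in the ambient graph.\<close>

definition piece_graph :: "nat set \<Rightarrow> (nat \<Rightarrow> 'a set) \<Rightarrow> ('a \<times> 'a) set \<Rightarrow> (nat \<times> 'a) pair_pre_digraph" where
  "piece_graph K D E = \<lparr>pverts = Sigma K D, parcs = {((k, x), (k, y)) |k x y. k \<in> K \<and> x \<in> D k \<and> y \<in> D k \<and> (x, y) \<in> E}\<rparr>"

text \<open>The second player answers within the same piece if the new vertex is near to an old one, and otherwise in a
  fresh piece; both moves keep the vertex of the ambient graph.\<close>

lemma fo_sat_piece_graph:
  assumes symE: "sym E"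
    and fresh: "\<And>a x Z. a \<in> K \<union> K' \<Longrightarrow> x \<in> D a \<Longrightarrow> finite Z \<Longrightarrow> card Z \<le> q \<Longrightarrow>
      \<exists>b\<in>K \<inter> K' - Z. D b \<inter> walk_ball E (2 ^ q) x = D a \<inter> walk_ball E (2 ^ q) x"
    and \<phi>: "sentence \<phi>" "quantifier_rank \<phi> \<le> q"
  shows "fo_sat (piece_graph K D E) s \<phi> \<longleftrightarrow> fo_sat (piece_graph K' D E) t \<phi>"
proof -
  \<comment> \<open>With \<open>k\<close> rounds left, partners have the same ambient vertex, their
    pieces agree within radius \<open>2 ^ k\<close>, and vertices at distance at most
    \<open>2 ^ k\<close> share a piece on one side iff they do on the other. Halving the radius in
    each round leaves room for the triangle inequality, and radius \<open>1\<close> at the end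
    decides adjacency. The bound on \<open>card J + k\<close> keeps the number of occupied pieces
    within the reach of \<open>fresh\<close>.\<close>
  define I :: "nat \<Rightarrow> nat set \<Rightarrow> (nat \<Rightarrow> nat \<times> 'a) \<Rightarrow> (nat \<Rightarrow> nat \<times> 'a) \<Rightarrow> bool" where
    "I k J s t \<longleftrightarrow> finite J \<and> card J + k \<le> q \<and>
      (\<forall>i\<in>J. s i \<in> Sigma K D \<and> t i \<in> Sigma K' D \<and> snd (s i) = snd (t i) \<and>
        D (fst (s i)) \<inter> walk_ball E (2 ^ k) (snd (s i)) = D (fst (t i)) \<inter> walk_ball E (2 ^ k) (snd (s i))) \<and>
      (\<forall>i\<in>J. \<forall>j\<in>J. snd (s j) \<in> walk_ball E (2 ^ k) (snd (s i)) \<longrightarrow> (fst (s i) = fst (s j) \<longleftrightarrow> fst (t i) = fst (t j)))"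
    for k J s t
  \<comment> \<open>The answer to one move, stated symmetrically so that it serves moves on either
    side: \<open>a\<close> may be a piece of either union, and \<open>K2\<close> is the index set of
    the union in which the answer is given.\<close>
  have step: "\<exists>b\<in>K2. x \<in> D b \<and> D a \<inter> walk_ball E (2 ^ k) x = D b \<inter> walk_ball E (2 ^ k) x \<and>
      (\<forall>j\<in>J. snd (s j) \<in> walk_ball E (2 ^ k) x \<longrightarrow> (a = fst (s j) \<longleftrightarrow> b = fst (t j)))"
    if J: "finite J" "card J + Suc k \<le> q" and ax: "a \<in> K \<union> K'" "x \<in> D a"
      and K2: "K \<inter> K' \<subseteq> K2" "\<And>j. j \<in> J \<Longrightarrow> fst (t j) \<in> K2"
      and st: "\<And>j. j \<in> J \<Longrightarrow> D (fst (s j)) \<inter> walk_ball E (2 ^ Suc k) (snd (s j)) = D (fst (t j)) \<inter> walk_ball E (2 ^ Suc k) (snd (s j))"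
      and near: "\<And>i j. i \<in> J \<Longrightarrow> j \<in> J \<Longrightarrow> snd (s j) \<in> walk_ball E (2 ^ Suc k) (snd (s i)) \<Longrightarrow> fst (s i) = fst (s j) \<longleftrightarrow> fst (t i) = fst (t j)"
    for J k a x K2 and s t :: "nat \<Rightarrow> nat \<times> 'a"
  proof (cases "\<exists>i\<in>J. fst (s i) = a \<and> snd (s i) \<in> walk_ball E (2 ^ k) x")
    case True
    then obtain i where i: "i \<in> J" "fst (s i) = a" "snd (s i) \<in> walk_ball E (2 ^ k) x" by auto
    have xi: "x \<in> walk_ball E (2 ^ k) (snd (s i))" using walk_ball_sym[OF symE i(3)] .
    have sub: "walk_ball E (2 ^ k) x \<subseteq> walk_ball E (2 ^ Suc k) (snd (s i))"
      using walk_ball_trans[OF xi] by (auto simp: mult_2)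
    show ?thesis
    proof (intro bexI[of _ "fst (t i)"] conjI ballI impI)
      show "fst (t i) \<in> K2" using K2(2) i(1) .
      show "x \<in> D (fst (t i))" using st[OF i(1)] i(2) ax(2) subsetD[OF sub walk_ball_self] by auto
      show "D a \<inter> walk_ball E (2 ^ k) x = D (fst (t i)) \<inter> walk_ball E (2 ^ k) x"
        using st[OF i(1)] sub i(2) by auto
      fix j assume j: "j \<in> J" "snd (s j) \<in> walk_ball E (2 ^ k) x"
      then have "snd (s j) \<in> walk_ball E (2 ^ Suc k) (snd (s i))" using sub by auto
      from near[OF i(1) j(1) this] show "a = fst (s j) \<longleftrightarrow> fst (t i) = fst (t j)" using i(2) by auto
    qed
  next
    case False
    have "card (fst ` t ` J) \<le> q" using J card_image_le[of J "fst \<circ> t"] by (simp add: image_comp)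
    then obtain b where b: "b \<in> K \<inter> K' - fst ` t ` J" "D b \<inter> walk_ball E (2 ^ q) x = D a \<inter> walk_ball E (2 ^ q) x"
      using fresh[OF ax, of "fst ` t ` J"] J(1) by auto
    have "(2::nat) ^ k \<le> 2 ^ q" using J(2) by simp
    from walk_ball_mono[OF this] have sub: "walk_ball E (2 ^ k) x \<subseteq> walk_ball E (2 ^ q) x" .
    show ?thesis
    proof (intro bexI[of _ b] conjI ballI impI)
      show "b \<in> K2" using b(1) K2(1) by auto
      show "x \<in> D b" using b(2) ax(2) walk_ball_self[of x E "2 ^ q"] by auto
      show "D a \<inter> walk_ball E (2 ^ k) x = D b \<inter> walk_ball E (2 ^ k) x" using b(2) sub by auto
      fix j assume j: "j \<in> J" "snd (s j) \<in> walk_ball E (2 ^ k) x"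
      then show "a = fst (s j) \<longleftrightarrow> b = fst (t j)" using False b(1) by auto
    qed
  qed
  show ?thesis
  proof (rule ehrenfeucht_fraisse[where I = I and k = q and J = "{}"])
    fix k J s t i j assume I: "I k J s t" and ij: "i \<in> J" "j \<in> J"
    have eq: "snd (s i) = snd (t i)" "snd (s j) = snd (t j)"
      and near: "snd (s j) \<in> walk_ball E (2 ^ k) (snd (s i)) \<Longrightarrow> fst (s i) = fst (s j) \<longleftrightarrow> fst (t i) = fst (t j)"
      and mem: "s i \<in> Sigma K D" "s j \<in> Sigma K D" "t i \<in> Sigma K' D" "t j \<in> Sigma K' D"
      using I ij unfolding I_def by auto
    have "s i = s j \<longleftrightarrow> t i = t j" using eq near walk_ball_self by (metis prod_eq_iff)
    moreover have "(s i, s j) \<in> parcs (piece_graph K D E) \<longleftrightarrow> fst (s i) = fst (s j) \<and> (snd (s i), snd (s j)) \<in> E"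
      using mem by (cases "s i"; cases "s j") (auto simp: piece_graph_def)
    moreover have "(t i, t j) \<in> parcs (piece_graph K' D E) \<longleftrightarrow> fst (t i) = fst (t j) \<and> (snd (t i), snd (t j)) \<in> E"
      using mem by (cases "t i"; cases "t j") (auto simp: piece_graph_def)
    ultimately show "(s i = s j \<longleftrightarrow> t i = t j) \<and>
        ((s i, s j) \<in> parcs (piece_graph K D E) \<longleftrightarrow> (t i, t j) \<in> parcs (piece_graph K' D E))"
      using near walk_ball_arc[of "snd (s i)" "snd (s j)" E "2 ^ k"] eq by auto
  next
    have card: "card (insert i J) + k \<le> q" if "finite J" "card J + Suc k \<le> q" for i k :: nat and J
      using that by (simp add: card_insert_if)
    have close: "I k (insert i J) (s(i := v)) (t(i := w))"
      if I: "I (Suc k) J s t" and vw: "v \<in> Sigma K D" "w \<in> Sigma K' D" "snd v = snd w"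
        "D (fst v) \<inter> walk_ball E (2 ^ k) (snd v) = D (fst w) \<inter> walk_ball E (2 ^ k) (snd v)"
        and near: "\<And>j. j \<in> J \<Longrightarrow> snd (s j) \<in> walk_ball E (2 ^ k) (snd v) \<Longrightarrow> fst v = fst (s j) \<longleftrightarrow> fst w = fst (t j)"
      for k J s t i v w
    proof -
      have mono: "walk_ball E (2 ^ k) x \<subseteq> walk_ball E (2 ^ Suc k) x" for x by (rule walk_ball_mono) simp
      have old: "s j \<in> Sigma K D \<and> t j \<in> Sigma K' D \<and> snd (s j) = snd (t j) \<and>
        D (fst (s j)) \<inter> walk_ball E (2 ^ k) (snd (s j)) = D (fst (t j)) \<inter> walk_ball E (2 ^ k) (snd (s j))" if "j \<in> J" for j
        using I that mono[of "snd (s j)"] unfolding I_def by blast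
      have old2: "fst (s i) = fst (s j) \<longleftrightarrow> fst (t i) = fst (t j)"
        if "i \<in> J" "j \<in> J" "snd (s j) \<in> walk_ball E (2 ^ k) (snd (s i))" for i j
        using I that mono[of "snd (s i)"] unfolding I_def by blast
      have near': "fst (s j) = fst v \<longleftrightarrow> fst (t j) = fst w" if "j \<in> J" "snd v \<in> walk_ball E (2 ^ k) (snd (s j))" for j
        using near[OF that(1) walk_ball_sym[OF symE that(2)]] by auto
      show ?thesis
        unfolding I_def
      proof (intro conjI)
        show "finite (insert i J)" "card (insert i J) + k \<le> q" using I card unfolding I_def by simp_all
        let ?s = "s(i := v)" and ?t = "t(i := w)"
        show "\<forall>j\<in>insert i J. ?s j \<in> Sigma K D \<and> ?t j \<in> Sigma K' D \<and> snd (?s j) = snd (?t j) \<and>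
          D (fst (?s j)) \<inter> walk_ball E (2 ^ k) (snd (?s j)) = D (fst (?t j)) \<inter> walk_ball E (2 ^ k) (snd (?s j))"
        proof
          fix j assume "j \<in> insert i J"
          then show "?s j \<in> Sigma K D \<and> ?t j \<in> Sigma K' D \<and> snd (?s j) = snd (?t j) \<and>
            D (fst (?s j)) \<inter> walk_ball E (2 ^ k) (snd (?s j)) = D (fst (?t j)) \<inter> walk_ball E (2 ^ k) (snd (?s j))"
          proof (cases "j = i")
            case True
            then show ?thesis unfolding True fun_upd_same using vw by (intro conjI)
          next
            case False
            then show ?thesis unfolding fun_upd_other[OF False] using old[of j] \<open>j \<in> insert i J\<close> by fast
          qed
        qed
        show "\<forall>a\<in>insert i J. \<forall>b\<in>insert i J. snd (?s b) \<in> walk_ball E (2 ^ k) (snd (?s a)) \<longrightarrow>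
          (fst (?s a) = fst (?s b)) = (fst (?t a) = fst (?t b))"
        proof (intro ballI impI)
          fix a b assume ab: "a \<in> insert i J" "b \<in> insert i J" "snd (?s b) \<in> walk_ball E (2 ^ k) (snd (?s a))"
          consider "a = i" "b = i" | "a = i" "b \<noteq> i" | "a \<noteq> i" "b = i" | "a \<noteq> i" "b \<noteq> i" by blast
          then show "(fst (?s a) = fst (?s b)) = (fst (?t a) = fst (?t b))"
          proof cases
            case 1
            then show ?thesis by simp
          next
            case 2
            then show ?thesis using near[of b] ab by simp
          next
            case 3
            then show ?thesis using near'[of a] ab by simp
          next
            case 4
            then show ?thesis using old2[of a b] ab by simp
          qed
        qed
      qed
    qed
    fix k J s t i
    assume I: "I (Suc k) J s t"
    have I1: "finite J" "card J + Suc k \<le> q" using I unfolding I_def by blast+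
    have mem: "fst (s j) \<in> K" "fst (t j) \<in> K'" and eq: "snd (t j) = snd (s j)"
      and st: "D (fst (s j)) \<inter> walk_ball E (2 ^ Suc k) (snd (s j)) = D (fst (t j)) \<inter> walk_ball E (2 ^ Suc k) (snd (s j))"
      if "j \<in> J" for j
    proof -
      have *: "s j \<in> Sigma K D \<and> t j \<in> Sigma K' D \<and> snd (s j) = snd (t j) \<and>
          D (fst (s j)) \<inter> walk_ball E (2 ^ Suc k) (snd (s j)) = D (fst (t j)) \<inter> walk_ball E (2 ^ Suc k) (snd (s j))"
        using I that unfolding I_def by blast
      show "fst (s j) \<in> K" "fst (t j) \<in> K'" "snd (t j) = snd (s j)" using * by auto
      show "D (fst (s j)) \<inter> walk_ball E (2 ^ Suc k) (snd (s j)) = D (fst (t j)) \<inter> walk_ball E (2 ^ Suc k) (snd (s j))"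
        using * by blast
    qed
    have near: "fst (s i) = fst (s j) \<longleftrightarrow> fst (t i) = fst (t j)"
      if "i \<in> J" "j \<in> J" "snd (s j) \<in> walk_ball E (2 ^ Suc k) (snd (s i))" for i j
      using I that unfolding I_def by blast
    have st': "D (fst (t j)) \<inter> walk_ball E (2 ^ Suc k) (snd (t j)) = D (fst (s j)) \<inter> walk_ball E (2 ^ Suc k) (snd (t j))"
      if "j \<in> J" for j using st[OF that] unfolding eq[OF that] by (rule sym)
    have near': "fst (t i) = fst (t j) \<longleftrightarrow> fst (s i) = fst (s j)"
      if "i \<in> J" "j \<in> J" "snd (t j) \<in> walk_ball E (2 ^ Suc k) (snd (t i))" for i j
      using near[OF that(1,2)] that(3) unfolding eq[OF that(1)] eq[OF that(2)] by blast
    {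
      fix v assume v: "v \<in> pverts (piece_graph K D E)"
      then have v': "fst v \<in> K \<union> K'" "snd v \<in> D (fst v)" "v \<in> Sigma K D" by (auto simp: piece_graph_def)
      have "\<exists>b\<in>K'. snd v \<in> D b \<and> D (fst v) \<inter> walk_ball E (2 ^ k) (snd v) = D b \<inter> walk_ball E (2 ^ k) (snd v) \<and>
          (\<forall>j\<in>J. snd (s j) \<in> walk_ball E (2 ^ k) (snd v) \<longrightarrow> (fst v = fst (s j) \<longleftrightarrow> b = fst (t j)))"
        by (rule step[OF I1 v'(1,2) _ mem(2) st near]) simp_all
      then obtain b where b: "b \<in> K'" "snd v \<in> D b" "D (fst v) \<inter> walk_ball E (2 ^ k) (snd v) = D b \<inter> walk_ball E (2 ^ k) (snd v)"
        "\<And>j. j \<in> J \<Longrightarrow> snd (s j) \<in> walk_ball E (2 ^ k) (snd v) \<Longrightarrow> fst v = fst (s j) \<longleftrightarrow> b = fst (t j)" by auto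
      have "I k (insert i J) (s(i := v)) (t(i := (b, snd v)))"
        by (rule close[OF I v'(3)]) (use b in simp_all)
      then show "\<exists>w\<in>pverts (piece_graph K' D E). I k (insert i J) (s(i := v)) (t(i := w))"
        using b(1,2) by (intro bexI[of _ "(b, snd v)"]) (auto simp: piece_graph_def)
    next
      fix w assume w: "w \<in> pverts (piece_graph K' D E)"
      then have w': "fst w \<in> K \<union> K'" "snd w \<in> D (fst w)" "w \<in> Sigma K' D" by (auto simp: piece_graph_def)
      have "\<exists>b\<in>K. snd w \<in> D b \<and> D (fst w) \<inter> walk_ball E (2 ^ k) (snd w) = D b \<inter> walk_ball E (2 ^ k) (snd w) \<and>
          (\<forall>j\<in>J. snd (t j) \<in> walk_ball E (2 ^ k) (snd w) \<longrightarrow> (fst w = fst (t j) \<longleftrightarrow> b = fst (s j)))"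
        by (rule step[OF I1 w'(1,2) _ mem(1) st' near']) simp_all
      then obtain b where b: "b \<in> K" "snd w \<in> D b" "D (fst w) \<inter> walk_ball E (2 ^ k) (snd w) = D b \<inter> walk_ball E (2 ^ k) (snd w)"
        "\<And>j. j \<in> J \<Longrightarrow> snd (t j) \<in> walk_ball E (2 ^ k) (snd w) \<Longrightarrow> fst w = fst (t j) \<longleftrightarrow> b = fst (s j)" by auto
      have "I k (insert i J) (s(i := (b, snd w))) (t(i := w))"
        by (rule close[OF I _ w'(3)]) (use b eq in auto)
      then show "\<exists>v\<in>pverts (piece_graph K D E). I k (insert i J) (s(i := v)) (t(i := w))"
        using b(1,2) by (intro bexI[of _ "(b, snd w)"]) (auto simp: piece_graph_def)
    }
  qed (use \<phi> in \<open>simp_all add: I_def sentence_def\<close>)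
qed

section \<open>Closure properties of classes\<close>

lemma pair_graph_eta [simp]: "\<lparr>pverts = pverts G, parcs = parcs G\<rparr> = (G :: 'a pair_pre_digraph)"
  by (cases G) simp

text \<open>\<open>X\<close> need not have natural numbers as vertices.\<close>

definition in_class :: "nat pair_pre_digraph set \<Rightarrow> 'a pair_pre_digraph \<Rightarrow> bool" where
  "in_class \<C> X \<longleftrightarrow> (\<exists>f. inj_on f (pverts X) \<and> image_graph f X \<in> \<C>)"

lemma wf_with_proj: "pair_graph G \<Longrightarrow> wf_digraph (with_proj G)"
  using pair_graphD(2)[of G] by (intro wf_digraph.intro) auto

lemma subgraph_with_proj:
  assumes "pair_graph H" "pair_graph G" "pverts H \<subseteq> pverts G" "parcs H \<subseteq> parcs G"
  shows "subgraph (with_proj H) (with_proj G)"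
  using assms wf_with_proj by (auto simp: subgraph_def compatible_def with_proj_def)

lemma image_pair_graph:
  assumes "pair_graph X" "inj_on f (pverts X)"
  shows "pair_graph (image_graph f X)"
proof -
  note X = pair_graphD[OF assms(1)]
  show ?thesis unfolding image_graph_def
  proof (rule pair_graphI)
    show "finite (f ` pverts X)" using X(1) by simp
    show "map_prod f f ` parcs X \<subseteq> f ` pverts X \<times> f ` pverts X" using X(2) by auto
    show "sym (map_prod f f ` parcs X)" using X(3) by (force simp: sym_def)
    show "irrefl (map_prod f f ` parcs X)"
    proof (rule irreflI, rule notI)
      fix a assume "(a, a) \<in> map_prod f f ` parcs X"
      then obtain x y where xy: "(x, y) \<in> parcs X" "f x = f y" by auto
      then have "x = y" using inj_onD[OF assms(2)] X(2) by blast
      then show False using xy(1) X(4) by (auto simp: irrefl_def)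
    qed
  qed
qed

lemma in_classI:
  assumes "monotone_class \<C>" "graph_class \<C>" "T \<in> \<C>" "pair_graph X" "inj_on g (pverts X)" "g ` pverts X \<subseteq> pverts T"
    "\<And>x y. (x, y) \<in> parcs X \<Longrightarrow> (g x, g y) \<in> parcs T"
  shows "in_class \<C> X"
proof -
  have "pair_graph T" using assms(2,3) by (simp add: graph_class_def)
  then have "subgraph (with_proj (image_graph g X)) (with_proj T)"
    using assms(6,7) image_pair_graph[OF assms(4,5)] by (intro subgraph_with_proj) auto
  then have "image_graph g X \<in> \<C>"
    using assms(1,3) image_pair_graph[OF assms(4,5)] unfolding monotone_class_def by blast
  then show ?thesis unfolding in_class_def using assms(5) by blast
qed

lemma in_class_mono:
  assumes "monotone_class \<C>" "graph_class \<C>" "in_class \<C> X" "pair_graph Y" "inj_on g (pverts Y)" "g ` pverts Y \<subseteq> pverts X"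
    "\<And>x y. (x, y) \<in> parcs Y \<Longrightarrow> (g x, g y) \<in> parcs X"
  shows "in_class \<C> Y"
proof -
  obtain f where f: "inj_on f (pverts X)" "image_graph f X \<in> \<C>" using assms(3) by (auto simp: in_class_def)
  have "inj_on (f \<circ> g) (pverts Y)" using assms(5,6) f(1) by (meson comp_inj_on inj_on_subset)
  moreover have "(f \<circ> g) ` pverts Y \<subseteq> pverts (image_graph f X)" using assms(6) by auto
  moreover have "((f \<circ> g) x, (f \<circ> g) y) \<in> parcs (image_graph f X)" if "(x, y) \<in> parcs Y" for x y
    using assms(7)[OF that] by force
  ultimately show ?thesis by (intro in_classI[OF assms(1,2) f(2) assms(4)])
qed

lemma graph_class_image:
  assumes "graph_class \<C>" "G \<in> \<C>" "inj_on f (pverts G)"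
  shows "image_graph f G \<in> \<C>"
proof -
  have G: "pair_graph G" using assms by (simp add: graph_class_def)
  note G' = pair_graphD[OF G]
  let ?h = "\<lparr>iso_verts = f, iso_arcs = map_prod f f, iso_head = snd, iso_tail = fst\<rparr>"
  have "inj_on (map_prod f f) (parcs G)"
  proof (rule inj_onI)
    fix s t assume st: "s \<in> parcs G" "t \<in> parcs G" "map_prod f f s = map_prod f f t"
    then have "fst s = fst t \<and> snd s = snd t"
      using inj_onD[OF assms(3), of "fst s" "fst t"] inj_onD[OF assms(3), of "snd s" "snd t"] G'(2)
      by (cases s; cases t) auto
    then show "s = t" by (simp add: prod_eq_iff)
  qed
  then have "pre_digraph.digraph_isomorphism (with_proj G) ?h"
    unfolding pre_digraph.digraph_isomorphism_def using wf_with_proj[OF G] assms(3) by simp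
  moreover have "with_proj (image_graph f G) = app_iso ?h (with_proj G)"
    by (simp add: app_iso_def with_proj_def image_graph_def)
  ultimately have "digraph_iso (with_proj G) (with_proj (image_graph f G))" unfolding digraph_iso_def by blast
  then show ?thesis using assms by (auto simp: graph_class_def)
qed

lemma subdivide_in_class:
  assumes "graph_class \<C>" "topologically_closed \<C>" "G \<in> \<C>" "e \<in> parcs G" "w \<notin> pverts G"
  shows "subdivide G e w \<in> \<C>"
proof -
  interpret pair_graph G using assms by (simp add: graph_class_def)
  have "subdivision_pair G G" by (rule subdivision_pair_base) unfold_locales
  then have "subdivision_pair G (subdivide G e w)" by (rule subdivision_pair_divide[OF assms(4,5)])
  then show ?thesis using assms(2,3) by (auto simp: topologically_closed_def)
qed

lemma induced_in_class:
  assumes "graph_class \<C>" "hereditary \<C>" "G \<in> \<C>" "W \<subseteq> pverts G"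
  shows "\<lparr>pverts = W, parcs = Restr (parcs G) W\<rparr> \<in> \<C>"
proof -
  have G: "pair_graph G" using assms by (simp add: graph_class_def)
  note G' = pair_graphD[OF G]
  let ?H = "\<lparr>pverts = W, parcs = Restr (parcs G) W\<rparr>"
  have "pair_graph ?H"
    using assms(4) G' by (intro pair_graphI) (auto intro: finite_subset simp: sym_def irrefl_def)
  then have "subgraph (with_proj ?H) (with_proj G)"
    using assms(4) by (intro subgraph_with_proj[OF _ G]) auto
  then have "induced_subgraph (with_proj ?H) (with_proj G)"
    by (auto simp: induced_subgraph_def)
  then show ?thesis using assms(2,3) unfolding hereditary_def by blast
qed

text \<open>Subdividing an edge once and deleting the new vertex deletes the edge.\<close>

lemma hereditary_topologically_closed_monotone:
  assumes C: "graph_class \<C>" "hereditary \<C>" "topologically_closed \<C>"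
  shows "monotone_class \<C>"
proof -
  have del1: "\<lparr>pverts = pverts G, parcs = parcs G - {(u, v), (v, u)}\<rparr> \<in> \<C>"
    if G: "G \<in> \<C>" "(u, v) \<in> parcs G" for G u v
  proof -
    have "pair_graph G" using G C by (simp add: graph_class_def)
    note G' = pair_graphD[OF this]
    obtain w where w: "w \<notin> pverts G" using ex_new_if_finite[OF _ G'(1)] by auto
    have uv: "u \<in> pverts G" "v \<in> pverts G" using G' G(2) by auto
    have S: "subdivide G (u, v) w \<in> \<C>" using subdivide_in_class[OF C(1,3) G w] .
    have "Restr (parcs (subdivide G (u, v) w)) (pverts G) = parcs G - {(u, v), (v, u)}"
      using w G'(2) by (auto simp: subdivide_simps)
    then show ?thesis using induced_in_class[OF C(1,2) S, of "pverts G"] by (auto simp: subdivide_simps)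
  qed
  have del: "\<lparr>pverts = pverts G, parcs = parcs G - (F \<union> F\<inverse>)\<rparr> \<in> \<C>" if G: "G \<in> \<C>" and F: "finite F" for G F
    using F
  proof (induction F)
    case empty
    then show ?case using G by simp
  next
    case (insert e F)
    obtain u v where e: "e = (u, v)" by (cases e)
    let ?G = "\<lparr>pverts = pverts G, parcs = parcs G - (F \<union> F\<inverse>)\<rparr>"
    have eq: "parcs G - (insert e F \<union> (insert e F)\<inverse>) = parcs ?G - {(u, v), (v, u)}" unfolding e by auto
    show ?case
    proof (cases "(u, v) \<in> parcs ?G")
      case True
      from del1[OF insert.IH True] show ?thesis unfolding eq by simp
    next
      case False
      have "pair_graph ?G" using insert.IH C by (simp add: graph_class_def)
      then have "(v, u) \<notin> parcs ?G" using False pair_graphD(3) symD by metis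
      then show ?thesis using False insert.IH unfolding eq by simp
    qed
  qed
  show ?thesis
    unfolding monotone_class_def
  proof (intro ballI allI impI, elim conjE)
    fix G H assume G: "G \<in> \<C>" and H: "pair_graph H" and sub: "subgraph (with_proj H) (with_proj G)"
    have "pair_graph G" using G C by (simp add: graph_class_def)
    note G' = pair_graphD[OF this] and H' = pair_graphD[OF H]
    have sub': "pverts H \<subseteq> pverts G" "parcs H \<subseteq> parcs G" using sub by (auto simp: subgraph_def)
    let ?F = "parcs G - parcs H"
    let ?G = "\<lparr>pverts = pverts G, parcs = parcs G - (?F \<union> ?F\<inverse>)\<rparr>"
    have "finite ?F" using G'(1,2) by (meson finite_Diff finite_SigmaI finite_subset)
    then have "?G \<in> \<C>" by (rule del[OF G])
    from induced_in_class[OF C(1,2) this, of "pverts H"] sub'(1)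
    have "\<lparr>pverts = pverts H, parcs = Restr (parcs G - (?F \<union> ?F\<inverse>)) (pverts H)\<rparr> \<in> \<C>" by simp
    moreover have "Restr (parcs G - (?F \<union> ?F\<inverse>)) (pverts H) = parcs H"
      using sub'(2) H'(2) symD[OF H'(3)] symD[OF G'(3)] by auto
    ultimately show "H \<in> \<C>" by simp
  qed
qed

text \<open>Disjointness of \<open>F\<close> from its converse selects one direction of every edge,
  so each edge receives exactly one new vertex. The arcs are listed explicitly because embeddings
  into the result are defined on them.\<close>

lemma subdivide_arcs_in_class:
  assumes C: "graph_class \<C>" "topologically_closed \<C>" and T: "T \<in> \<C>"
    and F: "finite F" "F \<subseteq> parcs T" "F \<inter> F\<inverse> = {}"
  shows "\<exists>w. inj_on w F \<and> w ` F \<inter> pverts T = {} \<and>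
    \<lparr>pverts = pverts T \<union> w ` F, parcs = (parcs T - (F \<union> F\<inverse>)) \<union>
      (\<Union>(u, v)\<in>F. {(u, w (u, v)), (w (u, v), u), (w (u, v), v), (v, w (u, v))})\<rparr> \<in> \<C>"
  using F
proof (induction F)
  case empty
  then show ?case using T by (intro exI[of _ "\<lambda>_. 0"]) simp
next
  case (insert e F)
  obtain a b where e: "e = (a, b)" by (cases e)
  define new where "new w = (\<lambda>(u, v). {(u, w (u, v)), (w (u, v), u), (w (u, v), v), (v, w (u, v) :: nat)})" for w :: "nat \<times> nat \<Rightarrow> nat"
  have new_eq: "(\<Union>(u, v)\<in>F. {(u, w (u, v)), (w (u, v), u), (w (u, v), v), (v, w (u, v))}) = (\<Union>e\<in>F. new w e)" for w F
    by (simp add: new_def)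
  from insert have "F \<subseteq> parcs T" "F \<inter> F\<inverse> = {}" by auto
  from insert.IH[OF this] obtain w where w: "inj_on w F" "w ` F \<inter> pverts T = {}"
    "\<lparr>pverts = pverts T \<union> w ` F, parcs = (parcs T - (F \<union> F\<inverse>)) \<union> (\<Union>e\<in>F. new w e)\<rparr> \<in> \<C>" (is "?S \<in> _")
    unfolding new_eq by auto
  have "pair_graph ?S" using w(3) C by (simp add: graph_class_def)
  note S' = pair_graphD[OF this]
  have pT: "pair_graph T" using T C by (simp add: graph_class_def)
  note T' = pair_graphD[OF pT]
  obtain z where z: "z \<notin> pverts ?S" using ex_new_if_finite[OF _ S'(1)] by auto
  have ab: "(a, b) \<in> parcs T" "(a, b) \<notin> F" "(b, a) \<notin> F" "a \<noteq> b" "a \<in> pverts T" "b \<in> pverts T"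
    using insert.prems insert.hyps e T'(2) by auto
  then have "(a, b) \<in> parcs ?S" by auto
  from subdivide_in_class[OF C w(3) this z] have sd: "subdivide ?S (a, b) z \<in> \<C>" .
  define w' where "w' = w(e := z)"
  have "inj_on w' (insert e F)" using w(1) z insert.hyps by (auto simp: w'_def inj_on_def)
  moreover have "w' ` insert e F \<inter> pverts T = {}" using w(2) z insert.hyps by (auto simp: w'_def)
  moreover have "subdivide ?S (a, b) z = \<lparr>pverts = pverts T \<union> w' ` insert e F,
     parcs = (parcs T - (insert e F \<union> (insert e F)\<inverse>)) \<union> (\<Union>e\<in>insert e F. new w' e)\<rparr>"
  proof -
    have neq: "x \<noteq> e" if "x \<in> F" for x using that insert.hyps by auto
    have "(\<Union>x\<in>F. new w' x) = (\<Union>x\<in>F. new w x)"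
      by (intro SUP_cong refl) (use neq in \<open>auto simp: new_def w'_def\<close>)
    moreover have "(a, b) \<notin> new w x" "(b, a) \<notin> new w x" if "x \<in> F" for x
    proof -
      have "w x \<noteq> a" "w x \<noteq> b" using w(2) ab(5,6) that by auto
      then show "(a, b) \<notin> new w x" "(b, a) \<notin> new w x" by (auto simp: new_def split: prod.splits)
    qed
    moreover have "new w' e = {(a, z), (z, a), (z, b), (b, z)}" by (simp add: new_def w'_def e)
    moreover have "w' ` F = w ` F" using neq by (auto simp: w'_def)
    moreover have "w' e = z" by (simp add: w'_def)
    ultimately show ?thesis
      unfolding subdivide.simps e by auto
  qed
  ultimately show ?case unfolding new_eq using sd by (intro exI[of _ w']) simp
qed

section \<open>Undefinability from locality\<close>

abbreviation copies :: "nat \<Rightarrow> 'a pair_pre_digraph \<Rightarrow> (nat \<times> 'a) pair_pre_digraph" where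
  "copies M X \<equiv> piece_graph {..M} (\<lambda>_. pverts X) (parcs X)"

text \<open>The balls and the whole graph are pieces of copies of one graph, so by monotonicity both
  unions belong to the class as soon as the copies do. Piece \<open>0\<close> is the whole graph,
  and the others are balls.\<close>

lemma pieces_not_definable:
  assumes C: "monotone_class \<C>" "graph_class \<C>"
    and B: "pair_graph \<lparr>pverts = V, parcs = E\<rparr>" and copies: "\<And>M. in_class \<C> (piece_graph {..M} (\<lambda>_. V) E)"
    and \<Phi>: "sentence \<Phi>" "\<forall>G\<in>\<C>. fo_models G \<Phi> \<longleftrightarrow> graph_hom G H"
    and H: "(h0, h1) \<in> parcs H" "pair_graph H"
    and odd: "short_odd_free (2 * 2 ^ quantifier_rank \<Phi> + 1) E" and nohom: "\<not> graph_hom \<lparr>pverts = V, parcs = E\<rparr> H"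
  shows False
proof -
  let ?q = "quantifier_rank \<Phi>"
  let ?R = "2 ^ ?q :: nat"
  note B' = pair_graphD[OF B, simplified] and H' = pair_graphD[OF H(2)]
  obtain h :: "nat \<Rightarrow> 'a" where h: "bij_betw h {0..<card V} V" using ex_bij_betw_nat_finite[OF B'(1)] by auto
  have hV: "h ` {..<card V} = V" using h by (auto simp: bij_betw_def atLeast0LessThan)
  have "V \<noteq> {}"
  proof
    assume "V = {}"
    then show False using nohom B'(2) by (auto simp: graph_hom_def)
  qed
  then have n: "0 < card V" using B'(1) by (simp add: card_gt_0_iff)
  \<comment> \<open>The pieces \<open>1, ..., M\<close> run cyclically through all centres. With
    \<open>M = card V * Suc ?q\<close> every vertex is the centre of \<open>Suc ?q\<close> balls, so
    one of them is always unoccupied.\<close>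
  define c where "c k = h ((k - 1) mod card V)" for k
  have cV: "c k \<in> V" for k unfolding c_def using hV n by auto
  define D where "D k = (if k = 0 then V else walk_ball E ?R (c k))" for k
  have ball: "walk_ball E r x \<subseteq> V" if "x \<in> V" for r x
  proof
    fix y assume "y \<in> walk_ball E r x"
    then obtain l where "(x, y) \<in> E ^^ l" by (auto simp: walk_ball_def)
    then show "y \<in> V" using that B'(2) by (cases l) auto
  qed
  have DV: "D k \<subseteq> V" for k using ball[OF cV] by (simp add: D_def)
  define M where "M = card V * Suc ?q"
  have many: "\<exists>b\<in>{1..M} - Z. c b = x" if x: "x \<in> V" and Z: "finite Z" "card Z \<le> ?q" for x and Z :: "nat set"
  proof -
    have "x \<in> h ` {..<card V}" using x hV by simp
    then obtain i where i: "i < card V" "h i = x" by auto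
    let ?f = "\<lambda>t. Suc (i + card V * t)"
    have "inj_on ?f {..?q}" using n by (auto simp: inj_on_def)
    then have "card (?f ` {..?q}) = Suc ?q" by (simp add: card_image)
    then have "\<not> ?f ` {..?q} \<subseteq> Z" using Z card_mono[of Z "?f ` {..?q}"] by auto
    then obtain t where t: "t \<le> ?q" "?f t \<notin> Z" by auto
    have "i + card V * t < card V + card V * t" using i(1) by simp
    also have "\<dots> = card V * Suc t" by simp
    also have "\<dots> \<le> M" unfolding M_def using t(1) by (intro mult_le_mono2) simp
    finally have "?f t \<in> {1..M}" by simp
    moreover have "c (?f t) = x" using i by (simp add: c_def)
    ultimately show ?thesis using t(2) by blast
  qed
  have eq: "fo_sat (piece_graph {1..M} D E) s \<Phi> \<longleftrightarrow> fo_sat (piece_graph {..M} D E) t \<Phi>" for s t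
  proof (rule fo_sat_piece_graph[OF B'(3) _ \<Phi>(1) le_refl])
    fix a x and Z :: "nat set" assume a: "a \<in> {1..M} \<union> {..M}" "x \<in> D a" and Z: "finite Z" "card Z \<le> ?q"
    show "\<exists>b\<in>{1..M} \<inter> {..M} - Z. D b \<inter> walk_ball E ?R x = D a \<inter> walk_ball E ?R x"
    proof (cases "a = 0")
      case True
      \<comment> \<open>A vertex of the whole graph is answered by the centre of a ball around it,
        which agrees with the whole graph up to the full radius.\<close>
      have x: "x \<in> V" using a DV by auto
      obtain b where "b \<in> {1..M} - Z" "c b = x" using many[OF x Z] by auto
      then show ?thesis using True ball[OF x] by (intro bexI[of _ b]) (auto simp: D_def)
    next
      case False
      obtain b where b: "b \<in> {1..M} - Z" "c b = c a" using many[OF cV Z, of a] by blast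
      then have "D b = D a" using False by (simp add: D_def)
      then show ?thesis using b(1) by (intro bexI[of _ b]) auto
    qed
  qed
  have pg: "pair_graph (piece_graph K D E)" if "finite K" for K
    unfolding piece_graph_def
  proof (rule pair_graphI)
    show "finite (Sigma K D)" using that DV B'(1) by (auto intro: finite_subset)
  qed (use B'(3,4) in \<open>auto simp: sym_def irrefl_def\<close>)
  have inC: "in_class \<C> (piece_graph K D E)" if "K \<subseteq> {..M}" for K
  proof (rule in_class_mono[OF C copies[of M] pg])
    show "finite K" using that finite_subset by auto
    show "inj_on (\<lambda>x. x) (pverts (piece_graph K D E))" by simp
  qed (use that subsetD[OF DV] in \<open>auto simp: piece_graph_def subset_iff\<close>)
  have models: "fo_models (piece_graph K D E) \<Phi> \<longleftrightarrow> graph_hom (piece_graph K D E) H" if K: "K \<subseteq> {..M}" for K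
  proof -
    have "finite K" using K finite_subset by auto
    note pg' = pair_graphD(2)[OF pg[OF this]]
    obtain f where f: "inj_on f (pverts (piece_graph K D E))" "image_graph f (piece_graph K D E) \<in> \<C>"
      using inC[OF K] by (auto simp: in_class_def)
    then show ?thesis
      using \<Phi>(2) fo_models_image_graph[OF f(1) pg' \<Phi>(1)] graph_hom_image_graph[OF f(1) pg'] by blast
  qed
  have "graph_hom (piece_graph {1..M} D E) H"
  proof -
    \<comment> \<open>The parity of the distance from the centre is a proper 2-colouring of a ball:
      adjacent vertices of equal parity would close up to an odd walk of length at most
      \<open>2 * ?R + 1\<close>. So every ball maps to a single edge of \<open>H\<close>.\<close>
    define l where "l k x = (LEAST l. (c k, x) \<in> E ^^ l)" for k x
    have l: "(c k, x) \<in> E ^^ l k x \<and> l k x \<le> ?R" if kx: "k \<in> {1..M}" "x \<in> D k" for k x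
    proof -
      obtain l' where l': "l' \<le> ?R" "(c k, x) \<in> E ^^ l'" using kx by (auto simp: D_def walk_ball_def)
      then show ?thesis unfolding l_def using LeastI[of "\<lambda>l. (c k, x) \<in> E ^^ l"] Least_le[of "\<lambda>l. (c k, x) \<in> E ^^ l"] le_trans by blast
    qed
    define g where "g = (\<lambda>(k, x). if even (l k x) then h0 else h1)"
    have "(g (k, x), g (k, y)) \<in> parcs H" if k: "k \<in> {1..M}" and xy: "x \<in> D k" "y \<in> D k" "(x, y) \<in> E" for k x y
    proof -
      have "(c k, y) \<in> E ^^ (l k x + 1)" using l[OF k xy(1)] xy(3) by auto
      moreover have "(y, c k) \<in> E ^^ l k y" using l[OF k xy(2)] relpow_sym[OF B'(3)] by blast
      ultimately have "(c k, c k) \<in> E ^^ (l k x + 1 + l k y)" unfolding relpow_add by (rule relcompI)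
      moreover have "l k x + 1 + l k y \<le> 2 * ?R + 1" using l[OF k xy(1)] l[OF k xy(2)] by simp
      ultimately have "even (l k x + 1 + l k y)" using odd unfolding short_odd_free_def by blast
      then have "even (l k x) \<longleftrightarrow> odd (l k y)" by auto
      then show ?thesis using H(1) symD[OF H'(3) H(1)] by (auto simp: g_def)
    qed
    moreover have "g v \<in> pverts H" for v using H(1) H'(2) by (cases v) (auto simp: g_def)
    ultimately show ?thesis unfolding graph_hom_def by (intro exI[of _ g]) (auto simp: piece_graph_def)
  qed
  then have "fo_models (piece_graph {1..M} D E) \<Phi>" using models[of "{1..M}"] by auto
  then have "fo_models (piece_graph {..M} D E) \<Phi>" using eq unfolding fo_models_def by blast
  then have "graph_hom (piece_graph {..M} D E) H" using models[of "{..M}"] by auto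
  then obtain f where f: "f ` pverts (piece_graph {..M} D E) \<subseteq> pverts H"
    "\<forall>(u, v)\<in>parcs (piece_graph {..M} D E). (f u, f v) \<in> parcs H" unfolding graph_hom_def by auto
  have "f (0, x) \<in> pverts H" if "x \<in> V" for x using f(1) that by (auto simp: piece_graph_def D_def)
  moreover have "(f (0, x), f (0, y)) \<in> parcs H" if "(x, y) \<in> E" for x y
    using f(2) that B'(2) by (force simp: piece_graph_def D_def)
  ultimately have "graph_hom \<lparr>pverts = V, parcs = E\<rparr> H"
    unfolding graph_hom_def by (intro exI[of _ "\<lambda>x. f (0, x)"]) auto
  then show False using nohom by simp
qed

section \<open>Uniform subdivisions\<close>

definition colorable :: "nat \<Rightarrow> 'a pair_pre_digraph \<Rightarrow> bool" where
  "colorable n G \<longleftrightarrow> (\<exists>col :: 'a \<Rightarrow> nat. (\<forall>v\<in>pverts G. col v < n) \<and> (\<forall>(u, v)\<in>parcs G. col u \<noteq> col v))"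

text \<open>In the subdivision of \<open>G\<close> with paths of length \<open>m\<close>, the vertex \<open>x\<close> of \<open>G\<close> is \<open>(x, x, 0)\<close>, and the
  \<open>i\<close>-th inner vertex of the path from \<open>x\<close> to \<open>y\<close>, where \<open>x < y\<close>, is \<open>(x, y, i)\<close>.\<close>

definition path_vertex :: "nat \<Rightarrow> nat \<Rightarrow> nat \<Rightarrow> nat \<Rightarrow> nat \<times> nat \<times> nat" where
  "path_vertex m x y i = (if i = 0 then (x, x, 0) else if i = m then (y, y, 0) else (x, y, i))"

definition path_arcs :: "nat \<Rightarrow> (nat \<times> nat) set \<Rightarrow> ((nat \<times> nat \<times> nat) \<times> (nat \<times> nat \<times> nat)) set" where
  "path_arcs m E = {(path_vertex m x y i, path_vertex m x y (Suc i)) |x y i. (x, y) \<in> E \<and> x < y \<and> i < m}"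

definition subdiv_graph :: "nat \<Rightarrow> nat pair_pre_digraph \<Rightarrow> (nat \<times> nat \<times> nat) pair_pre_digraph" where
  "subdiv_graph m G = \<lparr>pverts = (\<lambda>x. (x, x, 0)) ` pverts G \<union> {(x, y, i) |x y i. (x, y) \<in> parcs G \<and> x < y \<and> 0 < i \<and> i < m},
     parcs = path_arcs m (parcs G) \<union> (path_arcs m (parcs G))\<inverse>\<rparr>"

lemma path_arcsI: "(x, y) \<in> E \<Longrightarrow> x < y \<Longrightarrow> i < m \<Longrightarrow> (path_vertex m x y i, path_vertex m x y (Suc i)) \<in> path_arcs m E"
  unfolding path_arcs_def by blast

lemma path_arcsE:
  assumes "(a, b) \<in> path_arcs m E"
  obtains x y i where "(x, y) \<in> E" "x < y" "i < m" "a = path_vertex m x y i" "b = path_vertex m x y (Suc i)"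
  using assms unfolding path_arcs_def by blast

lemma path_vertex_in:
  assumes "pair_graph G" "(x, y) \<in> parcs G" "x < y" "i \<le> m"
  shows "path_vertex m x y i \<in> pverts (subdiv_graph m G)"
  using pair_graphD(2)[OF assms(1)] assms(2-4) by (auto simp: path_vertex_def subdiv_graph_def)

lemma pair_graph_subdiv_graph:
  assumes G: "pair_graph G"
  shows "pair_graph (subdiv_graph m G)"
proof -
  note G' = pair_graphD[OF G]
  let ?S = "subdiv_graph m G"
  have "pverts ?S \<subseteq> pverts G \<times> pverts G \<times> {..m}"
    using G'(2) by (auto simp: subdiv_graph_def)
  then have "finite (pverts ?S)" using G'(1) by (meson finite_SigmaI finite_atMost finite_subset)
  moreover have "path_arcs m (parcs G) \<subseteq> pverts ?S \<times> pverts ?S"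
    using path_vertex_in[OF G] by (auto elim!: path_arcsE)
  then have "parcs ?S \<subseteq> pverts ?S \<times> pverts ?S" by (auto simp: subdiv_graph_def)
  moreover have "sym (parcs ?S)" by (auto simp: subdiv_graph_def sym_def)
  moreover have "irrefl (parcs ?S)"
    by (auto simp: subdiv_graph_def irrefl_def path_vertex_def elim!: path_arcsE split: if_splits)
  ultimately have "pair_graph \<lparr>pverts = pverts ?S, parcs = parcs ?S\<rparr>" by (rule pair_graphI)
  then show ?thesis by simp
qed

text \<open>Folding every path back and forth onto its edge is a homomorphism to \<open>G\<close>.
  It is consistent at the far end because \<open>m\<close> is odd.\<close>

lemma short_odd_free_subdiv_graph:
  assumes "pair_graph G" "short_odd_free L (parcs G)" "odd m"
  shows "short_odd_free L (parcs (subdiv_graph m G))"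
proof (rule short_odd_free_map[OF assms(2), of _ "\<lambda>(x, y, i). if even i then x else y"])
  let ?f = "\<lambda>(x, y, i). if even i then x else y"
  note G' = pair_graphD[OF assms(1)]
  have f: "?f (path_vertex m x y i) = (if even i then x else y)" for x y i :: nat
    using assms(3) by (auto simp: path_vertex_def)
  have *: "(?f a, ?f b) \<in> parcs G \<and> (?f b, ?f a) \<in> parcs G" if "(a, b) \<in> path_arcs m (parcs G)" for a b
    using that
  proof (rule path_arcsE)
    fix x y i assume "(x, y) \<in> parcs G" "a = path_vertex m x y i" "b = path_vertex m x y (Suc i)"
    then show ?thesis using symD[OF G'(3)] by (simp only: f) auto
  qed
  show "(?f a, ?f b) \<in> parcs G" if "(a, b) \<in> parcs (subdiv_graph m G)" for a b
    using that *[of a b] *[of b a] unfolding subdiv_graph_def pair_pre_digraph.simps Un_iff converse_iff by blast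
qed

lemma relpow_path_arcs:
  assumes "(x, y) \<in> E" "x < y" "0 < m"
  shows "((x, x, 0), (y, y, 0)) \<in> path_arcs m E ^^ m"
  unfolding relpow_fun_conv
  using path_arcsI[OF assms(1,2)] assms(3) by (intro exI[of _ "path_vertex m x y"]) (simp add: path_vertex_def)

lemma graph_hom_subdiv_graph:
  assumes G: "pair_graph G" and H: "pair_graph H" "short_odd_free L (parcs H)" and m: "odd m" "m \<le> L"
    and hom: "graph_hom (subdiv_graph m G) H"
  shows "colorable (card (pverts H)) G"
proof -
  note G' = pair_graphD[OF G] and H' = pair_graphD[OF H(1)]
  obtain f where f1: "f ` pverts (subdiv_graph m G) \<subseteq> pverts H"
    and f2: "\<forall>(a, b)\<in>parcs (subdiv_graph m G). (f a, f b) \<in> parcs H" using hom unfolding graph_hom_def by blast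
  have f: "(f a, f b) \<in> parcs H" if "(a, b) \<in> parcs (subdiv_graph m G)" for a b
    using bspec[OF f2 that] by simp
  obtain h where h: "bij_betw h (pverts H) {0..<card (pverts H)}" using ex_bij_betw_finite_nat[OF H'(1)] by auto
  have fH: "f (x, x, 0) \<in> pverts H" if "x \<in> pverts G" for x
    using f1 that by (auto simp: subdiv_graph_def)
  have ne: "f (x, x, 0) \<noteq> f (y, y, 0)" if "(x, y) \<in> parcs G" "x < y" for x y
  proof
    have "0 < m" using m(1) by (auto intro: Nat.gr0I)
    have "(f (x, x, 0), f (y, y, 0)) \<in> parcs H ^^ m"
      by (rule relpow_map[OF relpow_path_arcs[OF that \<open>0 < m\<close>]]) (use f in \<open>simp add: subdiv_graph_def\<close>)
    moreover assume "f (x, x, 0) = f (y, y, 0)"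
    ultimately show False using H(2) m unfolding short_odd_free_def by metis
  qed
  have ne': "f (x, x, 0) \<noteq> f (y, y, 0)" if xy: "(x, y) \<in> parcs G" for x y
  proof -
    have "x \<noteq> y" using xy G'(4) by (auto simp: irrefl_def)
    then show ?thesis using ne[OF xy] ne[OF symD[OF G'(3) xy]] by (metis linorder_neqE_nat)
  qed
  show ?thesis
    unfolding colorable_def
  proof (intro exI[of _ "\<lambda>x. h (f (x, x, 0))"] conjI ballI)
    show "h (f (v, v, 0)) < card (pverts H)" if "v \<in> pverts G" for v
      using bij_betwE[OF h] fH[OF that] by auto
    fix e assume e: "e \<in> parcs G"
    obtain x y where xy: "e = (x, y)" by (cases e)
    have "x \<in> pverts G" "y \<in> pverts G" using e G'(2) xy by auto
    then show "case e of (u, v) \<Rightarrow> h (f (u, u, 0)) \<noteq> h (f (v, v, 0))"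
      using ne'[of x y] e xy fH inj_onD[OF bij_betw_imp_inj_on[OF h]] by auto
  qed
qed

lemma vwalk_arcs_nth: "Suc i < length p \<Longrightarrow> (p ! i, p ! Suc i) \<in> set (vwalk_arcs p)"
proof (induction p arbitrary: i rule: vwalk_arcs.induct)
  case (3 x y xs)
  then show ?case by (cases i) auto
qed auto

text \<open>Passes from arbitrary replacing paths to the canonical model. The parameter becomes
  \<open>p + 1\<close> because \<open>k_subdivision\<close> counts inner vertices and
  \<open>subdiv_graph\<close> the length of the paths.\<close>

lemma k_subdivision_in_class:
  assumes C: "monotone_class \<C>" "graph_class \<C>" and S: "k_subdivision p G S" "S \<in> \<C>"
  shows "in_class \<C> (subdiv_graph (p + 1) G)"
proof -
  have G: "pair_graph G" and pS: "pair_graph S" using S(1) by (auto simp: k_subdivision_def)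
  note G' = pair_graphD[OF G]
  obtain f P where f: "inj_on f (pverts G)"
    and P: "\<forall>(x, y)\<in>parcs G. vpath (P (x, y)) (with_proj S) \<and> hd (P (x, y)) = f x \<and> last (P (x, y)) = f y \<and>
           vwalk_length (P (x, y)) = p + 1 \<and> P (y, x) = rev (P (x, y)) \<and> set (P (x, y)) \<inter> f ` pverts G = {f x, f y}"
    and disj: "\<forall>(x, y)\<in>parcs G. \<forall>(x', y')\<in>parcs G. {x, y} \<noteq> {x', y'} \<longrightarrow> set (P (x, y)) \<inter> set (P (x', y')) \<subseteq> f ` pverts G"
    and S': "pverts S = f ` pverts G \<union> (\<Union>e\<in>parcs G. set (P e))"
    using S(1) unfolding k_subdivision_def by (elim conjE exE) (rule that; assumption)
  have P': "length (P (x, y)) = p + 2" "distinct (P (x, y))" "P (x, y) ! 0 = f x" "P (x, y) ! (p + 1) = f y"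
    "set (P (x, y)) \<inter> f ` pverts G = {f x, f y}" "set (vwalk_arcs (P (x, y))) \<subseteq> parcs S"
    if xy: "(x, y) \<in> parcs G" for x y
  proof -
    have Pxy: "vpath (P (x, y)) (with_proj S)" "hd (P (x, y)) = f x" "last (P (x, y)) = f y"
      "vwalk_length (P (x, y)) = p + 1" "set (P (x, y)) \<inter> f ` pverts G = {f x, f y}"
      using bspec[OF P xy] unfolding prod.case by blast+
    then show len: "length (P (x, y)) = p + 2" by (auto simp: vpath_def vwalk_def)
    then have "P (x, y) \<noteq> []" by auto
    then show "P (x, y) ! 0 = f x" "P (x, y) ! (p + 1) = f y" using Pxy len by (simp_all add: hd_conv_nth last_conv_nth)
    show "distinct (P (x, y))" "set (vwalk_arcs (P (x, y))) \<subseteq> parcs S" using Pxy(1) by (auto simp: vpath_def vwalk_def)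
    show "set (P (x, y)) \<inter> f ` pverts G = {f x, f y}" by fact
  qed
  have inner: "P (x, y) ! i \<notin> f ` pverts G" if xy: "(x, y) \<in> parcs G" and i: "0 < i" "i < p + 1" for x y i
  proof
    assume "P (x, y) ! i \<in> f ` pverts G"
    moreover have "P (x, y) ! i \<in> set (P (x, y))" using i P'(1)[OF xy] by simp
    ultimately have "P (x, y) ! i \<in> {f x, f y}"
      using P'(5)[OF xy] by blast
    then have "P (x, y) ! i = P (x, y) ! 0 \<or> P (x, y) ! i = P (x, y) ! (p + 1)"
      using P'(3,4)[OF xy] by auto
    then show False using nth_eq_iff_index_eq[OF P'(2)[OF xy]] P'(1)[OF xy] i by auto
  qed
  define g where "g = (\<lambda>(x, y, i). if i = 0 then f x else P (x, y) ! i)"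
  have g: "g (path_vertex (p + 1) x y i) = P (x, y) ! i" if "(x, y) \<in> parcs G" for x y i
    using P'(3,4)[OF that] by (auto simp: g_def path_vertex_def)
  show ?thesis
  proof (rule in_classI[OF C S(2) pair_graph_subdiv_graph[OF G]])
    show "inj_on g (pverts (subdiv_graph (p + 1) G))"
    proof (rule inj_onI)
      have main: "P (x, y) ! i = P (x', y') ! j \<Longrightarrow> (x, y, i) = (x', y', j)"
        if "(x, y) \<in> parcs G" "x < y" "0 < i" "i < p + 1" "(x', y') \<in> parcs G" "x' < y'" "0 < j" "j < p + 1" for x y i x' y' j
      proof -
        assume eq: "P (x, y) ! i = P (x', y') ! j"
        have "P (x, y) ! i \<in> set (P (x, y)) \<inter> set (P (x', y'))"
          using eq P'(1) that by (metis Int_iff add_2_eq_Suc' nth_mem Suc_eq_plus1 less_SucI)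
        then have "{x, y} = {x', y'}" using disj inner[OF that(1,3,4)] that(1,5) by blast
        then have "x = x'" "y = y'" using that(2,6) by (auto simp: doubleton_eq_iff)
        then show ?thesis using eq nth_eq_iff_index_eq[OF P'(2)[OF that(1)]] P'(1)[OF that(1)] that by auto
      qed
      fix a b assume ab: "a \<in> pverts (subdiv_graph (p + 1) G)" "b \<in> pverts (subdiv_graph (p + 1) G)" "g a = g b"
      have cs: "(\<exists>x\<in>pverts G. v = (x, x, 0)) \<or> (\<exists>x y i. v = (x, y, i) \<and> (x, y) \<in> parcs G \<and> x < y \<and> 0 < i \<and> i < p + 1)"
        if "v \<in> pverts (subdiv_graph (p + 1) G)" for v using that unfolding subdiv_graph_def by auto
      from cs[OF ab(1)] cs[OF ab(2)] show "a = b"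
      proof (elim disjE bexE exE conjE)
        fix x y assume "a = (x, x, 0)" "b = (y, y, 0)" "x \<in> pverts G" "y \<in> pverts G"
        then show ?thesis using ab(3) inj_onD[OF f] by (simp add: g_def)
      next
        fix x z y i assume *: "a = (x, x, 0)" "x \<in> pverts G" "b = (z, y, i)" "(z, y) \<in> parcs G" "0 < i" "i < p + 1"
        then have "P (z, y) ! i = f x" using ab(3) by (simp add: g_def)
        then show ?thesis using inner[OF *(4-6)] *(2) by simp
      next
        fix x z y i assume *: "b = (x, x, 0)" "x \<in> pverts G" "a = (z, y, i)" "(z, y) \<in> parcs G" "0 < i" "i < p + 1"
        then have "P (z, y) ! i = f x" using ab(3) by (simp add: g_def)
        then show ?thesis using inner[OF *(4-6)] *(2) by simp
      next
        fix x y i x' y' j assume "a = (x, y, i)" "(x, y) \<in> parcs G" "x < y" "0 < i" "i < p + 1"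
          "b = (x', y', j)" "(x', y') \<in> parcs G" "x' < y'" "0 < j" "j < p + 1"
        then show ?thesis using ab(3) main[of x y i x' y' j] by (auto simp: g_def)
      qed
    qed
    show "g ` pverts (subdiv_graph (p + 1) G) \<subseteq> pverts S"
    proof
      fix z assume "z \<in> g ` pverts (subdiv_graph (p + 1) G)"
      then consider x where "x \<in> pverts G" "z = f x"
        | x y i where "(x, y) \<in> parcs G" "i < p + 1" "z = P (x, y) ! i"
        unfolding subdiv_graph_def by (auto simp: g_def)
      then show "z \<in> pverts S"
      proof cases
        case 2
        then have "z \<in> set (P (x, y))" using P'(1)[OF 2(1)] by simp
        then show ?thesis using 2(1) unfolding S' by blast
      qed (simp add: S')
    qed
    have *: "(g a, g b) \<in> parcs S" if "(a, b) \<in> path_arcs (p + 1) (parcs G)" for a b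
      using that
    proof (rule path_arcsE)
      fix x y i assume xy: "(x, y) \<in> parcs G" "x < y" "i < p + 1" "a = path_vertex (p + 1) x y i" "b = path_vertex (p + 1) x y (Suc i)"
      have "(P (x, y) ! i, P (x, y) ! Suc i) \<in> set (vwalk_arcs (P (x, y)))"
        using P'(1)[OF xy(1)] xy(3) by (intro vwalk_arcs_nth) simp
      then show ?thesis unfolding xy(4,5) g[OF xy(1)] using P'(6)[OF xy(1)] by blast
    qed
    show "(g a, g b) \<in> parcs S" if "(a, b) \<in> parcs (subdiv_graph (p + 1) G)" for a b
    proof -
      have "(a, b) \<in> path_arcs (p + 1) (parcs G) \<or> (b, a) \<in> path_arcs (p + 1) (parcs G)"
        using that by (simp add: subdiv_graph_def)
      then show ?thesis using *[of a b] *[of b a] symD[OF pair_graphD(3)[OF pS]] by blast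
    qed
  qed
qed

text \<open>Subdividing only the first arc of every path lengthens all paths by one. This is how an
  even path length is made odd.\<close>

lemma longer_subdivision_in_class:
  assumes C: "monotone_class \<C>" "graph_class \<C>" "topologically_closed \<C>" and G: "pair_graph G"
    and S: "in_class \<C> (subdiv_graph m G)" and m: "0 < m"
  shows "in_class \<C> (subdiv_graph (Suc m) G)"
proof -
  let ?S = "subdiv_graph m G"
  note G' = pair_graphD[OF G] and S' = pair_graphD[OF pair_graph_subdiv_graph[OF G, of m]]
  obtain f where f: "inj_on f (pverts ?S)" "image_graph f ?S \<in> \<C>" using S by (auto simp: in_class_def)
  define F0 :: "((nat \<times> nat \<times> nat) \<times> (nat \<times> nat \<times> nat)) set" where "F0 = {((x, x, 0), path_vertex m x y 1) |x y. (x, y) \<in> parcs G \<and> x < y}"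
  define F where "F = map_prod f f ` F0"
  have pv0: "path_vertex m x y 0 = (x, x, 0)" for x y by (simp add: path_vertex_def)
  have F0S: "F0 \<subseteq> parcs ?S"
    using path_arcsI[of _ _ "parcs G" 0 m] m unfolding F0_def subdiv_graph_def by (auto simp: pv0)
  then have F0V: "F0 \<subseteq> pverts ?S \<times> pverts ?S" using S'(2) by auto
  have "finite F0" using F0V S'(1) by (meson finite_SigmaI finite_subset)
  then have finF: "finite F" by (simp add: F_def)
  have F0sym: "(a, b) \<in> F0 \<Longrightarrow> (b, a) \<notin> F0" for a b
    by (auto simp: F0_def path_vertex_def split: if_splits)
  have Fin: "(f a, f b) \<in> F \<longleftrightarrow> (a, b) \<in> F0" if "a \<in> pverts ?S" "b \<in> pverts ?S" for a b
    unfolding F_def by (rule map_prod_in_image_iff[OF f(1) F0V that])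
  have "F \<inter> F\<inverse> = {}"
  proof (rule ccontr)
    assume "F \<inter> F\<inverse> \<noteq> {}"
    then obtain s t where st: "(s, t) \<in> F" "(t, s) \<in> F" by auto
    obtain a b where ab: "(a, b) \<in> F0" "s = f a" "t = f b" using st(1) by (auto simp: F_def)
    then have "a \<in> pverts ?S" "b \<in> pverts ?S" using F0V by auto
    then show False using Fin[of b a] st(2) ab F0sym by auto
  qed
  moreover have "F \<subseteq> parcs (image_graph f ?S)" using F0S by (auto simp: F_def)
  ultimately obtain w where w: "inj_on w F" "w ` F \<inter> pverts (image_graph f ?S) = {}"
    "\<lparr>pverts = pverts (image_graph f ?S) \<union> w ` F, parcs = (parcs (image_graph f ?S) - (F \<union> F\<inverse>)) \<union>
      (\<Union>(u, v)\<in>F. {(u, w (u, v)), (w (u, v), u), (w (u, v), v), (v, w (u, v))})\<rparr> \<in> \<C>" (is "?T \<in> _")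
    using subdivide_arcs_in_class[OF C(2,3) f(2) finF] by blast
  define e where "e x y = (f (x, x, 0), f (path_vertex m x y 1))" for x y
  have eF: "e x y \<in> F" if "(x, y) \<in> parcs G" "x < y" for x y
    using that unfolding e_def F_def F0_def by force
  have vS: "(x, x, 0) \<in> pverts ?S" if "x \<in> pverts G" for x using that by (auto simp: subdiv_graph_def)
  have pS: "path_vertex m x y i \<in> pverts ?S" if "(x, y) \<in> parcs G" "x < y" "i \<le> m" for x y i
    using path_vertex_in[OF G that] .
  have e_inj: "x = x' \<and> y = y'" if "(x, y) \<in> parcs G" "x < y" "(x', y') \<in> parcs G" "x' < y'" "e x y = e x' y'" for x y x' y'
  proof -
    have "x \<in> pverts G" "x' \<in> pverts G" using that G'(2) by auto
    moreover have "f (x, x, 0) = f (x', x', 0)" "f (path_vertex m x y 1) = f (path_vertex m x' y' 1)"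
      using that(5) by (simp_all add: e_def)
    ultimately have "(x, x, 0) = (x', x', 0 :: nat)" using inj_onD[OF f(1)] vS by blast
    then have "x = x'" by simp
    have "1 \<le> m" using m by simp
    have "path_vertex m x y 1 = path_vertex m x' y' 1"
      by (rule inj_onD[OF f(1) \<open>f (path_vertex m x y 1) = _\<close> pS[OF that(1,2) \<open>1 \<le> m\<close>] pS[OF that(3,4) \<open>1 \<le> m\<close>]])
    with \<open>x = x'\<close> show ?thesis by (simp add: path_vertex_def split: if_splits)
  qed
  \<comment> \<open>Index \<open>1\<close> is the new vertex on the first arc, and every larger
    index \<open>i\<close> is the old vertex with index \<open>i - 1\<close>.\<close>
  define g where "g = (\<lambda>(x, y, i). if i = 0 then f (x, x, 0) else if i = 1 then w (e x y) else f (path_vertex m x y (i - 1)))"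
  have g: "g (path_vertex (Suc m) x y i) = (if i = 0 then f (x, x, 0) else if i = 1 then w (e x y) else f (path_vertex m x y (i - 1)))"
    if "i \<le> Suc m" for x y i
    using that m by (auto simp: g_def path_vertex_def)
  have pT: "pair_graph ?T" using w(3) C(2) by (simp add: graph_class_def)
  show ?thesis
  proof (rule in_classI[OF C(1,2) w(3) pair_graph_subdiv_graph[OF G]])
    have cs: "(\<exists>x\<in>pverts G. v = (x, x, 0)) \<or> (\<exists>x y. v = (x, y, 1) \<and> (x, y) \<in> parcs G \<and> x < y) \<or>
        (\<exists>x y i. v = (x, y, Suc i) \<and> (x, y) \<in> parcs G \<and> x < y \<and> 0 < i \<and> i < m)"
      if v: "v \<in> pverts (subdiv_graph (Suc m) G)" for v
    proof -
      consider x where "x \<in> pverts G" "v = (x, x, 0)"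
        | x y i where "v = (x, y, i)" "(x, y) \<in> parcs G" "x < y" "0 < i" "i < Suc m"
        using v unfolding subdiv_graph_def by auto
      then show ?thesis
      proof cases
        case 2
        then show ?thesis by (cases "i = 1"; cases i) auto
      qed auto
    qed
    have gv: "(\<exists>a\<in>pverts ?S. g v = f a \<and> v = (if snd (snd a) = 0 then a else (fst a, fst (snd a), Suc (snd (snd a))))) \<or>
        (\<exists>x y. v = (x, y, 1) \<and> (x, y) \<in> parcs G \<and> x < y \<and> g v = w (e x y))"
      if v: "v \<in> pverts (subdiv_graph (Suc m) G)" for v
      using cs[OF v]
    proof (elim disjE bexE exE conjE)
      fix x assume "v = (x, x, 0)" "x \<in> pverts G"
      then show ?thesis using vS[of x] by (intro disjI1 bexI[of _ "(x, x, 0)"]) (auto simp: g_def)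
    next
      fix x y assume "v = (x, y, 1)" "(x, y) \<in> parcs G" "x < y"
      then show ?thesis by (intro disjI2) (simp add: g_def)
    next
      fix x y i assume "v = (x, y, Suc i)" "(x, y) \<in> parcs G" "x < y" "0 < i" "i < m"
      then show ?thesis using pS[of x y i]
        by (intro disjI1 bexI[of _ "(x, y, i)"]) (auto simp: g_def path_vertex_def)
    qed
    have wout: "w (e x y) \<noteq> f a" if "(x, y) \<in> parcs G" "x < y" "a \<in> pverts ?S" for x y a
      using w(2) eF[OF that(1,2)] that(3) by (force simp: disjoint_iff)
    show "inj_on g (pverts (subdiv_graph (Suc m) G))"
    proof (rule inj_onI)
      fix u v assume uv: "u \<in> pverts (subdiv_graph (Suc m) G)" "v \<in> pverts (subdiv_graph (Suc m) G)" "g u = g v"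
      from gv[OF uv(1)] gv[OF uv(2)] show "u = v"
      proof (elim disjE)
        assume "\<exists>a\<in>pverts ?S. g u = f a \<and> u = (if snd (snd a) = 0 then a else (fst a, fst (snd a), Suc (snd (snd a))))"
          "\<exists>a\<in>pverts ?S. g v = f a \<and> v = (if snd (snd a) = 0 then a else (fst a, fst (snd a), Suc (snd (snd a))))"
        then show ?thesis using uv(3) inj_onD[OF f(1)] by metis
      next
        assume "\<exists>x y. u = (x, y, 1) \<and> (x, y) \<in> parcs G \<and> x < y \<and> g u = w (e x y)"
          "\<exists>x y. v = (x, y, 1) \<and> (x, y) \<in> parcs G \<and> x < y \<and> g v = w (e x y)"
        then obtain x y x' y' where xy: "u = (x, y, 1)" "(x, y) \<in> parcs G" "x < y" "g u = w (e x y)"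
          "v = (x', y', 1)" "(x', y') \<in> parcs G" "x' < y'" "g v = w (e x' y')" by auto
        then have "e x y = e x' y'" using uv(3) inj_onD[OF w(1) _ eF eF] by auto
        then show ?thesis using e_inj[OF xy(2,3,6,7)] xy(1,5) by simp
      qed (use uv(3) wout in metis)+
    qed
    show "g ` pverts (subdiv_graph (Suc m) G) \<subseteq> pverts ?T"
    proof
      fix z assume "z \<in> g ` pverts (subdiv_graph (Suc m) G)"
      then obtain v where v: "v \<in> pverts (subdiv_graph (Suc m) G)" "z = g v" by auto
      from gv[OF v(1)] show "z \<in> pverts ?T" unfolding v(2) using eF by auto
    qed
    have new: "(a, w (a, b)) \<in> parcs ?T" "(w (a, b), b) \<in> parcs ?T" if "(a, b) \<in> F" for a b
      using that by (simp_all, (intro disjI2 bexI[of _ "(a, b)"]; simp)+)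
    have *: "(g a, g b) \<in> parcs ?T" if "(a, b) \<in> path_arcs (Suc m) (parcs G)" for a b
      using that
    proof (rule path_arcsE)
      fix x y i assume xy: "(x, y) \<in> parcs G" "x < y" "i < Suc m" "a = path_vertex (Suc m) x y i" "b = path_vertex (Suc m) x y (Suc i)"
      have ga: "g a = (if i = 0 then f (x, x, 0) else if i = 1 then w (e x y) else f (path_vertex m x y (i - 1)))"
        unfolding xy(4) using xy(3) by (intro g) simp
      have gb: "g b = (if i = 0 then w (e x y) else f (path_vertex m x y i))"
        unfolding xy(5) using xy(3) g[of "Suc i"] by simp
      consider "i = 0" | "i = 1" | "2 \<le> i" by linarith
      then show "(g a, g b) \<in> parcs ?T"
      proof cases
        case 1
        then show ?thesis using new(1)[OF eF[OF xy(1,2), unfolded e_def]] ga gb by (simp add: e_def)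
      next
        case 2
        then show ?thesis using new(2)[OF eF[OF xy(1,2), unfolded e_def]] ga gb by (simp add: e_def)
      next
        case 3
        let ?a = "path_vertex m x y (i - 1)" and ?b = "path_vertex m x y i"
        have "(?a, ?b) \<in> path_arcs m (parcs G)" using path_arcsI[OF xy(1,2), of "i - 1" m] 3 xy(3) by simp
        then have arc: "(?a, ?b) \<in> parcs ?S" by (simp add: subdiv_graph_def)
        have "(?a, ?b) \<notin> F0" "(?b, ?a) \<notin> F0"
          using 3 xy(2,3) by (auto simp: F0_def path_vertex_def split: if_splits)
        moreover have "?a \<in> pverts ?S" "?b \<in> pverts ?S" using pS[OF xy(1,2)] xy(3) by auto
        ultimately have "(f ?a, f ?b) \<notin> F" "(f ?b, f ?a) \<notin> F" using Fin by auto
        then show ?thesis using arc 3 ga gb by auto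
      qed
    qed
    show "(g a, g b) \<in> parcs ?T" if "(a, b) \<in> parcs (subdiv_graph (Suc m) G)" for a b
    proof -
      have "(a, b) \<in> path_arcs (Suc m) (parcs G) \<or> (b, a) \<in> path_arcs (Suc m) (parcs G)"
        using that by (simp add: subdiv_graph_def)
      then show ?thesis
      proof
        assume "(b, a) \<in> path_arcs (Suc m) (parcs G)"
        then have "(g b, g a) \<in> parcs ?T" by (rule *)
        then show ?thesis by (rule symD[OF pair_graphD(3)[OF pT]])
      qed (rule *)
    qed
  qed
qed

lemma addable_copies_in_class:
  assumes C: "monotone_class \<C>" "graph_class \<C>" "addable \<C>" and X: "pair_graph X" "in_class \<C> X"
  shows "in_class \<C> (copies M X)"
proof (induction M)
  case 0
  note X' = pair_graphD[OF X(1)]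
  have "pair_graph (copies 0 X)"
    unfolding piece_graph_def using X' by (intro pair_graphI) (auto simp: sym_def irrefl_def)
  then show ?case
    by (rule in_class_mono[OF C(1,2) X(2), of _ snd]) (auto simp: piece_graph_def inj_on_def)
next
  case (Suc M)
  let ?Y = "\<lambda>M. copies M X"
  note X' = pair_graphD[OF X(1)]
  obtain f where f: "inj_on f (pverts (?Y M))" "image_graph f (?Y M) \<in> \<C>" using Suc by (auto simp: in_class_def)
  obtain g where g: "inj_on g (pverts X)" "image_graph g X \<in> \<C>" using X(2) by (auto simp: in_class_def)
  \<comment> \<open>\<open>addable\<close> asks for disjoint vertex sets, so the previous copies
    move to even numbers and the additional copy to odd ones.\<close>
  define h where "h = (\<lambda>(k, x). if k = Suc M then 2 * g x + 1 else 2 * f (k, x))"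
  have f2: "image_graph (\<lambda>n. 2 * n) (image_graph f (?Y M)) \<in> \<C>"
    by (rule graph_class_image[OF C(2) f(2)]) (simp add: inj_on_def)
  have g2: "image_graph (\<lambda>n. 2 * n + 1) (image_graph g X) \<in> \<C>"
    by (rule graph_class_image[OF C(2) g(2)]) (simp add: inj_on_def)
  have "\<lparr>pverts = pverts (image_graph (\<lambda>n. 2 * n) (image_graph f (?Y M))) \<union> pverts (image_graph (\<lambda>n. 2 * n + 1) (image_graph g X)),
    parcs = parcs (image_graph (\<lambda>n. 2 * n) (image_graph f (?Y M))) \<union> parcs (image_graph (\<lambda>n. 2 * n + 1) (image_graph g X))\<rparr> \<in> \<C>"
    (is "?U \<in> _")
    using C(3) f2 g2 unfolding addable_def
    by (elim ballE[of _ _ "image_graph (\<lambda>n. 2 * n) (image_graph f (?Y M))"] ballE[of _ _ "image_graph (\<lambda>n. 2 * n + 1) (image_graph g X)"])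
      (auto, presburger+)
  moreover have "pair_graph (?Y (Suc M))"
    unfolding piece_graph_def using X' by (intro pair_graphI) (auto simp: sym_def irrefl_def)
  moreover have "inj_on h (pverts (?Y (Suc M)))"
  proof (rule inj_onI)
    fix a b assume ab: "a \<in> pverts (?Y (Suc M))" "b \<in> pverts (?Y (Suc M))" "h a = h b"
    obtain k x l y where kl: "a = (k, x)" "b = (l, y)" by (cases a; cases b)
    have xy: "x \<in> pverts X" "y \<in> pverts X" "k \<le> Suc M" "l \<le> Suc M" using ab kl by (auto simp: piece_graph_def)
    have par: "2 * c + 1 \<noteq> 2 * d" "2 * d \<noteq> 2 * c + 1" for c d :: nat by presburger+
    show "a = b"
    proof (cases "k = Suc M"; cases "l = Suc M")
      assume "k = Suc M" "l = Suc M"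
      then show ?thesis using ab(3) kl xy inj_onD[OF g(1)] by (simp add: h_def)
    next
      assume "k \<noteq> Suc M" "l \<noteq> Suc M"
      then have "(k, x) \<in> pverts (?Y M)" "(l, y) \<in> pverts (?Y M)" "f (k, x) = f (l, y)" using ab(3) kl xy by (auto simp: h_def piece_graph_def)
      then show ?thesis using inj_onD[OF f(1)] kl by blast
    qed (use ab(3) kl par in \<open>auto simp: h_def\<close>)
  qed
  moreover have "h ` pverts (?Y (Suc M)) \<subseteq> pverts ?U"
  proof
    fix z assume "z \<in> h ` pverts (?Y (Suc M))"
    then obtain k x where kx: "k \<le> Suc M" "x \<in> pverts X" "z = h (k, x)" by (auto simp: piece_graph_def)
    show "z \<in> pverts ?U"
    proof (cases "k = Suc M")
      case False
      then have "(k, x) \<in> pverts (?Y M)" using kx by (auto simp: piece_graph_def)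
      then have "2 * f (k, x) \<in> (\<lambda>n. 2 * n) ` f ` pverts (?Y M)" by blast
      then show ?thesis using False kx(3) by (simp add: h_def)
    qed (use kx in \<open>simp add: h_def\<close>)
  qed
  moreover have "(h a, h b) \<in> parcs ?U" if arc: "(a, b) \<in> parcs (?Y (Suc M))" for a b
  proof -
    obtain k x y where k: "k \<le> Suc M" "(x, y) \<in> parcs X" "x \<in> pverts X" "y \<in> pverts X" "a = (k, x)" "b = (k, y)"
      using arc X'(2) by (auto simp: piece_graph_def)
    show ?thesis
    proof (cases "k = Suc M")
      case True
      have "map_prod (\<lambda>n. 2 * n + 1) (\<lambda>n. 2 * n + 1) (map_prod g g (x, y)) \<in> parcs (image_graph (\<lambda>n. 2 * n + 1) (image_graph g X))"
        unfolding image_graph_simps using k(2) by (intro imageI)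
      then show ?thesis using True k(5,6) by (simp add: h_def)
    next
      case False
      then have "((k, x), (k, y)) \<in> parcs (?Y M)" using k by (auto simp: piece_graph_def)
      then have "map_prod (\<lambda>n. 2 * n) (\<lambda>n. 2 * n) (map_prod f f ((k, x), (k, y))) \<in> parcs (image_graph (\<lambda>n. 2 * n) (image_graph f (?Y M)))"
        unfolding image_graph_simps by (intro imageI)
      then show ?thesis using False k(5,6) by (simp add: h_def)
    qed
  qed
  ultimately show ?case by (intro in_classI[OF C(1,2)])
qed

text \<open>Copies of a subdivision form the subdivision of the copies. If the class contains all
  \<open>m\<close>-fold subdivisions, disjoint unions thus come without addability.\<close>

lemma subdivision_copies_in_class:
  assumes C: "monotone_class \<C>" "graph_class \<C>" and all: "\<And>G. pair_graph G \<Longrightarrow> in_class \<C> (subdiv_graph m G)"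
    and G: "pair_graph G"
  shows "in_class \<C> (copies M (subdiv_graph m G))"
proof -
  note G' = pair_graphD[OF G]
  obtain N where N: "\<And>x. x \<in> pverts G \<Longrightarrow> x < N" using G'(1) by (metis finite_nat_set_iff_bounded)
  \<comment> \<open>Besides being injective, the encoding is increasing in \<open>x\<close> within
    each copy. \<open>subdiv_graph\<close> orients the paths by the order of their ends, so this
    keeps the names of inner vertices compatible.\<close>
  define e where "e k x = k * N + x" for k x :: nat
  have e_inj: "k = l \<and> x = y" if "e k x = e l y" "x < N" "y < N" for k l x y
  proof -
    have "(k * N + x) div N = k" "(l * N + y) div N = l" using that(2,3) by auto
    then have "k = l" using that(1) unfolding e_def by metis
    then show ?thesis using that(1) by (simp add: e_def)
  qed
  let ?Y = "copies M G" and ?S = "subdiv_graph m G"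
  let ?G = "image_graph (\<lambda>(k, x). e k x) ?Y"
  have "pair_graph ?Y"
    unfolding piece_graph_def using G' by (intro pair_graphI) (auto simp: sym_def irrefl_def)
  moreover have "inj_on (\<lambda>(k, x). e k x) (pverts ?Y)"
  proof (rule inj_onI)
    fix a b assume ab: "a \<in> pverts ?Y" "b \<in> pverts ?Y" "(case a of (k, x) \<Rightarrow> e k x) = (case b of (k, x) \<Rightarrow> e k x)"
    obtain k x l y where kl: "a = (k, x)" "b = (l, y)" by (cases a; cases b)
    have "x < N" "y < N" using ab(1,2) N by (auto simp: kl piece_graph_def)
    then show "a = b" using e_inj[of k x l y] ab(3) kl by simp
  qed
  ultimately have pG: "pair_graph ?G" by (rule image_pair_graph)
  define h where "h = (\<lambda>(k, x, y, i). (e k x, e k y, i :: nat))"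
  have arc: "(e k x, e k y) \<in> parcs ?G" if "k \<le> M" "(x, y) \<in> parcs G" for k x y
    using that G'(2) by (force simp: piece_graph_def)
  note S' = pair_graphD[OF pair_graph_subdiv_graph[OF G, of m]]
  have pS: "pair_graph (copies M ?S)"
    unfolding piece_graph_def using S' by (intro pair_graphI) (auto simp: sym_def irrefl_def)
  show ?thesis
  proof (rule in_class_mono[OF C all[OF pG] pS, of h])
    have lt: "x < N \<and> y < N" if "(x, y, i) \<in> pverts ?S" for x y i
    proof -
      have "x \<in> pverts G \<and> y \<in> pverts G" using that subsetD[OF G'(2)] by (auto simp: subdiv_graph_def)
      then show ?thesis using N by blast
    qed
    show "inj_on h (pverts (copies M ?S))"
    proof (rule inj_onI)
      fix a b assume ab: "a \<in> pverts (copies M ?S)"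
        "b \<in> pverts (copies M ?S)" "h a = h b"
      obtain k x y i l x' y' j where kl: "a = (k, x, y, i)" "b = (l, x', y', j)"
        by (metis prod_cases4)
      have "e k x = e l x'" "e k y = e l y'" "i = j" using ab(3) by (simp_all add: kl h_def)
      moreover have "x < N" "y < N" "x' < N" "y' < N" using ab(1,2) lt by (auto simp: kl piece_graph_def)
      ultimately show "a = b" using e_inj[of k x l x'] e_inj[of k y l y'] kl by blast
    qed
    show "h ` pverts (copies M ?S) \<subseteq> pverts (subdiv_graph m ?G)"
    proof
      fix z assume "z \<in> h ` pverts (copies M ?S)"
      then obtain k v where kv: "k \<le> M" "v \<in> pverts ?S" "z = h (k, v)" by (auto simp: piece_graph_def)
      then consider x where "x \<in> pverts G" "z = (e k x, e k x, 0)"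
        | x y i where "(x, y) \<in> parcs G" "x < y" "0 < i" "i < m" "z = (e k x, e k y, i)"
        by (auto simp: subdiv_graph_def h_def)
      then show "z \<in> pverts (subdiv_graph m ?G)"
      proof cases
        case 1
        then have "e k x \<in> pverts ?G" using kv(1) by (force simp: piece_graph_def)
        then show ?thesis using 1(2) by (auto simp: subdiv_graph_def)
      next
        case 2
        have "e k x < e k y" using 2(2) by (simp add: e_def)
        then show ?thesis using arc[OF kv(1) 2(1)] 2(3-5) by (auto simp: subdiv_graph_def)
      qed
    qed
    have hp: "h (k, path_vertex m x y i) = path_vertex m (e k x) (e k y) i" for k x y i
      by (simp add: h_def path_vertex_def)
    have *: "(h (k, a), h (k, b)) \<in> path_arcs m (parcs ?G)" if "k \<le> M" "(a, b) \<in> path_arcs m (parcs G)" for k a b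
      using that(2)
    proof (rule path_arcsE)
      fix x y i assume xy: "(x, y) \<in> parcs G" "x < y" "i < m" "a = path_vertex m x y i" "b = path_vertex m x y (Suc i)"
      have "e k x < e k y" using xy(2) by (simp add: e_def)
      then show ?thesis unfolding xy(4,5) hp by (intro path_arcsI arc[OF that(1) xy(1)] xy(3))
    qed
    show "(h a, h b) \<in> parcs (subdiv_graph m ?G)"
      if ab: "(a, b) \<in> parcs (copies M ?S)" for a b
    proof -
      obtain k s t where k: "k \<le> M" "(s, t) \<in> parcs ?S" "a = (k, s)" "b = (k, t)" using ab by (auto simp: piece_graph_def)
      from k(2) have "(s, t) \<in> path_arcs m (parcs G) \<or> (t, s) \<in> path_arcs m (parcs G)" by (auto simp: subdiv_graph_def)
      then show ?thesis unfolding k(3,4) using *[OF k(1), of s t] *[OF k(1), of t s] by (auto simp: subdiv_graph_def simp del: image_graph_simps)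
    qed
  qed
qed

section \<open>Shift graphs\<close>

definition increasing_lists :: "nat \<Rightarrow> nat \<Rightarrow> nat list set" where
  "increasing_lists k n = {xs. length xs = k \<and> sorted_wrt (<) xs \<and> set xs \<subseteq> {..<n}}"

text \<open>A \<open>c\<close>-colouring of the \<open>(k + 1)\<close>-tuples yields a \<open>2 ^ c\<close>-colouring of the \<open>k\<close>-tuples: record the colours of
  all extensions by a larger last entry.\<close>

lemma shift_coloring:
  "\<exists>n. \<forall>col :: nat list \<Rightarrow> nat. (\<forall>xs\<in>increasing_lists (Suc k) n. col xs < c) \<longrightarrow>
    (\<exists>z\<in>increasing_lists (Suc (Suc k)) n. col (tl z) = col (butlast z))"
proof (induction k arbitrary: c)
  case 0
  show ?case
  proof (intro exI[of _ "Suc c"] allI impI)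
    fix col :: "nat list \<Rightarrow> nat" assume col: "\<forall>xs\<in>increasing_lists (Suc 0) (Suc c). col xs < c"
    then have "(\<lambda>a. col [a]) ` {..<Suc c} \<subseteq> {..<c}" by (auto simp: increasing_lists_def)
    then have "card ((\<lambda>a. col [a]) ` {..<Suc c}) < card {..<Suc c}"
      using card_mono[of "{..<c}" "(\<lambda>a. col [a]) ` {..<Suc c}"] by simp
    then have "\<not> inj_on (\<lambda>a. col [a]) {..<Suc c}" by (rule pigeonhole)
    then obtain a b where ab: "a < Suc c" "b < Suc c" "a < b" "col [a] = col [b]"
      unfolding inj_on_def by (metis lessThan_iff linorder_neqE_nat)
    then show "\<exists>z\<in>increasing_lists (Suc (Suc 0)) (Suc c). col (tl z) = col (butlast z)"
      by (intro bexI[of _ "[a, b]"]) (auto simp: increasing_lists_def)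
  qed
next
  case (Suc k)
  obtain n where n: "\<forall>col :: nat list \<Rightarrow> nat. (\<forall>xs\<in>increasing_lists (Suc k) n. col xs < 2 ^ c) \<longrightarrow>
    (\<exists>z\<in>increasing_lists (Suc (Suc k)) n. col (tl z) = col (butlast z))" using Suc[of "2 ^ c"] by auto
  show ?case
  proof (intro exI[of _ n] allI impI)
    fix col :: "nat list \<Rightarrow> nat" assume col: "\<forall>xs\<in>increasing_lists (Suc (Suc k)) n. col xs < c"
    define ext where "ext xs = {col (xs @ [y]) |y. xs @ [y] \<in> increasing_lists (Suc (Suc k)) n}" for xs
    obtain h where h: "bij_betw h (Pow {..<c}) {0..<card (Pow {..<c})}"
      using ex_bij_betw_finite_nat[of "Pow {..<c}"] by auto
    have ext: "ext xs \<in> Pow {..<c}" for xs using col by (auto simp: ext_def)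
    have "h (ext xs) < 2 ^ c" for xs using bij_betwE[OF h] ext[of xs] by (auto simp: card_Pow)
    then obtain z where z: "z \<in> increasing_lists (Suc (Suc k)) n" "h (ext (tl z)) = h (ext (butlast z))"
      using n[rule_format, of "\<lambda>xs. h (ext xs)"] by auto
    have eq: "ext (tl z) = ext (butlast z)" using inj_onD[OF bij_betw_imp_inj_on[OF h] z(2)] ext by blast
    have len: "length z = Suc (Suc k)" using z(1) by (simp add: increasing_lists_def)
    then have "z \<noteq> []" by auto
    then have "butlast z @ [last z] = z" by simp
    \<comment> \<open>\<open>z\<close> extends \<open>butlast z\<close> by its last entry. Since
      \<open>tl z\<close> has the same set of extension colours, some \<open>tl z @ [y]\<close> has
      the colour of \<open>z\<close>, and \<open>z @ [y]\<close> is the required longer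
      tuple.\<close>
    then have "col z \<in> ext (butlast z)" unfolding ext_def using z(1) by (auto intro!: exI[of _ "last z"])
    then have "col z \<in> ext (tl z)" by (simp only: eq)
    then obtain y where y: "col z = col (tl z @ [y])" "tl z @ [y] \<in> increasing_lists (Suc (Suc k)) n"
      unfolding ext_def by blast
    obtain a b zs where abz: "z = a # b # zs" using len by (cases z; cases "tl z") auto
    have "z @ [y] \<in> increasing_lists (Suc (Suc (Suc k))) n"
      using z(1) y(2) unfolding abz by (auto simp: increasing_lists_def sorted_wrt_append)
    then show "\<exists>z\<in>increasing_lists (Suc (Suc (Suc k))) n. col (tl z) = col (butlast z)"
      using y(1) \<open>z \<noteq> []\<close> by (intro bexI[of _ "z @ [y]"]) auto
  qed
qed

definition shift_arcs :: "nat \<Rightarrow> nat \<Rightarrow> (nat list \<times> nat list) set" where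
  "shift_arcs k n = {(xs, ys). xs \<in> increasing_lists k n \<and> ys \<in> increasing_lists k n \<and> (tl xs = butlast ys \<or> tl ys = butlast xs)}"

text \<open>Along a walk that is short compared to \<open>k\<close>, a middle entry is only shifted to another position, by an odd
  distance if the length of the walk is odd.\<close>

lemma short_odd_free_shift_arcs: "short_odd_free L (shift_arcs (2 * L + 1) n)"
  unfolding short_odd_free_def
proof (intro allI impI notI)
  let ?k = "2 * L + 1"
  have inc: "xs ! i < xs ! j" if "xs \<in> increasing_lists ?k n" "i < j" "j < ?k" for xs i j
    using that by (auto simp: increasing_lists_def sorted_wrt_iff_nth_less)
  \<comment> \<open>\<open>h\<close> is the net shift after \<open>m\<close> steps. Only positions
    at distance at least \<open>m\<close> from both ends are followed, since their entries cannot
    have been pushed off the list.\<close>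
  have key: "\<exists>h :: int. \<bar>h\<bar> \<le> int m \<and> even (h - int m) \<and>
      (\<forall>i. m \<le> i \<and> i + m < ?k \<longrightarrow> xs ! i = ys ! nat (int i - h))"
    if "(xs, ys) \<in> shift_arcs ?k n ^^ m" for m xs ys
    using that
  proof (induction m arbitrary: ys)
    case 0
    then show ?case by (intro exI[of _ 0]) simp
  next
    case (Suc m)
    then obtain zs where zs: "(xs, zs) \<in> shift_arcs ?k n ^^ m" "(zs, ys) \<in> shift_arcs ?k n" by auto
    then obtain h :: int where h: "\<bar>h\<bar> \<le> int m" "even (h - int m)"
      "\<And>i. m \<le> i \<Longrightarrow> i + m < ?k \<Longrightarrow> xs ! i = zs ! nat (int i - h)" using Suc.IH by blast
    have len: "length zs = ?k" "length ys = ?k" using zs(2) by (auto simp: shift_arcs_def increasing_lists_def)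
    have "tl zs = butlast ys \<or> tl ys = butlast zs" using zs(2) by (auto simp: shift_arcs_def)
    then show ?case
    proof
      assume eq: "tl zs = butlast ys"
      have sh: "zs ! Suc j = ys ! j" if "Suc j < ?k" for j
        using arg_cong[OF eq, of "\<lambda>l. l ! j"] that len by (simp add: nth_tl nth_butlast)
      have "xs ! i = ys ! nat (int i - (h + 1))" if "Suc m \<le> i" "i + Suc m < ?k" for i
      proof -
        have "nat (int i - h) = Suc (nat (int i - (h + 1)))" "nat (int i - h) < ?k" using h(1) that by linarith+
        then show ?thesis using h(3)[of i] sh that by simp
      qed
      then show ?thesis using h(1,2) by (intro exI[of _ "h + 1"]) auto
    next
      assume eq: "tl ys = butlast zs"
      have sh: "ys ! Suc j = zs ! j" if "Suc j < ?k" for j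
        using arg_cong[OF eq, of "\<lambda>l. l ! j"] that len by (simp add: nth_tl nth_butlast)
      have "xs ! i = ys ! nat (int i - (h - 1))" if "Suc m \<le> i" "i + Suc m < ?k" for i
      proof -
        have "nat (int i - (h - 1)) = Suc (nat (int i - h))" "nat (int i - (h - 1)) < ?k" using h(1) that by linarith+
        then show ?thesis using h(3)[of i] sh that by simp
      qed
      then show ?thesis using h(1,2) by (intro exI[of _ "h - 1"]) auto
    qed
  qed
  fix m xs assume m: "m \<le> L" "odd m" "(xs, xs) \<in> shift_arcs ?k n ^^ m"
  obtain h :: int where h: "\<bar>h\<bar> \<le> int m" "even (h - int m)"
    "\<forall>i. m \<le> i \<and> i + m < ?k \<longrightarrow> xs ! i = xs ! nat (int i - h)" using key[OF m(3)] by blast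
  have xs: "xs \<in> increasing_lists ?k n" using m(2,3) by (cases m) (auto simp: shift_arcs_def)
  \<comment> \<open>The middle position \<open>L\<close> is still safe after
    \<open>m \<le> L\<close> steps. As \<open>h\<close> is odd, its entry would occur again at
    another position of a strictly increasing list.\<close>
  have "xs ! L = xs ! nat (int L - h)" using h(3) m(1) by simp
  moreover have "h \<noteq> 0" using h(2) m(2) by auto
  moreover have "nat (int L - h) < ?k" using h(1) m(1) by linarith
  moreover from \<open>h \<noteq> 0\<close> have "nat (int L - h) < L \<or> L < nat (int L - h)" using h(1) m(1) by linarith
  ultimately show False
    using inc[OF xs, of L "nat (int L - h)"] inc[OF xs, of "nat (int L - h)" L] by auto
qed

lemma ex_short_odd_free_uncolorable:
  "\<exists>G :: nat pair_pre_digraph. pair_graph G \<and> short_odd_free L (parcs G) \<and> \<not> colorable c G"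
proof -
  \<comment> \<open>One more than \<open>L\<close>, so that the case of length \<open>1\<close> is
    covered even for \<open>L = 0\<close> and loops are excluded.\<close>
  define K where "K = Suc L"
  let ?k = "2 * K + 1"
  obtain n where n: "\<forall>col :: nat list \<Rightarrow> nat. (\<forall>xs\<in>increasing_lists ?k n. col xs < c) \<longrightarrow>
    (\<exists>z\<in>increasing_lists (Suc ?k) n. col (tl z) = col (butlast z))" using shift_coloring[of "2 * K" c] by auto
  let ?V = "increasing_lists ?k n" and ?E = "shift_arcs ?k n"
  have free: "short_odd_free K ?E" by (rule short_odd_free_shift_arcs)
  have fin: "finite ?V"
    unfolding increasing_lists_def using finite_lists_length_eq[of "{..<n}" ?k] by (rule rev_finite_subset) auto
  have pg: "pair_graph \<lparr>pverts = ?V, parcs = ?E\<rparr>"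
  proof (rule pair_graphI[OF fin])
    show "irrefl ?E" using free[unfolded short_odd_free_def, rule_format, of 1] by (simp add: K_def irrefl_def)
  qed (auto simp: shift_arcs_def sym_def)
  obtain h :: "nat list \<Rightarrow> nat" where h: "inj_on h ?V" using finite_imp_inj_to_nat_seg[OF fin] by auto
  let ?G = "image_graph h \<lparr>pverts = ?V, parcs = ?E\<rparr>"
  have "pair_graph ?G" using h by (intro image_pair_graph[OF pg]) simp
  moreover have "short_odd_free L (parcs ?G)"
  proof (rule short_odd_free_map[of _ ?E _ "inv_into ?V h"])
    show "short_odd_free L ?E" using free by (auto simp: short_odd_free_def K_def)
    show "(inv_into ?V h a, inv_into ?V h b) \<in> ?E" if "(a, b) \<in> parcs ?G" for a b
      using that h by (auto simp: shift_arcs_def)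
  qed
  moreover have False if col: "\<forall>v\<in>pverts ?G. col v < c" "\<forall>(u, v)\<in>parcs ?G. col u \<noteq> col v" for col :: "nat \<Rightarrow> nat"
  proof -
    obtain z where z: "z \<in> increasing_lists (Suc ?k) n" "col (h (tl z)) = col (h (butlast z))"
      using n[rule_format, of "\<lambda>xs. col (h xs)"] col(1) by auto
    then have "length z = Suc ?k" by (simp add: increasing_lists_def)
    moreover have "set (tl z) \<subseteq> set z" "set (butlast z) \<subseteq> set z"
      by (cases z; simp) (auto dest: in_set_butlastD)
    ultimately have "tl z \<in> ?V" "butlast z \<in> ?V"
      using z(1) by (auto simp: increasing_lists_def sorted_wrt_iff_nth_less nth_tl nth_butlast)
    then have "(butlast z, tl z) \<in> ?E" by (auto simp: shift_arcs_def butlast_tl)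
    then have "(h (butlast z), h (tl z)) \<in> parcs ?G" by (force simp: image_graph_def)
    then show False using col(2) z(2) by fastforce
  qed
  ultimately show ?thesis unfolding colorable_def by blast
qed

section \<open>Undefinability\<close>

lemma large_odd_girth_not_definable:
  assumes C: "monotone_class \<C>" "graph_class \<C>" and "fo_definable_large_odd_girth \<C>" and m: "odd m"
    and G: "\<And>c L. \<exists>G :: nat pair_pre_digraph. pair_graph G \<and> short_odd_free L (parcs G) \<and>
      \<not> colorable c G \<and> (\<forall>M. in_class \<C> (copies M (subdiv_graph m G)))"
  shows False
proof -
  \<comment> \<open>Taking \<open>p = m\<close> puts the odd girth of \<open>H\<close> beyond the
    path length, so \<open>H\<close> has no closed walk of length \<open>m\<close>.\<close>
  obtain H :: "nat pair_pre_digraph" where H: "pair_graph H" "\<not> bipartite H" "odd_girth H > enat (2 * m + 1)" "coloring_fo_definable H \<C>"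
    using assms(3) unfolding fo_definable_large_odd_girth_def by blast
  obtain \<Phi> where \<Phi>: "sentence \<Phi>" "\<forall>G\<in>\<C>. fo_models G \<Phi> \<longleftrightarrow> graph_hom G H"
    using H(4) unfolding coloring_fo_definable_def by blast
  \<comment> \<open>Being non-bipartite, \<open>H\<close> has an edge, which is the target for all
    the bipartite balls.\<close>
  have "parcs H \<noteq> {}"
  proof
    assume "parcs H = {}"
    then have "bipartite H" unfolding bipartite_def by (intro exI[of _ "pverts H"] exI[of _ "{}"]) auto
    then show False using H(2) by simp
  qed
  then obtain h0 h1 where h: "(h0, h1) \<in> parcs H" by auto
  obtain G :: "nat pair_pre_digraph" where G: "pair_graph G" "short_odd_free (2 * 2 ^ quantifier_rank \<Phi> + 1) (parcs G)"
    "\<not> colorable (card (pverts H)) G"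
    "\<And>M. in_class \<C> (copies M (subdiv_graph m G))"
    using G[of "2 * 2 ^ quantifier_rank \<Phi> + 1" "card (pverts H)"] by blast
  have "\<not> graph_hom (subdiv_graph m G) H"
    using graph_hom_subdiv_graph[OF G(1) H(1) odd_girth_short_odd_free[OF H(1,3)] m] G(3) by auto
  then show False
    using pieces_not_definable[OF C _ G(4) \<Phi> h H(1) short_odd_free_subdiv_graph[OF G(1,2) m]]
      pair_graph_subdiv_graph[OF G(1), of m] by simp
qed

lemma somewhere_dense_not_definable:
  assumes C: "graph_class \<C>" "hereditary \<C>" "topologically_closed \<C>" and sd: "somewhere_dense \<C>"
  shows "\<not> fo_definable_large_odd_girth \<C>"
proof
  assume def: "fo_definable_large_odd_girth \<C>"
  have mono: "monotone_class \<C>" using hereditary_topologically_closed_monotone[OF C] .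
  obtain p where p: "\<And>H :: nat pair_pre_digraph. pair_graph H \<Longrightarrow> \<exists>G\<in>\<C>. \<exists>S. k_subdivision p H S \<and> subgraph (with_proj S) (with_proj G)"
    using sd unfolding somewhere_dense_def by blast
  have 1: "in_class \<C> (subdiv_graph (p + 1) H)" if H: "pair_graph H" for H
  proof -
    obtain G S where S: "G \<in> \<C>" "k_subdivision p H S" "subgraph (with_proj S) (with_proj G)" using p[OF H] by blast
    then have "pair_graph S" by (simp add: k_subdivision_def)
    then have "S \<in> \<C>" using mono S unfolding monotone_class_def by blast
    then show ?thesis using k_subdivision_in_class[OF mono C(1) S(2)] by simp
  qed
  \<comment> \<open>A \<open>p\<close>-subdivision has paths of length \<open>p + 1\<close>; if this
    is even, one more subdivision step makes it odd.\<close>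
  define m where "m = (if even p then p + 1 else Suc (p + 1))"
  have m: "odd m" by (simp add: m_def)
  have all: "in_class \<C> (subdiv_graph m H)" if H: "pair_graph H" for H
    using 1[OF H] longer_subdivision_in_class[OF mono C(1,3) H 1[OF H]] by (simp add: m_def)
  show False
  proof (rule large_odd_girth_not_definable[OF mono C(1) def m])
    fix c L :: nat
    obtain G :: "nat pair_pre_digraph" where G: "pair_graph G" "short_odd_free L (parcs G)" "\<not> colorable c G"
      using ex_short_odd_free_uncolorable[of L c] by blast
    show "\<exists>G :: nat pair_pre_digraph. pair_graph G \<and> short_odd_free L (parcs G) \<and>
      \<not> colorable c G \<and> (\<forall>M. in_class \<C> (copies M (subdiv_graph m G)))"
      using G subdivision_copies_in_class[OF mono C(1) all G(1)] by (intro exI[of _ G] conjI allI)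
  qed
qed

text \<open>Here only particular subdivisions are known to lie in the class, not those of all
  graphs, so addability has to supply the disjoint copies.\<close>

lemma large_subdivisions_not_definable:
  assumes C: "graph_class \<C>" "hereditary \<C>" "addable \<C>" "topologically_closed \<C>"
    and sub: "\<forall>c g :: nat. \<exists>(G :: nat pair_pre_digraph) (S :: nat pair_pre_digraph).
      pair_graph G \<and> chromatic_number G \<ge> c \<and> girth G \<ge> enat g \<and> k_subdivision p G S \<and> S \<in> \<C>"
  shows "\<not> fo_definable_large_odd_girth \<C>"
proof
  assume def: "fo_definable_large_odd_girth \<C>"
  have mono: "monotone_class \<C>" using hereditary_topologically_closed_monotone[OF C(1,2,4)] .
  define m where "m = (if even p then p + 1 else Suc (p + 1))"
  have m: "odd m" by (simp add: m_def)
  show False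
  proof (rule large_odd_girth_not_definable[OF mono C(1) def m])
    fix c L :: nat
    obtain G S :: "nat pair_pre_digraph" where G: "pair_graph G" "chromatic_number G \<ge> Suc c" "girth G \<ge> enat (Suc L)"
      and S: "k_subdivision p G S" "S \<in> \<C>" using sub by blast
    have "\<not> colorable c G"
    proof
      assume "colorable c G"
      then have "chromatic_number G \<le> c" unfolding chromatic_number_def colorable_def by (rule Least_le)
      then show False using G(2) by simp
    qed
    moreover have 1: "in_class \<C> (subdiv_graph (p + 1) G)" using k_subdivision_in_class[OF mono C(1) S] .
    then have "in_class \<C> (subdiv_graph m G)"
      using longer_subdivision_in_class[OF mono C(1,4) G(1) 1] by (simp add: m_def)
    then have "in_class \<C> (copies M (subdiv_graph m G))" for M
      by (rule addable_copies_in_class[OF mono C(1,3) pair_graph_subdiv_graph[OF G(1)]])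
    ultimately show "\<exists>G :: nat pair_pre_digraph. pair_graph G \<and> short_odd_free L (parcs G) \<and>
      \<not> colorable c G \<and> (\<forall>M. in_class \<C> (copies M (subdiv_graph m G)))"
      using G(1) girth_short_odd_free[OF G(1,3)] by (intro exI[of _ G] conjI allI)
  qed
qed

theorem theorem5:
  shows "(\<forall>\<C>. graph_class \<C> \<and> hereditary \<C> \<and> topologically_closed \<C> \<and>
              (somewhere_dense \<C> \<or> bounded_expansion \<C>) \<longrightarrow>
            (fo_definable_large_odd_girth \<C> \<longleftrightarrow> bounded_expansion \<C>))
       \<and> ((\<forall>\<D>. graph_class \<D> \<and> monotone_class \<D> \<and> nowhere_dense \<D> \<and> \<not> bounded_expansion \<D> \<longrightarrow>
              (\<exists>p :: nat. \<forall>c g :: nat. \<exists>(G :: nat pair_pre_digraph) (S :: nat pair_pre_digraph).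
                 pair_graph G \<and> chromatic_number G \<ge> c \<and> girth G \<ge> enat g \<and>
                 k_subdivision p G S \<and> S \<in> \<D>)) \<longrightarrow>
          (\<forall>\<C>. graph_class \<C> \<and> hereditary \<C> \<and> addable \<C> \<and> topologically_closed \<C> \<longrightarrow>
             (fo_definable_large_odd_girth \<C> \<longleftrightarrow> bounded_expansion \<C>)))"
proof (intro conjI allI impI, elim conjE)
  fix \<C> :: "nat pair_pre_digraph set"
  assume C: "graph_class \<C>" "hereditary \<C>" "topologically_closed \<C>" "somewhere_dense \<C> \<or> bounded_expansion \<C>"
  then show "fo_definable_large_odd_girth \<C> \<longleftrightarrow> bounded_expansion \<C>"
    using somewhere_dense_not_definable bounded_expansion_fo_definable by blast
next
  fix \<C> :: "nat pair_pre_digraph set"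
  assume large: "\<forall>\<D>. graph_class \<D> \<and> monotone_class \<D> \<and> nowhere_dense \<D> \<and> \<not> bounded_expansion \<D> \<longrightarrow>
      (\<exists>p :: nat. \<forall>c g :: nat. \<exists>(G :: nat pair_pre_digraph) (S :: nat pair_pre_digraph).
         pair_graph G \<and> chromatic_number G \<ge> c \<and> girth G \<ge> enat g \<and> k_subdivision p G S \<and> S \<in> \<D>)"
    and "graph_class \<C> \<and> hereditary \<C> \<and> addable \<C> \<and> topologically_closed \<C>"
  then have C: "graph_class \<C>" "hereditary \<C>" "addable \<C>" "topologically_closed \<C>" by blast+
  show "fo_definable_large_odd_girth \<C> \<longleftrightarrow> bounded_expansion \<C>"
  proof
    assume def: "fo_definable_large_odd_girth \<C>"
    \<comment> \<open>The somewhere dense case is already excluded. Without bounded expansion the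
      assumed statement would apply to the class itself and contradict definability.\<close>
    then have "nowhere_dense \<C>"
      using somewhere_dense_not_definable[OF C(1,2,4)] by (auto simp: nowhere_dense_def)
    moreover have "monotone_class \<C>" using hereditary_topologically_closed_monotone[OF C(1,2,4)] .
    ultimately show "bounded_expansion \<C>"
      using large[rule_format, of \<C>] C(1) large_subdivisions_not_definable[OF C] def by blast
  qed (rule bounded_expansion_fo_definable[OF _ C(1)])
qed

end
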